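(* There is a polynomial time algorithm that, for any $\Delta$-regular graph $G=(V,E)$ with $n=|V|$ vertices and any $0<\delta<1$, returns a set $S\subseteq V$ of size $|S|\geq 3\delta n/8$ with $$\lambda_2(L_{G[S]}) \gtrsim \frac{\delta^2\lambda^2}{\Delta\,\log^2\delta},$$ where $\lambda=\lambda(\delta)$.
   Context: $G$ is an undirected, unweighted, $\Delta$-regular graph. For vertices $u,v$ let $\mathbf{1}_{u,v}\in\mathbb{R}^V$ be the vector that is $1$ at $v$, $-1$ at $u$ and $0$ elsewhere, and $L_{u,v}=\mathbf{1}_{u,v}\mathbf{1}_{u,v}^\intercal$. The Laplacian of a graph $H$ is $L_H=\sum_{\{u,v\}\in E(H)}L_{u,v}$, and $\lambda_2(L_H)$ is its second smallest eigenvalue. $G[S]$ is the subgraph induced on $S$. For $0<\delta\le 1$, $\lambda(\delta):=\max_{S\subseteq V:\,|S|\geq\delta n}\lambda_2(L_{G[S]})$. $\log^2\delta$ means $(\log\delta)^2$; $A\gtrsim B$ means $A\geq cB$ for an absolute constant $c>0$.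
   Formalization: log²δ is replaced by max(1, ln²δ), since the literal bound fails as δ→1 (K₂: the right side is unbounded while λ₂ ≤ 2); it agrees up to constants for δ bounded away from 1. δ is taken rational as a finite input; any real δ can be replaced by a rational one with no weaker guarantees. *)

theory Defs
  imports
    "HOL-Library.Log_Nat"
    "HOL-Computational_Algebra.Computational_Algebra"
    "Jordan_Normal_Form.Char_Poly"
begin

section \<open>Graphs, Laplacians and \<open>\<lambda>\<^sub>2\<close>\<close>

definition simple_graph :: "nat set \<Rightarrow> nat set set \<Rightarrow> bool" where
  "simple_graph V E \<longleftrightarrow> finite V \<and> (\<forall>e\<in>E. \<exists>u v. u \<in> V \<and> v \<in> V \<and> u \<noteq> v \<and> e = {u, v})"

definition regular_graph :: "nat set \<Rightarrow> nat set set \<Rightarrow> nat \<Rightarrow> bool" where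
  "regular_graph V E \<Delta> \<longleftrightarrow> simple_graph V E \<and> (\<forall>v\<in>V. card {e \<in> E. v \<in> e} = \<Delta>)"

definition induced_edges :: "nat set set \<Rightarrow> nat set \<Rightarrow> nat set set" where
  "induced_edges E S = {e \<in> E. e \<subseteq> S}"

text \<open>The space of real vectors indexed by a finite vertex set \<open>V\<close> is identified with the vectors of
  dimension \<open>card V\<close> through the increasing enumeration of \<open>V\<close>; the spectrum does not depend
  on the enumeration.\<close>

definition edge_vec :: "nat set \<Rightarrow> nat \<Rightarrow> nat \<Rightarrow> real vec" where
  "edge_vec V u v = vec (card V) (\<lambda>i. let w = sorted_list_of_set V ! i in
     if w = v then 1 else if w = u then - 1 else 0)"

definition edge_laplacian :: "nat set \<Rightarrow> nat \<Rightarrow> nat \<Rightarrow> real mat" where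
  "edge_laplacian V u v =
     mat (card V) (card V) (\<lambda>(i, j). edge_vec V u v $ i * edge_vec V u v $ j)"

text \<open>The entrywise sum of the matrices of the edges. An edge is oriented from its smaller to its larger
  endpoint, which is immaterial since \<open>edge_laplacian\<close> is symmetric in the endpoints.\<close>

definition laplacian :: "nat set \<Rightarrow> nat set set \<Rightarrow> real mat" where
  "laplacian V E =
     mat (card V) (card V) (\<lambda>(i, j). \<Sum>e\<in>E. edge_laplacian V (Min e) (Max e) $$ (i, j))"

text \<open>The second smallest eigenvalue, counted with multiplicity, of a real symmetric matrix (all roots
  of its characteristic polynomial are real). Matrices of dimension at most 1 have no
  second eigenvalue and get the value 0. As a Laplacian has no negative eigenvalue, a graph with at
  most one vertex thus never has a better \<open>\<lambda>\<^sub>2\<close> than a larger one.\<close>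

definition lambda2 :: "real mat \<Rightarrow> real" where
  "lambda2 A =
     (if dim_row A < 2 then 0 else sorted_list_of_multiset (proots (char_poly A)) ! 1)"

definition lambda2_induced :: "nat set set \<Rightarrow> nat set \<Rightarrow> real" where
  "lambda2_induced E S = lambda2 (laplacian S (induced_edges E S))"

definition lambda_max :: "nat set \<Rightarrow> nat set set \<Rightarrow> real \<Rightarrow> real" where
  "lambda_max V E \<delta> =
     Max {lambda2_induced E S | S. S \<subseteq> V \<and> real (card S) \<ge> \<delta> * real (card V)}"

section \<open>The logarithmic factor\<close>

text \<open>Read literally over the whole range \<open>0 < \<delta> < 1\<close>, a lower bound of order
  \<open>\<delta>\<^sup>2 \<lambda>\<^sup>2 / (\<Delta> (log \<delta>)\<^sup>2)\<close> is impossible: for a fixed connected graph it tends to infinity as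
  \<open>\<delta>\<close> tends to 1, whereas \<open>\<lambda>\<^sub>2\<close> of an induced subgraph is at most \<open>2 \<Delta>\<close>. As usual for such
  a factor, \<open>(log \<delta>)\<^sup>2\<close> is kept from vanishing. This changes nothing for \<open>\<delta> \<le> 1/e\<close>, and only
  a constant factor on every range \<open>\<delta> \<le> \<delta>\<^sub>0\<close> with \<open>\<delta>\<^sub>0 < 1\<close>.\<close>

definition log_sq :: "real \<Rightarrow> real" where
  "log_sq \<delta> = max 1 ((ln \<delta>)\<^sup>2)"

lemma log_sq_eq:
  assumes "0 < \<delta>" "\<delta> \<le> exp (- 1)"
  shows "log_sq \<delta> = (ln \<delta>)\<^sup>2"
proof -
  have "ln \<delta> \<le> - 1"
    using assms by (metis exp_gt_zero ln_exp ln_le_cancel_iff)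
  then have "1\<^sup>2 \<le> (- ln \<delta>)\<^sup>2"
    by (intro power_mono) auto
  then show ?thesis by (simp add: log_sq_def)
qed

lemma log_sq_le:
  assumes "0 < \<delta>" "\<delta> \<le> \<delta>0" "\<delta>0 < 1"
  shows "log_sq \<delta> \<le> max 1 (1 / (ln \<delta>0)\<^sup>2) * (ln \<delta>)\<^sup>2"
proof -
  have le: "ln \<delta> \<le> ln \<delta>0" and neg: "ln \<delta>0 < 0"
    using assms by auto
  have "(- ln \<delta>0)\<^sup>2 \<le> (- ln \<delta>)\<^sup>2"
    using le neg by (intro power_mono) auto
  then have "1 \<le> 1 / (ln \<delta>0)\<^sup>2 * (ln \<delta>)\<^sup>2"
    using neg by (simp add: field_simps)
  moreover have "1 / (ln \<delta>0)\<^sup>2 * (ln \<delta>)\<^sup>2 \<le> max 1 (1 / (ln \<delta>0)\<^sup>2) * (ln \<delta>)\<^sup>2"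
    and "1 * (ln \<delta>)\<^sup>2 \<le> max 1 (1 / (ln \<delta>0)\<^sup>2) * (ln \<delta>)\<^sup>2"
    by (intro mult_right_mono; simp)+
  ultimately show ?thesis by (simp add: log_sq_def)
qed

section \<open>Algorithms and their running time\<close>

text \<open>A deterministic random access machine under the logarithmic cost criterion (Cook and
  Reckhow; Aho, Hopcroft and Ullman), presented as a structured programming language.
  The memory consists of named banks of integer cells; a program mentions finitely many of them.
  Every elementary operation is charged the total bit size of its operands, including
  the addresses used, so the time is polynomially related to that of Turing machines. A condition
  holds iff its value is positive.\<close>

datatype arith = Add | Sub | Mul | Div

datatype aexp = Const int | Cell string aexp | Op arith aexp aexp

datatype com =
    Skip
  | Store string aexp aexp
  | Seq com com
  | If aexp com com
  | While aexp com

type_synonym state = "string \<Rightarrow> int \<Rightarrow> int"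

definition bit_size :: "int \<Rightarrow> nat" where
  "bit_size i = floorlog 2 (nat \<bar>i\<bar>) + 1"

fun arith_val :: "arith \<Rightarrow> int \<Rightarrow> int \<Rightarrow> int" where
  "arith_val Add i j = i + j"
| "arith_val Sub i j = i - j"
| "arith_val Mul i j = i * j"
| "arith_val Div i j = i div j"

fun aval :: "aexp \<Rightarrow> state \<Rightarrow> int" where
  "aval (Const i) s = i"
| "aval (Cell x a) s = s x (aval a s)"
| "aval (Op f a b) s = arith_val f (aval a s) (aval b s)"

fun acost :: "aexp \<Rightarrow> state \<Rightarrow> nat" where
  "acost (Const i) s = bit_size i"
| "acost (Cell x a) s = acost a s + bit_size (aval a s) + bit_size (s x (aval a s))"
| "acost (Op f a b) s = acost a s + acost b s + bit_size (aval a s) + bit_size (aval b s)"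

inductive exec :: "com \<Rightarrow> state \<Rightarrow> nat \<Rightarrow> state \<Rightarrow> bool" where
  Skip: "exec Skip s 1 s"
| Store: "exec (Store x a b) s
     (acost a s + acost b s + bit_size (aval a s) + bit_size (aval b s))
     (s(x := (s x)(aval a s := aval b s)))"
| Seq: "exec c s t s' \<Longrightarrow> exec d s' t' s'' \<Longrightarrow> exec (Seq c d) s (t + t') s''"
| IfTrue: "aval b s > 0 \<Longrightarrow> exec c s t s' \<Longrightarrow>
     exec (If b c d) s (acost b s + bit_size (aval b s) + t) s'"
| IfFalse: "\<not> aval b s > 0 \<Longrightarrow> exec d s t s' \<Longrightarrow>
     exec (If b c d) s (acost b s + bit_size (aval b s) + t) s'"
| WhileFalse: "\<not> aval b s > 0 \<Longrightarrow> exec (While b c) s (acost b s + bit_size (aval b s)) s"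
| WhileTrue: "aval b s > 0 \<Longrightarrow> exec c s t s' \<Longrightarrow> exec (While b c) s' t' s'' \<Longrightarrow>
     exec (While b c) s (acost b s + bit_size (aval b s) + t + t') s''"

text \<open>The input is a finite list of integers, stored in the first cells of bank \<open>in\<close>; all
  other cells are initially 0.\<close>

definition input_state :: "int list \<Rightarrow> state" where
  "input_state xs = (\<lambda>x i. if x = ''in'' \<and> 0 \<le> i \<and> i < int (length xs) then xs ! nat i else 0)"

definition input_size :: "int list \<Rightarrow> nat" where
  "input_size xs = (\<Sum>x\<leftarrow>xs. bit_size x)"

text \<open>\<open>poly_time_solves c enc I ok\<close>: on every instance \<open>x \<in> I\<close>, encoded by \<open>enc\<close>, the program \<open>c\<close>
  halts in time polynomial in the input size, in a final state \<open>s\<close> with \<open>ok x s\<close>.\<close>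

definition poly_time_solves ::
    "com \<Rightarrow> ('a \<Rightarrow> int list) \<Rightarrow> 'a set \<Rightarrow> ('a \<Rightarrow> state \<Rightarrow> bool) \<Rightarrow> bool" where
  "poly_time_solves c enc I ok \<longleftrightarrow>
     (\<exists>p :: nat poly. \<forall>x\<in>I. \<exists>t s.
        exec c (input_state (enc x)) t s \<and> t \<le> poly p (input_size (enc x)) \<and> ok x s)"

text \<open>An instance is a graph on the vertices \<open>0, \<dots>, n - 1\<close> together with the parameter \<open>\<delta>\<close>, which
  is rational so that it is a finite input. It is given by \<open>n\<close>, the numerator and the
  denominator of \<open>\<delta>\<close> in lowest terms, and the rows of the adjacency matrix.\<close>

definition encode :: "nat \<times> nat set set \<times> rat \<Rightarrow> int list" where
  "encode = (\<lambda>(n, E, \<delta>).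
     [int n, fst (quotient_of \<delta>), snd (quotient_of \<delta>)] @
     concat (map (\<lambda>u. map (\<lambda>v. if {u, v} \<in> E then 1 else 0) [0..<n]) [0..<n]))"

definition instances :: "(nat \<times> nat set set \<times> rat) set" where
  "instances = {(n, E, \<delta>). (\<exists>\<Delta>. regular_graph {..<n} E \<Delta>) \<and> 0 < \<delta> \<and> \<delta> < 1}"

text \<open>The returned vertex set, read off bank \<open>out\<close> as a characteristic vector.\<close>

definition output_set :: "nat \<Rightarrow> state \<Rightarrow> nat set" where
  "output_set n s = {v. v < n \<and> s ''out'' (int v) \<noteq> 0}"

text \<open>Rational parameters lose no generality: for every graph size, a real \<open>\<delta>\<close> can be replaced by a
  rational one whose guarantees are at least as strong.\<close>

lemma real_parameter_by_rational:
  fixes \<delta> :: real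
  assumes "0 < \<delta>" "\<delta> < 1" "finite V"
  obtains r :: rat where "0 < r" "r < 1" "\<delta> \<le> of_rat r"
    and "lambda_max V E (of_rat r) = lambda_max V E \<delta>"
    and "3 * \<delta> * real (card V) / 8 \<le> 3 * of_rat r * real (card V) / 8"
    and "\<delta>\<^sup>2 * (lambda_max V E \<delta>)\<^sup>2 / (real \<Delta> * log_sq \<delta>)
      \<le> (of_rat r)\<^sup>2 * (lambda_max V E (of_rat r))\<^sup>2 / (real \<Delta> * log_sq (of_rat r))"
proof -
  define n where "n = real (card V)"
  have "\<exists>r :: rat. \<delta> \<le> of_rat r \<and> of_rat r < (1 :: real) \<and>
      (\<forall>k :: nat. \<delta> * n \<le> real k \<longleftrightarrow> of_rat r * n \<le> real k)"
  proof (cases "n = 0 \<or> \<delta> * n \<in> \<int>")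
    case n0: True
    show ?thesis
    proof (cases "n = 0")
      case True
      obtain r :: rat where "\<delta> < of_rat r" "of_rat r < (1 :: real)"
        using of_rat_dense[OF assms(2)] by blast
      then show ?thesis using True by (intro exI[of _ r]) auto
    next
      case False
      with n0 obtain m where "\<delta> * n = of_int m" by (auto elim: Ints_cases)
      then have "\<delta> = of_rat (of_int m / of_nat (card V))"
        using False by (simp add: n_def of_rat_divide field_simps)
      then show ?thesis using assms by (metis order_refl)
    qed
  next
    case False
    then have n: "n > 0" by (auto simp: n_def)
    define m where "m = \<lceil>\<delta> * n\<rceil>"
    have m: "\<delta> * n < of_int m"
      using False unfolding m_def
      by (metis Ints_of_int le_of_int_ceiling order_less_le)
    have "\<delta> < min 1 (of_int m / n)"
      using m n assms by (simp add: field_simps)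
    then obtain r :: rat where r: "\<delta> < of_rat r" "of_rat r < min 1 (of_int m / n)"
      using of_rat_dense by blast
    have "\<delta> * n \<le> real k \<longleftrightarrow> of_rat r * n \<le> real k" for k
    proof
      assume "\<delta> * n \<le> real k"
      then have "m \<le> int k" unfolding m_def by linarith
      moreover have "of_rat r * n < of_int m" using r n by (simp add: field_simps)
      ultimately show "of_rat r * n \<le> real k" by linarith
    next
      assume "of_rat r * n \<le> real k"
      moreover have "\<delta> * n \<le> of_rat r * n" using r n by simp
      ultimately show "\<delta> * n \<le> real k" by linarith
    qed
    then show ?thesis using r by (intro exI[of _ r]) auto
  qed
  then obtain r :: rat where r: "\<delta> \<le> of_rat r" "of_rat r < (1 :: real)"
    and k: "\<And>k :: nat. \<delta> * n \<le> real k \<longleftrightarrow> of_rat r * n \<le> real k"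
    by blast
  have l: "lambda_max V E (of_rat r) = lambda_max V E \<delta>"
    unfolding lambda_max_def using k by (simp add: n_def)
  have r0: "0 < (of_rat r :: real)" using assms r by linarith
  have sq: "\<delta>\<^sup>2 \<le> (of_rat r)\<^sup>2" using r assms by (intro power_mono) auto
  have "(- ln (of_rat r))\<^sup>2 \<le> (- ln \<delta>)\<^sup>2"
    using r r0 assms by (intro power_mono) auto
  then have lg: "log_sq (of_rat r) \<le> log_sq \<delta>" by (auto simp: log_sq_def)
  have pos: "0 < log_sq (of_rat r)" by (simp add: log_sq_def less_max_iff_disj)
  have b: "\<delta>\<^sup>2 * (lambda_max V E \<delta>)\<^sup>2 / (real \<Delta> * log_sq \<delta>)
      \<le> (of_rat r)\<^sup>2 * (lambda_max V E (of_rat r))\<^sup>2 / (real \<Delta> * log_sq (of_rat r))"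
  proof (cases "\<Delta> = 0")
    case False
    then show ?thesis
      unfolding l using sq lg pos
      by (intro frac_le mult_right_mono mult_left_mono mult_nonneg_nonneg mult_pos_pos) auto
  qed simp
  show ?thesis
    using that[of r] r r0 l b by (auto simp: mult_right_mono)
qed

end

theory Submission
  imports Defs
begin

text \<open>Write \<open>n\<close> for the number of vertices. Among the threshold cuts \<open>{u. x u > x w}\<close> of the vectors
  \<open>x = (2 n I - L)\<^sup>t e\<^sub>i\<close> with \<open>t < 8 n\<^sup>5\<close>, which are exact integer vectors, the one of least
  ratio \<open>\<rho> = e(C, S - C) / min |C| |S - C|\<close> certifies \<open>\<lambda>\<^sub>2(G[S]) \<ge> \<rho>\<^sup>2 / (8 \<Delta>)\<close>: by Cheeger's rounding
  all the iterates have Rayleigh quotient at least \<open>\<rho>\<^sup>2 / (2 \<Delta>)\<close> away from the constants, so they decay at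
  a corresponding rate, whereas the component of some \<open>e\<^sub>i\<close> along a \<open>\<lambda>\<^sub>2\<close>-eigenvector decays at rate
  \<open>1 - \<lambda>\<^sub>2 / (2 n)\<close> only.

  The algorithm splits the vertex set along such cuts down to singletons and returns the piece of best ratio
  among those of size at least \<open>3 \<delta> n / 8\<close>. Let \<open>T\<close> attain \<open>\<lambda> = \<lambda>(\<delta>)\<close> and let \<open>\<phi> = \<delta> \<lambda> / 8\<close>. Follow the
  piece that contains most of \<open>T\<close> as long as the cuts have ratio below \<open>\<phi>\<close>. Each such cut costs at most \<open>\<phi>\<close> times the
  number of vertices discarded, no matter which side is kept, so at most \<open>\<phi> n \<le> \<lambda> |T| / 8\<close> edges
  separate the part of \<open>T\<close> in the piece from the rest of \<open>T\<close>. As \<open>G[T]\<close> has spectral gap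
  \<open>\<lambda>\<close>, the fraction \<open>p\<close> of \<open>T\<close> in the piece satisfies \<open>p (1 - p) \<le> 1/8\<close>; a single cut cannot take it from
  at least \<open>3/4\<close> to below \<open>3/8\<close>, so it stays at least \<open>3/4\<close>. Hence the path must meet a piece of
  ratio at least \<open>\<phi>\<close>, and even the logarithmic factor is not lost.\<close>

section \<open>Orthogonal diagonalization of real symmetric matrices\<close>

text \<open>Two obstacles shape the argument. Eigenvectors are irrational in general, while the
  machine computes with exact integers; so no eigenvector or eigenvalue is ever approximated.
  Eigenvectors occur in the analysis only, and enough integer iterates are swept to make it work.
  Moreover neither \<open>T\<close> nor \<lambda> is known to the algorithm, so there is no
  threshold at which to stop splitting: every piece is split, the best one is recorded, and \<phi>
  exists in the analysis only. As \<open>\<lambda>\<^sub>2\<close> is not monotone in the vertex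
  set, a piece is compared with \<open>T\<close> only through the number of edges of
  \<open>T\<close> cut so far. Origin of the constants: the gap of \<open>T\<close> gives \<lambda>
  p (1 - p) |T| \<le> \<phi> n, and \<phi> = \<delta> \<lambda> / 8 with \<delta> n \<le> |T| turns
  this into p (1 - p) \<le> 1/8, which excludes the whole range from 3/8 to 3/4. Keeping the side
  with the larger share of \<open>T\<close> retains at least half of 3/4. The final constant 1/512
  is 1 / (8 * 8^2): one 8 from the certificate, 8^2 from \<phi>^2.\<close>

no_notation fps_nth (infixl "$" 75)

text \<open>For n > 0 the characteristic polynomial has a complex root z. With a complex eigenvector
  v, the number v* A v = z |v|^2 equals its own conjugate because A is real symmetric, so z is real;
  as a real root it also has a real eigenvector.\<close>

lemma symmetric_mat_eigenvector_exists:
  fixes A :: "real mat"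
  assumes A: "A \<in> carrier_mat n n" and sym: "transpose_mat A = A" and n: "n > 0"
  shows "\<exists>e v. eigenvector A v e"
proof -
  let ?B = "map_mat complex_of_real A"
  have B: "?B \<in> carrier_mat n n" using A by simp
  have "degree (char_poly ?B) = n"
    using degree_monic_char_poly[OF B] by simp
  then obtain z where "poly (char_poly ?B) z = 0"
    using n fundamental_theorem_of_algebra[of "char_poly ?B"] by (auto simp: constant_degree)
  then have "eigenvalue ?B z" using eigenvalue_root_char_poly[OF B] by simp
  then obtain v where v: "v \<in> carrier_vec n" "v \<noteq> 0\<^sub>v n" "?B *\<^sub>v v = z \<cdot>\<^sub>v v"
    unfolding eigenvalue_def eigenvector_def using B by auto
  have Bv: "(\<Sum>j<n. complex_of_real (A $$ (i,j)) * v $ j) = z * v $ i" if "i < n" for i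
  proof -
    have "(?B *\<^sub>v v) $ i = (\<Sum>j<n. complex_of_real (A $$ (i,j)) * v $ j)"
      using that A v(1) by (auto simp: scalar_prod_def lessThan_atLeast0)
    then show ?thesis using v that by simp
  qed
  have symA: "A $$ (i,j) = A $$ (j,i)" if "i < n" "j < n" for i j
    using sym A that by (metis carrier_matD index_transpose_mat(1))
  define Q where "Q = (\<Sum>i<n. \<Sum>j<n. cnj (v $ i) * complex_of_real (A $$ (i,j)) * v $ j)"
  define N where "N = (\<Sum>i<n. (cmod (v $ i))\<^sup>2)"
  have "Q = (\<Sum>i<n. cnj (v $ i) * (z * v $ i))"
    unfolding Q_def
    by (rule sum.cong) (auto simp: Bv[symmetric] sum_distrib_left mult.assoc)
  also have "\<dots> = (\<Sum>i<n. z * complex_of_real ((cmod (v $ i))\<^sup>2))"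
    by (rule sum.cong) (auto simp: complex_norm_square mult_ac simp del: of_real_power)
  also have "\<dots> = z * complex_of_real N"
    by (simp add: N_def sum_distrib_left)
  finally have QN: "Q = z * complex_of_real N" .
  have "cnj Q = (\<Sum>i<n. \<Sum>j<n. cnj (v $ j) * complex_of_real (A $$ (i,j)) * v $ i)"
    unfolding Q_def by (simp add: mult_ac)
  also have "\<dots> = (\<Sum>j<n. \<Sum>i<n. cnj (v $ j) * complex_of_real (A $$ (i,j)) * v $ i)"
    by (rule sum.swap)
  also have "\<dots> = Q" unfolding Q_def by (intro sum.cong refl) (auto simp: symA)
  finally have "cnj z * complex_of_real N = z * complex_of_real N"
    using QN by (metis complex_cnj_complex_of_real complex_cnj_mult)
  moreover have "N \<noteq> 0"
  proof
    assume "N = 0"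
    then have "\<forall>i<n. v $ i = 0" unfolding N_def by (subst (asm) sum_nonneg_eq_0_iff) auto
    then have "v = 0\<^sub>v n" using v(1) by (intro eq_vecI) auto
    then show False using v by simp
  qed
  ultimately have "cnj z = z" by simp
  then have z: "z = complex_of_real (Re z)"
    by (metis Reals_cnj_iff of_real_Re)
  have "poly (char_poly ?B) z = complex_of_real (poly (char_poly A) (Re z))"
    by (subst z) (simp add: of_real_hom.char_poly_hom[OF A])
  then have "poly (char_poly A) (Re z) = 0"
    using \<open>poly (char_poly ?B) z = 0\<close> by simp
  then have "eigenvalue A (Re z)" using eigenvalue_root_char_poly[OF A] by simp
  then show ?thesis unfolding eigenvalue_def by blast
qed

text \<open>The witness is a Householder reflection.\<close>
lemma orthogonal_symmetric_mat_with_col: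
  fixes v :: "real vec"
  assumes v: "v \<in> carrier_vec n" and n: "n > 0" and unit: "v \<bullet> v = 1"
  shows "\<exists>H \<in> carrier_mat n n. transpose_mat H = H \<and> H * H = 1\<^sub>m n \<and> col H 0 = v"
proof (cases "v $ 0 = 1")
  case True
  have "v \<bullet> v = (\<Sum>i<n. (v $ i)\<^sup>2)"
    using v by (auto simp: scalar_prod_def lessThan_atLeast0 power2_eq_square)
  also have "\<dots> = (v $ 0)\<^sup>2 + (\<Sum>i\<in>{..<n}-{0}. (v $ i)\<^sup>2)"
    using n by (subst sum.remove[of _ 0]) auto
  finally have "(\<Sum>i\<in>{..<n}-{0}. (v $ i)\<^sup>2) = 0" using unit True by simp
  then have "\<forall>i\<in>{..<n}-{0}. v $ i = 0" by (subst (asm) sum_nonneg_eq_0_iff) auto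
  then have "col (1\<^sub>m n) 0 = v" using v n True by (intro eq_vecI) auto
  then show ?thesis by (intro bexI[of _ "1\<^sub>m n"]) auto
next
  case False
  \<comment> \<open>\<open>w\<close> is v - e_0 and \<open>c\<close> is half its squared norm
    (\<open>ww\<close>), so \<open>H\<close> is I - 2 w w^T / |w|^2, which exchanges e_0 and v. For
    v = e_0 this degenerates, whence the separate case.\<close>
  define w where "w i = v $ i - (if i = 0 then 1 else 0)" for i
  define c where "c = 1 - v $ 0"
  have vv: "(\<Sum>i<n. (v $ i)\<^sup>2) = 1"
    using v unit by (auto simp: scalar_prod_def lessThan_atLeast0 power2_eq_square)
  have c0: "c \<noteq> 0" using False by (simp add: c_def)
  have ww: "(\<Sum>i<n. w i * w i) = 2 * c"
  proof -
    have "(\<Sum>i<n. w i * w i) = (\<Sum>i<n. (v $ i)\<^sup>2 + (if i = 0 then 1 - 2 * v $ 0 else 0))"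
      by (rule sum.cong) (auto simp: w_def power2_eq_square algebra_simps)
    then show ?thesis using n by (simp add: sum.distrib vv c_def)
  qed
  define H where "H = mat n n (\<lambda>(i,j). (if i = j then 1 else 0) - w i * w j / c)"
  have H: "H \<in> carrier_mat n n" by (simp add: H_def)
  have "H * H = 1\<^sub>m n"
  proof (rule eq_matI)
    fix i j assume ij: "i < dim_row (1\<^sub>m n :: real mat)" "j < dim_col (1\<^sub>m n :: real mat)"
    then have "(H * H) $$ (i,j) =
        (\<Sum>k<n. ((if i = k then 1 else 0) - w i * w k / c) * ((if k = j then 1 else 0) - w k * w j / c))"
      by (auto simp: H_def scalar_prod_def lessThan_atLeast0)
    also have "\<dots> = (\<Sum>k<n. (if k = j then (if i = k then 1 else 0) else 0)
        - (if k = i then w k * w j / c else 0) - (if k = j then w i * w k / c else 0)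
        + (w k * w k) * (w i * w j / (c * c)))"
      by (rule sum.cong) (auto simp: algebra_simps)
    also have "\<dots> = (if i = j then 1 else 0)"
      unfolding sum.distrib sum_subtractf sum_distrib_right[symmetric] ww
      using ij c0 by simp
    finally show "(H * H) $$ (i,j) = 1\<^sub>m n $$ (i,j)" using ij by simp
  qed (auto simp: H_def)
  moreover have "transpose_mat H = H" by (rule eq_matI) (auto simp: H_def)
  moreover have "col H 0 = v"
    using v n c0 by (intro eq_vecI) (auto simp: H_def w_def c_def field_simps)
  ultimately show ?thesis using H by blast
qed

text \<open>Deflation by induction on the dimension. Conjugation with a reflection that has a unit
  eigenvector as column 0 makes column 0 a multiple of e_0, by symmetry row 0 as well, and a smaller
  symmetric block remains. Its diagonalization is bordered by a 1 and composed with the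
  reflection.\<close>

theorem symmetric_mat_orthogonally_diagonalizable:
  fixes A :: "real mat"
  assumes "A \<in> carrier_mat n n" "transpose_mat A = A"
  shows "\<exists>P \<in> carrier_mat n n. \<exists>D \<in> carrier_mat n n.
    transpose_mat P * P = 1\<^sub>m n \<and> P * transpose_mat P = 1\<^sub>m n \<and> diagonal_mat D \<and> A = P * D * transpose_mat P"
  using assms
proof (induction n arbitrary: A)
  case 0
  then show ?case by (intro bexI[of _ A]) (auto simp: diagonal_mat_def)
next
  case (Suc n)
  let ?n = "Suc n"
  note A = Suc.prems(1) and sym = Suc.prems(2)
  obtain e u where u: "eigenvector A u e"
    using symmetric_mat_eigenvector_exists[OF A sym] by auto
  then have u': "u \<in> carrier_vec ?n" "u \<noteq> 0\<^sub>v ?n" "A *\<^sub>v u = e \<cdot>\<^sub>v u"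
    using A by (auto simp: eigenvector_def)
  have uu: "u \<bullet> u > 0"
    using conjugate_square_greater_0_vec[OF u'(1)] u'(2) by simp
  define v where "v = (1 / sqrt (u \<bullet> u)) \<cdot>\<^sub>v u"
  have v: "v \<in> carrier_vec ?n" using u' by (simp add: v_def)
  have vv: "v \<bullet> v = 1" using uu u' by (simp add: v_def)
  have Av: "A *\<^sub>v v = e \<cdot>\<^sub>v v"
    using u' A by (simp add: v_def mult_mat_vec smult_smult_assoc mult.commute)
  obtain H where H: "H \<in> carrier_mat ?n ?n" and Hs: "transpose_mat H = H"
    and HH: "H * H = 1\<^sub>m ?n" and Hv: "col H 0 = v"
    using orthogonal_symmetric_mat_with_col[OF v _ vv] by auto
  define B where "B = H * A * H"
  have B: "B \<in> carrier_mat ?n ?n" using A H by (simp add: B_def)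
  have Bs: "transpose_mat B = B"
  proof -
    have "transpose_mat (H * A * H) = transpose_mat H * transpose_mat (H * A)"
      by (rule transpose_mult) (use A H in auto)
    also have "\<dots> = H * (A * H)" using transpose_mult[OF H A] Hs sym by simp
    also have "\<dots> = H * A * H" using A H by (simp add: assoc_mult_mat[of _ ?n ?n _ ?n _ ?n])
    finally show ?thesis by (simp add: B_def)
  qed
  have He: "H *\<^sub>v v = unit_vec ?n 0"
  proof -
    have "H *\<^sub>v col H 0 = col (H * H) 0" using col_mult2[OF H H, of 0] by simp
    then show ?thesis using HH Hv by simp
  qed
  have B0: "col B 0 = e \<cdot>\<^sub>v unit_vec ?n 0"
  proof -
    have "col B 0 = (H * A) *\<^sub>v v"
      using col_mult2[of "H * A" ?n ?n H ?n 0] H A Hv by (simp add: B_def)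
    also have "\<dots> = H *\<^sub>v (A *\<^sub>v v)" using H A v by (simp add: assoc_mult_mat_vec)
    also have "\<dots> = e \<cdot>\<^sub>v unit_vec ?n 0" using H v He by (simp add: Av mult_mat_vec)
    finally show ?thesis .
  qed
  have Bi0: "B $$ (i, 0) = (if i = 0 then e else 0)" if "i < ?n" for i
    using arg_cong[OF B0, of "\<lambda>x :: real vec. x $ i"] that B by auto
  have B0i: "B $$ (0, i) = (if i = 0 then e else 0)" if "i < ?n" for i
    using Bi0[OF that] Bs B that by (metis carrier_matD index_transpose_mat(1) zero_less_Suc)
  define A' where "A' = mat n n (\<lambda>(i,j). B $$ (Suc i, Suc j))"
  have A': "A' \<in> carrier_mat n n" by (simp add: A'_def)
  have "transpose_mat A' = A'"
    using Bs B by (intro eq_matI) (auto simp: A'_def,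
      metis Suc_less_eq carrier_matD index_transpose_mat(1))
  from Suc.IH[OF A' this] obtain P D where P: "P \<in> carrier_mat n n" and D: "D \<in> carrier_mat n n"
    and PP: "transpose_mat P * P = 1\<^sub>m n" "P * transpose_mat P = 1\<^sub>m n" and dD: "diagonal_mat D"
    and AP: "A' = P * D * transpose_mat P" by blast
  let ?E = "mat 1 1 (\<lambda>_. e)"
  define P1 where "P1 = four_block_mat (1\<^sub>m 1) (0\<^sub>m 1 n) (0\<^sub>m n 1) P"
  define D1 where "D1 = four_block_mat ?E (0\<^sub>m 1 n) (0\<^sub>m n 1) D"
  have P1: "P1 \<in> carrier_mat ?n ?n" using P unfolding P1_def by auto
  have D1: "D1 \<in> carrier_mat ?n ?n" using D unfolding D1_def by auto
  have P1t: "transpose_mat P1 = four_block_mat (1\<^sub>m 1) (0\<^sub>m 1 n) (0\<^sub>m n 1) (transpose_mat P)"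
    unfolding P1_def by (subst transpose_four_block_mat) (use P in auto)
  have BB: "B = four_block_mat ?E (0\<^sub>m 1 n) (0\<^sub>m n 1) A'"
    using B by (intro eq_matI) (auto simp: A'_def Bi0 B0i)
  have one: "four_block_mat (1\<^sub>m 1) (0\<^sub>m 1 n) (0\<^sub>m n 1) (1\<^sub>m n :: real mat) = 1\<^sub>m ?n"
    by (rule eq_matI) auto
  have P1P: "transpose_mat P1 * P1 = 1\<^sub>m ?n"
    unfolding P1t unfolding P1_def
    by (subst mult_four_block_mat) (use P PP one in auto)
  have PP1: "P1 * transpose_mat P1 = 1\<^sub>m ?n"
    unfolding P1t unfolding P1_def
    by (subst mult_four_block_mat) (use P PP one in auto)
  have PD: "P1 * D1 = four_block_mat ?E (0\<^sub>m 1 n) (0\<^sub>m n 1) (P * D)"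
    unfolding P1_def D1_def by (subst mult_four_block_mat) (use P D in auto)
  have B1: "B = P1 * D1 * transpose_mat P1"
    unfolding PD P1t unfolding BB AP by (subst mult_four_block_mat) (use P D in auto)
  have dD1: "diagonal_mat D1"
    using dD D unfolding diagonal_mat_def D1_def by (auto simp: less_Suc_eq_0_disj, metis)
  let ?P = "H * P1"
  have Pt: "transpose_mat ?P = transpose_mat P1 * H"
    using transpose_mult[OF H P1] Hs by simp
  have tP1: "transpose_mat P1 \<in> carrier_mat ?n ?n" using P1 by simp
  have "transpose_mat ?P * ?P = transpose_mat P1 * (H * H) * P1"
    unfolding Pt using H P1 tP1 by (simp add: assoc_mult_mat[of _ ?n ?n _ ?n _ ?n])
  then have 1: "transpose_mat ?P * ?P = 1\<^sub>m ?n" using HH P1P tP1 by simp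
  have "?P * transpose_mat ?P = H * (P1 * transpose_mat P1) * H"
    unfolding Pt using H P1 tP1 by (simp add: assoc_mult_mat[of _ ?n ?n _ ?n _ ?n])
  then have 2: "?P * transpose_mat ?P = 1\<^sub>m ?n" using HH PP1 H by simp
  have "A = (H * H) * A * (H * H)" using HH A by simp
  also have "\<dots> = H * B * H" unfolding B_def using A H by (simp add: assoc_mult_mat[of _ ?n ?n _ ?n _ ?n])
  also have "\<dots> = ?P * D1 * transpose_mat ?P"
    unfolding Pt B1 using H P1 tP1 D1 by (simp add: assoc_mult_mat[of _ ?n ?n _ ?n _ ?n])
  finally have 3: "A = ?P * D1 * transpose_mat ?P" .
  show ?case
    by (rule bexI[of _ ?P], rule bexI[of _ D1]) (use 1 2 3 dD1 D1 H P1 in auto)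
qed

section \<open>The second smallest eigenvalue\<close>

text \<open>Working with indices keeps multiplicities straight: \<open>j\<close> is a minimizer
  among the indices other than the minimizer \<open>i\<close>, so a repeated least value counts
  twice. Peeling both off the multiset puts their values at the head of the sorted list.\<close>

lemma sorted_image_mset_second:
  fixes d :: "'a \<Rightarrow> real"
  assumes "finite I" "card I \<ge> 2"
  obtains i j where "i \<in> I" "j \<in> I" "i \<noteq> j" "d i \<le> d j" "\<And>k. k \<in> I \<Longrightarrow> k \<noteq> i \<Longrightarrow> d j \<le> d k"
    and "sorted_list_of_multiset (image_mset d (mset_set I)) ! 1 = d j"
proof -
  have ins: "insort x (sorted_list_of_multiset (image_mset d (mset_set K))) =
      x # sorted_list_of_multiset (image_mset d (mset_set K))"
    if "finite K" "\<And>k. k \<in> K \<Longrightarrow> x \<le> d k" for x K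
    by (rule insort_is_Cons) (use that in auto)
  have "I \<noteq> {}" using assms by auto
  then obtain i where i: "i \<in> I" "\<And>k. k \<in> I \<Longrightarrow> d i \<le> d k"
    using ex_min_if_finite[of "d ` I"] assms(1) by (auto simp: not_less)
  have "card (I - {i}) \<ge> 1" using assms i by simp
  then have "I - {i} \<noteq> {}" by (metis card.empty not_one_le_zero)
  then obtain j where j: "j \<in> I - {i}" "\<And>k. k \<in> I - {i} \<Longrightarrow> d j \<le> d k"
    using ex_min_if_finite[of "d ` (I - {i})"] assms(1) by (auto simp: not_less)
  have 1: "mset_set I = add_mset i (mset_set (I - {i}))"
    using i assms(1) by (simp add: mset_set.remove)
  have 2: "mset_set (I - {i}) = add_mset j (mset_set (I - {i} - {j}))"
    by (rule mset_set.remove) (use j assms(1) in auto)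
  have "sorted_list_of_multiset (image_mset d (mset_set I)) =
      d i # d j # sorted_list_of_multiset (image_mset d (mset_set (I - {i} - {j})))"
    unfolding 1 image_mset_add_mset sorted_list_of_multiset_insert
  proof (subst ins)
    have "sorted_list_of_multiset (image_mset d (mset_set (I - {i}))) =
        insort (d j) (sorted_list_of_multiset (image_mset d (mset_set (I - {i} - {j}))))"
      unfolding 2 by simp
    also have "\<dots> = d j # sorted_list_of_multiset (image_mset d (mset_set (I - {i} - {j})))"
      by (rule ins) (use j assms(1) in auto)
    finally show "d i # sorted_list_of_multiset (image_mset d (mset_set (I - {i}))) =
        d i # d j # sorted_list_of_multiset (image_mset d (mset_set (I - {i} - {j})))" by simp
  qed (use i assms(1) in auto)
  then show ?thesis using that[of i j] i j by auto
qed

text \<open>The spectral theorem in coordinates, so that later arguments need sums only. The columns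
  \<open>q k\<close> of \<open>P\<close> are an orthonormal eigenbasis; by similarity the roots of
  the characteristic polynomial are the diagonal entries \<open>d k\<close>, with multiplicity. The
  last two facts are Parseval's identity and the diagonalized quadratic form.\<close>

lemma lambda2_spectrum:
  assumes A: "A \<in> carrier_mat n n" and sym: "transpose_mat A = A" and n: "n \<ge> 2"
  obtains q d i j where
    "i < n" "j < n" "i \<noteq> j" "d i \<le> d j" "d j = lambda2 A"
    "\<And>k. k < n \<Longrightarrow> k \<noteq> i \<Longrightarrow> d j \<le> d k"
    "\<And>k l. k < n \<Longrightarrow> l < n \<Longrightarrow> (\<Sum>r<n. q k r * q l r) = (if k = l then 1 else (0::real))"
    "\<And>k r. k < n \<Longrightarrow> r < n \<Longrightarrow> (\<Sum>s<n. A $$ (r,s) * q k s) = d k * q k r"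
    "\<And>f. (\<Sum>r<n. (f r)\<^sup>2) = (\<Sum>k<n. (\<Sum>r<n. f r * q k r)\<^sup>2)"
    "\<And>f. (\<Sum>r<n. f r * (\<Sum>s<n. A $$ (r,s) * f s)) = (\<Sum>k<n. d k * (\<Sum>r<n. f r * q k r)\<^sup>2)"
proof -
  from symmetric_mat_orthogonally_diagonalizable[OF A sym] obtain P D where
    P: "P \<in> carrier_mat n n" and D: "D \<in> carrier_mat n n" and
    PP: "transpose_mat P * P = 1\<^sub>m n" and PP': "P * transpose_mat P = 1\<^sub>m n" and
    dD: "diagonal_mat D" and APD: "A = P * D * transpose_mat P" by blast
  have "similar_mat A D"
    unfolding similar_mat_def similar_mat_wit_def
    by (rule exI[of _ P], rule exI[of _ "transpose_mat P"]) (use A P D PP PP' APD in auto)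
  then have "char_poly A = char_poly D" by (rule char_poly_similar)
  also have "\<dots> = (\<Prod>a\<leftarrow>diag_mat D. [:- a, 1:])"
    by (rule char_poly_upper_triangular[OF D])
      (use dD D in \<open>auto simp: diagonal_mat_def upper_triangular_def\<close>)
  also have "\<dots> = (\<Prod>k<n. [:- D $$ (k,k), 1:])"
    using D prod.distinct_set_conv_list[of "[0..<n]" "\<lambda>k. [:- D $$ (k,k), 1:]"]
    by (simp add: diag_mat_def comp_def lessThan_atLeast0)
  finally have cp: "char_poly A = (\<Prod>k<n. [:- D $$ (k,k), 1:])" .
  define d where "d k = D $$ (k,k)" for k
  have "proots (char_poly A) = (\<Sum>k<n. proots [:- d k, 1:])"
    unfolding cp d_def by (rule proots_prod) auto
  also have "\<dots> = (\<Sum>k<n. {#d k#})" by (simp add: proots_linear_factor)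
  also have "\<dots> = image_mset d (mset_set {..<n})"
    by (induction n) (auto simp: lessThan_Suc)
  finally have pr: "proots (char_poly A) = image_mset d (mset_set {..<n})" .
  obtain i j where ij: "i < n" "j < n" "i \<noteq> j" "d i \<le> d j"
    "\<And>k. k < n \<Longrightarrow> k \<noteq> i \<Longrightarrow> d j \<le> d k" 
    "sorted_list_of_multiset (image_mset d (mset_set {..<n})) ! 1 = d j"
    using sorted_image_mset_second[of "{..<n}" d] n by auto
  have lam: "d j = lambda2 A" using ij(6) n A by (simp add: lambda2_def pr)
  define q where "q k r = P $$ (r,k)" for k r
  have D0: "D $$ (k,l) = (if k = l then d k else 0)" if "k < n" "l < n" for k l
    using dD D that by (auto simp: diagonal_mat_def d_def)
  have o1: "(\<Sum>r<n. q k r * q l r) = (if k = l then 1 else 0)" if "k < n" "l < n" for k l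
    using arg_cong[OF PP, of "\<lambda>X. X $$ (k,l)"] that P
    by (simp add: q_def scalar_prod_def lessThan_atLeast0)
  have o2: "(\<Sum>k<n. q k r * q k s) = (if r = s then 1 else 0)" if "r < n" "s < n" for r s
    using arg_cong[OF PP', of "\<lambda>X. X $$ (r,s)"] that P
    by (simp add: q_def scalar_prod_def lessThan_atLeast0)
  have Ars: "A $$ (r,s) = (\<Sum>k<n. q k r * d k * q k s)" if "r < n" "s < n" for r s
  proof -
    have "(P * D) $$ (r,k) = q k r * d k" if "k < n" for k
    proof -
      have "(P * D) $$ (r,k) = (\<Sum>l<n. q l r * (if l = k then d l else 0))"
        using that \<open>r < n\<close> P D
        by (auto simp: scalar_prod_def lessThan_atLeast0 q_def D0 intro!: sum.cong)
      also have "\<dots> = (\<Sum>l<n. if l = k then q l r * d l else 0)" by (intro sum.cong) auto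
      also have "\<dots> = q k r * d k" using that by simp
      finally show ?thesis .
    qed
    moreover define X where "X = P * D"
    ultimately have Xrk: "X $$ (r,k) = q k r * d k" if "k < n" for k using that by simp
    have X: "X \<in> carrier_mat n n" using P D by (simp add: X_def)
    have "A $$ (r,s) = (\<Sum>k<n. X $$ (r,k) * q k s)"
      unfolding APD X_def[symmetric] using that P X
      by (auto simp: scalar_prod_def lessThan_atLeast0 q_def intro!: sum.cong)
    then show ?thesis by (simp add: Xrk)
  qed
  have ev: "(\<Sum>s<n. A $$ (r,s) * q k s) = d k * q k r" if "k < n" "r < n" for k r
  proof -
    have "(\<Sum>s<n. A $$ (r,s) * q k s) = (\<Sum>s<n. \<Sum>l<n. (q l r * d l) * (q l s * q k s))"
      using that by (intro sum.cong) (auto simp: Ars sum_distrib_left sum_distrib_right mult_ac)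
    also have "\<dots> = (\<Sum>l<n. (q l r * d l) * (\<Sum>s<n. q l s * q k s))"
      by (subst sum.swap) (simp add: sum_distrib_left)
    also have "\<dots> = (\<Sum>l<n. if l = k then q l r * d l else 0)"
      using that by (intro sum.cong) (auto simp: o1)
    also have "\<dots> = d k * q k r" using that by simp
    finally show ?thesis .
  qed
  \<comment> \<open>Stated for arbitrary weights \<open>c\<close>: weights 1 give Parseval's
    identity, weights \<open>d\<close> the quadratic form of \<open>A\<close>.\<close>
  have quad: "(\<Sum>k<n. c k * (\<Sum>r<n. f r * q k r)\<^sup>2) =
      (\<Sum>r<n. f r * (\<Sum>s<n. (\<Sum>k<n. q k r * c k * q k s) * f s))" for c f
  proof -
    have "(\<Sum>k<n. c k * (\<Sum>r<n. f r * q k r)\<^sup>2) =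
        (\<Sum>k<n. \<Sum>r<n. \<Sum>s<n. f r * (q k r * c k * q k s) * f s)"
      by (simp add: power2_eq_square sum_product sum_distrib_left mult_ac)
    also have "\<dots> = (\<Sum>r<n. \<Sum>k<n. \<Sum>s<n. f r * (q k r * c k * q k s) * f s)"
      by (rule sum.swap)
    also have "\<dots> = (\<Sum>r<n. \<Sum>s<n. \<Sum>k<n. f r * (q k r * c k * q k s) * f s)"
      by (intro sum.cong refl sum.swap)
    finally show ?thesis by (simp add: sum_distrib_left sum_distrib_right mult.assoc)
  qed
  have pars: "(\<Sum>r<n. (f r)\<^sup>2) = (\<Sum>k<n. (\<Sum>r<n. f r * q k r)\<^sup>2)" for f
  proof -
    have "(\<Sum>k<n. (\<Sum>r<n. f r * q k r)\<^sup>2) = (\<Sum>r<n. f r * (\<Sum>s<n. (\<Sum>k<n. q k r * q k s) * f s))"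
      using quad[of "\<lambda>_. 1" f] by simp
    also have "\<dots> = (\<Sum>r<n. f r * (\<Sum>s<n. if s = r then f s else 0))"
      by (intro sum.cong refl arg_cong2[where f = "(*)"]) (auto simp: o2)
    also have "\<dots> = (\<Sum>r<n. (f r)\<^sup>2)" by (simp add: power2_eq_square)
    finally show ?thesis by simp
  qed
  have form: "(\<Sum>r<n. f r * (\<Sum>s<n. A $$ (r,s) * f s)) = (\<Sum>k<n. d k * (\<Sum>r<n. f r * q k r)\<^sup>2)" for f
    unfolding quad by (intro sum.cong refl arg_cong2[where f = "(*)"]) (auto simp: Ars)
  show ?thesis by (rule that[OF ij(1-4) lam ij(5) o1 ev pars form])
qed

text \<open>The eigenvector \<open>q i\<close> of the least eigenvalue need not be constant when the
  kernel has dimension above 1, as for a disconnected graph. Orthogonality to the constants and to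
  \<open>q i\<close> are then different conditions, and the claims pass from one to the other by
  suitable linear combinations.\<close>

lemma lambda2_nonneg_form:
  assumes A: "A \<in> carrier_mat n n" and sym: "transpose_mat A = A" and n: "n \<ge> 2"
    and psd: "\<And>f. (\<Sum>r<n. f r * (\<Sum>s<n. A $$ (r,s) * f s)) \<ge> 0"
    and ker: "\<And>r. r < n \<Longrightarrow> (\<Sum>s<n. A $$ (r,s)) = 0"
  shows lambda2_nonneg: "lambda2 A \<ge> 0"
    and lambda2_eigenvector: "\<exists>f. (\<exists>r<n. f r \<noteq> 0) \<and> (\<Sum>r<n. f r) = 0 \<and>
          (\<forall>r<n. (\<Sum>s<n. A $$ (r,s) * f s) = lambda2 A * f r)"
    and lambda2_variational: "\<And>f. (\<Sum>r<n. f r) = 0 \<Longrightarrow>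
          lambda2 A * (\<Sum>r<n. (f r)\<^sup>2) \<le> (\<Sum>r<n. f r * (\<Sum>s<n. A $$ (r,s) * f s))"
proof -
  obtain q :: "nat \<Rightarrow> nat \<Rightarrow> real" and d i j where i: "i < n" and j: "j < n" and ij: "i \<noteq> j" "d i \<le> d j" and
    lam: "d j = lambda2 A" and least: "\<And>k. k < n \<Longrightarrow> k \<noteq> i \<Longrightarrow> d j \<le> d k" and
    orth: "\<And>k l. k < n \<Longrightarrow> l < n \<Longrightarrow> (\<Sum>r<n. q k r * q l r) = (if k = l then 1 else (0::real))" and
    ev: "\<And>k r. k < n \<Longrightarrow> r < n \<Longrightarrow> (\<Sum>s<n. A $$ (r,s) * q k s) = d k * q k r" and
    pars: "\<And>f. (\<Sum>r<n. (f r)\<^sup>2) = (\<Sum>k<n. (\<Sum>r<n. f r * q k r)\<^sup>2)" and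
    form: "\<And>f. (\<Sum>r<n. f r * (\<Sum>s<n. A $$ (r,s) * f s)) = (\<Sum>k<n. d k * (\<Sum>r<n. f r * q k r)\<^sup>2)"
    by (rule lambda2_spectrum[OF A sym n], rule that)
  have ker': "(\<Sum>r<n. A $$ (r,s)) = 0" if "s < n" for s
  proof -
    have "A $$ (r,s) = A $$ (s,r)" if "r < n" for r
      using sym A that \<open>s < n\<close> by (metis carrier_matD index_transpose_mat(1))
    then have "(\<Sum>r<n. A $$ (r,s)) = (\<Sum>r<n. A $$ (s,r))" by (intro sum.cong) auto
    then show ?thesis using ker[OF that] by simp
  qed
  have colsum: "(\<Sum>r<n. \<Sum>s<n. A $$ (r,s) * f s) = 0" for f
    by (subst sum.swap) (simp add: ker' flip: sum_distrib_right)
  have nonneg: "d k \<ge> 0" if "k < n" for k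
  proof -
    have "(\<Sum>r<n. q k r * (\<Sum>s<n. A $$ (r,s) * q k s)) = (\<Sum>r<n. d k * (q k r * q k r))"
      by (intro sum.cong) (auto simp: ev that)
    also have "\<dots> = d k" using orth[OF that that] by (simp flip: sum_distrib_left)
    finally show ?thesis using psd[of "q k"] by simp
  qed
  show lam0: "lambda2 A \<ge> 0" using nonneg[OF j] lam by simp
  have nz: "\<exists>r<n. q k r \<noteq> 0" if "k < n" for k
  proof (rule ccontr)
    assume "\<not> (\<exists>r<n. q k r \<noteq> 0)"
    then have "(\<Sum>r<n. q k r * q k r) = 0" by (intro sum.neutral) auto
    then show False using orth[OF that that] by simp
  qed
  show "\<exists>f. (\<exists>r<n. f r \<noteq> 0) \<and> (\<Sum>r<n. f r) = 0 \<and>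
          (\<forall>r<n. (\<Sum>s<n. A $$ (r,s) * f s) = lambda2 A * f r)"
  proof (cases "(\<Sum>r<n. q j r) = 0")
    case True
    then show ?thesis using nz[OF j] ev[OF j] lam by (intro exI[of _ "q j"]) auto
  next
    case False
    have "d j * (\<Sum>r<n. q j r) = 0"
      using colsum[of "q j"] by (simp add: ev j sum_distrib_left)
    then have dj: "d j = 0" using False by simp
    then have di: "d i = 0" using nonneg[OF i] ij by simp
    \<comment> \<open>The columns of \<open>A\<close> sum to 0, so an eigenvector with nonzero sum
      has eigenvalue 0; hence d i = d j = 0 and every combination of \<open>q i\<close> and
      \<open>q j\<close> is in the kernel. This one has sum 0 and is nonzero because its coefficient
      \<open>a\<close> at \<open>q i\<close> is.\<close>
    define a b where "a = (\<Sum>r<n. q j r)" and "b = (\<Sum>r<n. q i r)"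
    define f where "f r = a * q i r - b * q j r" for r
    have "(\<Sum>r<n. f r * q i r) = (\<Sum>r<n. a * (q i r * q i r) - b * (q j r * q i r))"
      by (simp add: f_def algebra_simps)
    also have "\<dots> = a" using orth[OF i i] orth[OF j i] ij
      by (simp add: sum_subtractf flip: sum_distrib_left)
    finally have "(\<Sum>r<n. f r * q i r) \<noteq> 0" using False by (simp add: a_def)
    then have "\<exists>r<n. f r \<noteq> 0" by (metis (no_types, lifting) lessThan_iff mult_zero_left sum.neutral)
    moreover have "(\<Sum>r<n. f r) = 0"
      unfolding f_def sum_subtractf by (simp add: a_def b_def flip: sum_distrib_left)
    moreover have "(\<Sum>s<n. A $$ (r,s) * f s) = 0" if "r < n" for r
    proof -
      have "(\<Sum>s<n. A $$ (r,s) * f s) =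
          a * (\<Sum>s<n. A $$ (r,s) * q i s) - b * (\<Sum>s<n. A $$ (r,s) * q j s)"
        by (simp add: f_def algebra_simps sum_subtractf sum_distrib_left)
      then show ?thesis using ev[OF i that] ev[OF j that] di dj by simp
    qed
    ultimately show ?thesis using dj lam by (intro exI[of _ f]) auto
  qed
  show "lambda2 A * (\<Sum>r<n. (f r)\<^sup>2) \<le> (\<Sum>r<n. f r * (\<Sum>s<n. A $$ (r,s) * f s))"
    if f0: "(\<Sum>r<n. f r) = 0" for f
  proof -
    let ?Q = "\<lambda>f. (\<Sum>r<n. f r * (\<Sum>s<n. A $$ (r,s) * f s))"
    have orth_bound: "lambda2 A * (\<Sum>r<n. (y r)\<^sup>2) \<le> ?Q y" if "(\<Sum>r<n. y r * q i r) = 0" for y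
    proof -
      have "lambda2 A * (\<Sum>r<n. y r * q k r)\<^sup>2 \<le> d k * (\<Sum>r<n. y r * q k r)\<^sup>2" if "k < n" for k
        using least[OF that] lam \<open>(\<Sum>r<n. y r * q i r) = 0\<close>
        by (cases "k = i") (auto intro: mult_right_mono)
      then have "(\<Sum>k<n. lambda2 A * (\<Sum>r<n. y r * q k r)\<^sup>2) \<le> ?Q y"
        unfolding form by (intro sum_mono) auto
      then show ?thesis by (simp only: pars[of y] sum_distrib_left)
    qed
    \<comment> \<open>As in Courant-Fischer, the span of the constant 1 and \<open>f\<close>
      contains a vector \<open>y\<close> orthogonal to \<open>q i\<close>. Constants do not affect
      the form, and 1 is orthogonal to \<open>f\<close>, so form and norm of \<open>y\<close> are
      explicit. If \<open>a = 0\<close>, \<open>f\<close> itself is orthogonal to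
      \<open>q i\<close>; if only \<open>b = 0\<close>, then \<open>y\<close> is a nonzero constant
      and forces the eigenvalue to be 0.\<close>
    define a b where "a = (\<Sum>r<n. f r * q i r)" and "b = (\<Sum>r<n. q i r)"
    define y where "y r = a - b * f r" for r
    have "(\<Sum>r<n. y r * q i r) = (\<Sum>r<n. a * q i r - b * (f r * q i r))"
      by (simp add: y_def algebra_simps)
    also have "\<dots> = 0" unfolding sum_subtractf by (simp add: a_def b_def flip: sum_distrib_left)
    finally have "lambda2 A * (\<Sum>r<n. (y r)\<^sup>2) \<le> ?Q y" by (rule orth_bound)
    moreover have "(\<Sum>r<n. (y r)\<^sup>2) = real n * a\<^sup>2 + b\<^sup>2 * (\<Sum>r<n. (f r)\<^sup>2)"
    proof -
      have "(\<Sum>r<n. (y r)\<^sup>2) = (\<Sum>r<n. a\<^sup>2 + b\<^sup>2 * (f r)\<^sup>2 - (2 * a * b) * f r)"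
        by (rule sum.cong) (auto simp: y_def power2_eq_square algebra_simps)
      then show ?thesis
        by (simp add: sum.distrib sum_subtractf f0 flip: sum_distrib_left)
    qed
    moreover have "?Q y = b\<^sup>2 * ?Q f"
    proof -
      have Ay: "(\<Sum>s<n. A $$ (r,s) * y s) = - b * (\<Sum>s<n. A $$ (r,s) * f s)" if "r < n" for r
      proof -
        have "(\<Sum>s<n. A $$ (r,s) * y s) = (\<Sum>s<n. a * A $$ (r,s) - b * (A $$ (r,s) * f s))"
          by (simp add: y_def algebra_simps)
        then show ?thesis
          using ker[OF that] by (simp add: sum_subtractf flip: sum_distrib_left)
      qed
      have "?Q y = (\<Sum>r<n. b\<^sup>2 * (f r * (\<Sum>s<n. A $$ (r,s) * f s)) - (a * b) * (\<Sum>s<n. A $$ (r,s) * f s))"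
        by (rule sum.cong) (auto simp: Ay, simp add: y_def power2_eq_square algebra_simps)
      then show ?thesis
        by (simp add: sum_subtractf colsum flip: sum_distrib_left)
    qed
    ultimately have le: "lambda2 A * (real n * a\<^sup>2 + b\<^sup>2 * (\<Sum>r<n. (f r)\<^sup>2)) \<le> b\<^sup>2 * ?Q f" by simp
    consider "a = 0" | "a \<noteq> 0" "b = 0" | "b \<noteq> 0" by blast
    then show ?thesis
    proof cases
      case 1
      then show ?thesis using orth_bound[of f] by (simp add: a_def)
    next
      case 2
      then have "lambda2 A * (real n * a\<^sup>2) \<le> 0" using le by simp
      moreover have "real n * a\<^sup>2 > 0" using 2 n by simp
      ultimately have "lambda2 A = 0"
        using lam0 by (smt (verit) mult_pos_pos)
      then show ?thesis using psd by simp
    next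
      case 3
      have "b\<^sup>2 * (lambda2 A * (\<Sum>r<n. (f r)\<^sup>2)) \<le> b\<^sup>2 * ?Q f"
      proof -
        have "0 \<le> lambda2 A * (real n * a\<^sup>2)" using lam0 by simp
        then show ?thesis using le by (simp add: algebra_simps)
      qed
      then show ?thesis using 3 by simp
    qed
  qed
qed

section \<open>Graph Laplacians as operators on functions\<close>

definition adj :: "nat set set \<Rightarrow> nat \<Rightarrow> nat \<Rightarrow> real" where
  "adj E u v = (if {u, v} \<in> E then 1 else 0)"

definition cut_weight :: "('a \<Rightarrow> 'a \<Rightarrow> real) \<Rightarrow> 'a set \<Rightarrow> 'a set \<Rightarrow> real" where
  "cut_weight a A B = (\<Sum>u\<in>A. \<Sum>v\<in>B. a u v)"

definition lap :: "('a \<Rightarrow> 'a \<Rightarrow> real) \<Rightarrow> 'a set \<Rightarrow> ('a \<Rightarrow> real) \<Rightarrow> 'a \<Rightarrow> real" where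
  "lap a S x u = (\<Sum>v\<in>S. a u v * (x u - x v))"

text \<open>Ordered pairs: every edge is counted twice.\<close>
definition energy :: "('a \<Rightarrow> 'a \<Rightarrow> real) \<Rightarrow> 'a set \<Rightarrow> ('a \<Rightarrow> real) \<Rightarrow> real" where
  "energy a S x = (\<Sum>u\<in>S. \<Sum>v\<in>S. a u v * (x u - x v)\<^sup>2)"

lemma adj_sym: "adj E u v = adj E v u"
  by (simp add: adj_def insert_commute)

lemma adj_nonneg: "adj E u v \<ge> 0"
  by (simp add: adj_def)

text \<open>Summation by parts: the double sum is averaged with its copy under exchange of
  \<open>u\<close> and \<open>v\<close>.\<close>

lemma sum_mult_lap:
  assumes sym: "\<And>u v. a u v = a v u"
  shows "(\<Sum>u\<in>S. x u * lap a S y u) = (\<Sum>u\<in>S. \<Sum>v\<in>S. a u v * (x u - x v) * (y u - y v)) / 2"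
proof -
  have "(\<Sum>u\<in>S. x u * lap a S y u) = (\<Sum>u\<in>S. \<Sum>v\<in>S. a u v * x u * (y u - y v))"
    by (simp add: lap_def sum_distrib_left mult_ac)
  moreover have "\<dots> = (\<Sum>v\<in>S. \<Sum>u\<in>S. a u v * x u * (y u - y v))"
    by (rule sum.swap)
  moreover have "(\<Sum>v\<in>S. \<Sum>u\<in>S. a u v * x u * (y u - y v)) = - (\<Sum>u\<in>S. \<Sum>v\<in>S. a u v * x v * (y u - y v))"
    by (simp add: sum_negf[symmetric] sym algebra_simps)
  ultimately have "2 * (\<Sum>u\<in>S. x u * lap a S y u) =
      (\<Sum>u\<in>S. \<Sum>v\<in>S. a u v * x u * (y u - y v)) - (\<Sum>u\<in>S. \<Sum>v\<in>S. a u v * x v * (y u - y v))"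
    by simp
  also have "\<dots> = (\<Sum>u\<in>S. \<Sum>v\<in>S. a u v * (x u - x v) * (y u - y v))"
    by (simp add: sum_subtractf[symmetric] algebra_simps)
  finally show ?thesis by simp
qed

lemma sum_mult_lap_eq_energy:
  assumes "\<And>u v. a u v = a v u"
  shows "(\<Sum>u\<in>S. x u * lap a S x u) = energy a S x / 2"
  using sum_mult_lap[where a = a and S = S and x = x and y = x, OF assms] by (simp add: energy_def power2_eq_square mult.assoc)

lemma sum_lap:
  assumes "\<And>u v. a u v = a v u"
  shows "(\<Sum>u\<in>S. lap a S x u) = 0"
  using sum_mult_lap[where a = a and S = S and x = "\<lambda>_. 1" and y = x, OF assms] by simp

lemma sum_mult_lap_commute:
  assumes "\<And>u v. a u v = a v u"
  shows "(\<Sum>u\<in>S. x u * lap a S y u) = (\<Sum>u\<in>S. y u * lap a S x u)"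
  unfolding sum_mult_lap[OF assms] by (simp add: mult_ac)

lemma energy_nonneg: "(\<And>u v. a u v \<ge> 0) \<Longrightarrow> energy a S x \<ge> 0"
  unfolding energy_def by (intro sum_nonneg mult_nonneg_nonneg) auto

lemma dim_laplacian: "laplacian S F \<in> carrier_mat (card S) (card S)"
  by (simp add: laplacian_def)

lemma bij_betw_sorted_list_of_set:
  "finite S \<Longrightarrow> bij_betw (\<lambda>i. sorted_list_of_set S ! i) {..<card S} S"
  by (rule bij_betw_nth) auto

lemma transpose_laplacian: "transpose_mat (laplacian S F) = laplacian S F"
  by (rule eq_matI) (auto simp: laplacian_def edge_laplacian_def mult.commute)

text \<open>Bridge from the matrix to the operator \<open>lap\<close>, free of the enumeration of
  \<open>S\<close>. An edge {p, q} with p < q contributes b(u) (x q - x p), which is 0 unless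
  \<open>u\<close> is an endpoint and x u - x v if \<open>v\<close> is the other one; exchanging the
  sums over edges and vertices yields \<open>lap\<close>.\<close>

lemma laplacian_mult:
  assumes S: "finite S" and i: "i < card S"
    and simple: "\<And>e. e \<in> E \<Longrightarrow> \<exists>u v. u \<noteq> v \<and> e = {u, v}"
  shows "(\<Sum>j<card S. laplacian S (induced_edges E S) $$ (i,j) * x (sorted_list_of_set S ! j)) =
    lap (adj E) S x (sorted_list_of_set S ! i)"
proof -
  define F where "F = induced_edges E S"
  define b :: "nat set \<Rightarrow> nat \<Rightarrow> real" where
    "b e w = (if w = Max e then 1 else if w = Min e then - 1 else 0)" for e w
  define u where "u = sorted_list_of_set S ! i"
  have u: "u \<in> S" unfolding u_def using bij_betwE[OF bij_betw_sorted_list_of_set[OF S]] i by auto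
  have finF: "finite F" unfolding F_def induced_edges_def
    by (rule finite_subset[of _ "Pow S"]) (use S in auto)
  have edge: "(\<Sum>w\<in>S. b e u * b e w * x w) = (\<Sum>v\<in>S. if e = {u,v} then x u - x v else 0)"
    if "e \<in> F" for e
  proof -
    from that simple obtain p q where "p \<noteq> q" "e = {p, q}" and sub: "e \<subseteq> S"
      unfolding F_def induced_edges_def by blast
    then obtain p q where pq: "p < q" "e = {p, q}" by (metis insert_commute linorder_neqE_nat)
    then have M: "Min e = p" "Max e = q" by auto
    have "(\<Sum>w\<in>S. b e w * x w) = (\<Sum>w\<in>S. (if w = q then x w else 0) - (if w = p then x w else 0))"
      using pq by (intro sum.cong) (auto simp: b_def M)
    also have "\<dots> = x q - x p" using sub pq S by (simp add: sum_subtractf)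
    finally have "(\<Sum>w\<in>S. b e u * b e w * x w) = b e u * (x q - x p)"
      by (simp add: mult.assoc flip: sum_distrib_left)
    moreover have "(\<Sum>v\<in>S. if e = {u,v} then x u - x v else 0) =
        (\<Sum>v\<in>S. (if v = p then if u = q then x u - x v else 0 else 0) +
               (if v = q then if u = p then x u - x v else 0 else 0))"
      using pq by (intro sum.cong) (auto simp: doubleton_eq_iff)
    moreover have "\<dots> = b e u * (x q - x p)"
      using pq sub S by (auto simp: sum.distrib b_def M)
    ultimately show ?thesis by simp
  qed
  have "(\<Sum>j<card S. laplacian S F $$ (i,j) * x (sorted_list_of_set S ! j)) =
      (\<Sum>j<card S. \<Sum>e\<in>F. b e u * b e (sorted_list_of_set S ! j) * x (sorted_list_of_set S ! j))"
    using i by (intro sum.cong)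
      (auto simp: laplacian_def edge_laplacian_def edge_vec_def Let_def sum_distrib_right b_def u_def
        intro!: sum.cong)
  also have "\<dots> = (\<Sum>w\<in>S. \<Sum>e\<in>F. b e u * b e w * x w)"
    by (rule sum.reindex_bij_betw[OF bij_betw_sorted_list_of_set[OF S]])
  also have "\<dots> = (\<Sum>e\<in>F. \<Sum>w\<in>S. b e u * b e w * x w)" by (rule sum.swap)
  also have "\<dots> = (\<Sum>e\<in>F. \<Sum>v\<in>S. if e = {u,v} then x u - x v else 0)"
    by (intro sum.cong refl edge)
  also have "\<dots> = (\<Sum>v\<in>S. \<Sum>e\<in>F. if e = {u,v} then x u - x v else 0)" by (rule sum.swap)
  also have "\<dots> = lap (adj E) S x u"
    unfolding lap_def using u finF
    by (intro sum.cong) (auto simp: adj_def F_def induced_edges_def)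
  finally show ?thesis by (simp add: F_def u_def)
qed

lemma lambda2_induced_small: "card S < 2 \<Longrightarrow> lambda2_induced E S = 0"
  by (simp add: lambda2_induced_def lambda2_def laplacian_def)

context
  fixes E :: "nat set set" and S :: "nat set"
  assumes S: "finite S" and simple: "\<And>e. e \<in> E \<Longrightarrow> \<exists>u v. u \<noteq> v \<and> e = {u, v}"
begin

private abbreviation "nth_vertex i \<equiv> sorted_list_of_set S ! i"

private lemma laplacian_facts:
  shows "(\<Sum>r<card S. f r * (\<Sum>s<card S. laplacian S (induced_edges E S) $$ (r,s) * f s)) \<ge> 0"
    and "r < card S \<Longrightarrow> (\<Sum>s<card S. laplacian S (induced_edges E S) $$ (r,s)) = 0"
proof -
  note bij = bij_betw_sorted_list_of_set[OF S]
  define x where "x u = f (the_inv_into {..<card S} (\<lambda>i. nth_vertex i) u)" for u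
  have x: "x (nth_vertex i) = f i" if "i < card S" for i
    using bij that by (simp add: x_def the_inv_into_f_f bij_betw_def)
  have "(\<Sum>r<card S. f r * (\<Sum>s<card S. laplacian S (induced_edges E S) $$ (r,s) * f s)) =
      (\<Sum>r<card S. x (nth_vertex r) * lap (adj E) S x (nth_vertex r))"
    by (intro sum.cong) (auto simp: x laplacian_mult[OF S _ simple, symmetric])
  also have "\<dots> = (\<Sum>u\<in>S. x u * lap (adj E) S x u)"
    by (rule sum.reindex_bij_betw[OF bij])
  also have "\<dots> \<ge> 0"
    using energy_nonneg[of "adj E" S x] by (simp add: sum_mult_lap_eq_energy adj_sym adj_nonneg)
  finally show "(\<Sum>r<card S. f r * (\<Sum>s<card S. laplacian S (induced_edges E S) $$ (r,s) * f s)) \<ge> 0" .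
  show "(\<Sum>s<card S. laplacian S (induced_edges E S) $$ (r,s)) = 0" if "r < card S"
    using laplacian_mult[where x = "\<lambda>_. 1", OF S that simple] by (simp add: lap_def)
qed

lemma lambda2_induced_nonneg: "lambda2_induced E S \<ge> 0"
proof (cases "card S < 2")
  case False
  then show ?thesis unfolding lambda2_induced_def
    by (intro lambda2_nonneg[OF dim_laplacian transpose_laplacian] laplacian_facts) auto
qed (simp add: lambda2_induced_small)

lemma lambda2_induced_eigenvector:
  assumes "card S \<ge> 2"
  shows "\<exists>x. (\<exists>u\<in>S. x u \<noteq> 0) \<and> (\<Sum>u\<in>S. x u) = 0 \<and>
    (\<forall>u\<in>S. lap (adj E) S x u = lambda2_induced E S * x u)"
proof -
  let ?A = "laplacian S (induced_edges E S)"
  note bij = bij_betw_sorted_list_of_set[OF S]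
  have "\<exists>f. (\<exists>r<card S. f r \<noteq> 0) \<and> (\<Sum>r<card S. f r) = 0 \<and>
          (\<forall>r<card S. (\<Sum>s<card S. ?A $$ (r,s) * f s) = lambda2 ?A * f r)"
    by (intro lambda2_eigenvector[OF dim_laplacian transpose_laplacian] laplacian_facts assms)
  then obtain f where f: "\<exists>r<card S. f r \<noteq> 0" "(\<Sum>r<card S. f r) = 0"
    "\<And>r. r < card S \<Longrightarrow> (\<Sum>s<card S. ?A $$ (r,s) * f s) = lambda2 ?A * f r" by blast
  define x where "x u = f (the_inv_into {..<card S} (\<lambda>i. nth_vertex i) u)" for u
  have x: "x (nth_vertex i) = f i" if "i < card S" for i
    using bij that by (simp add: x_def the_inv_into_f_f bij_betw_def)
  have img: "S = (\<lambda>i. nth_vertex i) ` {..<card S}" using bij by (simp add: bij_betw_def)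
  have "\<exists>u\<in>S. x u \<noteq> 0" using f(1) x img by (metis imageI lessThan_iff)
  moreover have "(\<Sum>u\<in>S. x u) = 0"
    using sum.reindex_bij_betw[OF bij, of x] f(2) by (simp add: x)
  moreover have "lap (adj E) S x u = lambda2_induced E S * x u" if "u \<in> S" for u
  proof -
    from that img obtain r where r: "r < card S" "u = nth_vertex r" by blast
    have "lap (adj E) S x u = (\<Sum>s<card S. ?A $$ (r,s) * x (nth_vertex s))"
      unfolding r by (rule laplacian_mult[OF S r(1) simple, symmetric])
    also have "\<dots> = (\<Sum>s<card S. ?A $$ (r,s) * f s)" by (intro sum.cong) (auto simp: x)
    finally show ?thesis using f(3)[OF r(1)] r x by (simp add: lambda2_induced_def)
  qed
  ultimately show ?thesis by blast
qed

lemma lambda2_induced_variational: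
  assumes sum0: "(\<Sum>u\<in>S. x u) = 0"
  shows "lambda2_induced E S * (\<Sum>u\<in>S. (x u)\<^sup>2) \<le> energy (adj E) S x / 2"
proof (cases "card S < 2")
  case True
  then show ?thesis using energy_nonneg[of "adj E" S x] by (simp add: lambda2_induced_small adj_nonneg)
next
  case False
  let ?A = "laplacian S (induced_edges E S)"
  note bij = bij_betw_sorted_list_of_set[OF S]
  have "lambda2 ?A * (\<Sum>r<card S. (x (nth_vertex r))\<^sup>2) \<le>
      (\<Sum>r<card S. x (nth_vertex r) * (\<Sum>s<card S. ?A $$ (r,s) * x (nth_vertex s)))"
  proof (rule lambda2_variational[OF dim_laplacian transpose_laplacian _ laplacian_facts])
    show "(\<Sum>r<card S. x (nth_vertex r)) = 0"
      using sum.reindex_bij_betw[OF bij, of x] sum0 by simp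
  qed (use False in auto)
  also have "\<dots> = (\<Sum>r<card S. x (nth_vertex r) * lap (adj E) S x (nth_vertex r))"
    by (intro sum.cong) (auto simp: laplacian_mult[OF S _ simple])
  also have "\<dots> = (\<Sum>u\<in>S. x u * lap (adj E) S x u)"
    by (rule sum.reindex_bij_betw[OF bij])
  also have "\<dots> = energy (adj E) S x / 2" by (simp add: sum_mult_lap_eq_energy adj_sym)
  also have "(\<Sum>r<card S. (x (nth_vertex r))\<^sup>2) = (\<Sum>u\<in>S. (x u)\<^sup>2)"
    by (rule sum.reindex_bij_betw[OF bij])
  finally show ?thesis by (simp add: lambda2_induced_def)
qed

end

section \<open>Cheeger rounding\<close>

lemma cut_weight_commute: "(\<And>u v. a u v = a v u) \<Longrightarrow> cut_weight a A B = cut_weight a B A"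
  unfolding cut_weight_def by (subst sum.swap) (auto intro!: sum.cong)

lemma cut_weight_nonneg: "(\<And>u v. a u v \<ge> 0) \<Longrightarrow> cut_weight a A B \<ge> 0"
  unfolding cut_weight_def by (intro sum_nonneg) auto

lemma sum_separated_pairs:
  assumes S: "finite S" and P: "P \<subseteq> S" and sym: "\<And>u v. a u v = a v u"
  shows "(\<Sum>u\<in>S. \<Sum>v\<in>S. a u v * (if (u \<in> P) \<noteq> (v \<in> P) then 1 else 0)) = 2 * cut_weight a P (S - P)"
proof -
  have inner: "(\<Sum>v\<in>S. a u v * (if (u \<in> P) \<noteq> (v \<in> P) then 1 else 0)) =
      (if u \<in> P then \<Sum>v\<in>S-P. a u v else \<Sum>v\<in>P. a u v)" for u
  proof (cases "u \<in> P")
    case True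
    have "(\<Sum>v\<in>S. a u v * (if (u \<in> P) \<noteq> (v \<in> P) then 1 else 0)) = (\<Sum>v\<in>S. if v \<in> S - P then a u v else 0)"
      using True by (intro sum.cong) auto
    also have "\<dots> = sum (a u) (S \<inter> (S - P))" by (rule sum.inter_restrict[OF S, symmetric])
    also have "S \<inter> (S - P) = S - P" by blast
    finally show ?thesis using True by simp
  next
    case False
    then have "(\<Sum>v\<in>S. a u v * (if (u \<in> P) \<noteq> (v \<in> P) then 1 else 0)) = (\<Sum>v\<in>S. if v \<in> P then a u v else 0)"
      by (intro sum.cong) auto
    then show ?thesis using False S P by (simp add: sum.inter_restrict[symmetric] Int_absorb1)
  qed
  have "(\<Sum>u\<in>S. if u \<in> P then \<Sum>v\<in>S-P. a u v else \<Sum>v\<in>P. a u v) =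
      (\<Sum>u\<in>P. \<Sum>v\<in>S-P. a u v) + (\<Sum>u\<in>S-P. \<Sum>v\<in>P. a u v)"
    using S P by (simp add: sum.If_cases Int_absorb1 Diff_eq)
  also have "\<dots> = 2 * cut_weight a P (S - P)"
    using cut_weight_commute[of a "S - P" P] sym by (simp add: cut_weight_def)
  finally show ?thesis by (simp only: inner)
qed

text \<open>By induction on the support, peeling off the lowest positive level set.\<close>
lemma coarea:
  fixes a :: "'a \<Rightarrow> 'a \<Rightarrow> real" and \<phi> :: real
  assumes S: "finite S" and sym: "\<And>u v. a u v = a v u" and nonneg: "\<And>u v. a u v \<ge> 0"
  shows "(\<And>u. u \<in> S \<Longrightarrow> f u \<ge> 0) \<Longrightarrow>
    (\<And>t. t \<ge> 0 \<Longrightarrow> \<phi> * card {u \<in> S. f u > t} \<le> cut_weight a {u \<in> S. f u > t} {u \<in> S. f u \<le> t}) \<Longrightarrow>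
    2 * \<phi> * (\<Sum>u\<in>S. f u) \<le> (\<Sum>u\<in>S. \<Sum>v\<in>S. a u v * \<bar>f u - f v\<bar>)"
proof (induction "card {u \<in> S. f u > 0}" arbitrary: f rule: less_induct)
  case less
  note f0 = less.prems(1) and level = less.prems(2)
  define P where "P = {u \<in> S. f u > 0}"
  have finP: "finite P" and PS: "P \<subseteq> S" using S by (auto simp: P_def)
  show ?case
  proof (cases "P = {}")
    case True
    then have "\<forall>u\<in>S. f u = 0" using f0 by (force simp: P_def)
    then show ?thesis by simp
  next
    case False
    define \<alpha> where "\<alpha> = Min (f ` P)"
    have "\<alpha> \<in> f ` P" unfolding \<alpha>_def using finP False by (intro Min_in) auto
    then obtain w where w: "w \<in> P" "f w = \<alpha>" by auto
    have le: "\<alpha> \<le> f u" if "u \<in> P" for u unfolding \<alpha>_def using finP that by (intro Min_le) auto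
    have \<alpha>: "\<alpha> > 0" using w by (auto simp: P_def)
    have fz: "f u = 0" if "u \<in> S" "u \<notin> P" for u using that f0[of u] by (auto simp: P_def)
    \<comment> \<open>\<open>g\<close> lowers \<open>f\<close> by its least positive value \<alpha>
      on the support, so the superlevel set of \<open>g\<close> at t is that of \<open>f\<close> at
      t + \<alpha> and the level hypothesis is inherited. The support loses \<open>w\<close>, and
      the variation loses exactly \<alpha> per ordered pair separated by \<open>P\<close>.\<close>
    define g where "g u = f u - (if u \<in> P then \<alpha> else 0)" for u
    have g0: "g u \<ge> 0" if "u \<in> S" for u using that le f0[of u] by (auto simp: g_def)
    have gl: "g u > t \<longleftrightarrow> f u > t + \<alpha>" if "u \<in> S" "t \<ge> 0" for u t
      using that fz[of u] \<alpha> by (auto simp: g_def)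
    have "w \<in> P - {u \<in> S. g u > 0}" using w by (auto simp: g_def)
    moreover have "{u \<in> S. g u > 0} \<subseteq> P" using gl[of _ 0] \<alpha> by (auto simp: P_def)
    ultimately have "card {u \<in> S. g u > 0} < card P" using finP by (intro psubset_card_mono) auto
    then have IH: "2 * \<phi> * (\<Sum>u\<in>S. g u) \<le> (\<Sum>u\<in>S. \<Sum>v\<in>S. a u v * \<bar>g u - g v\<bar>)"
    proof (intro less.hyps)
      fix t :: real assume t: "t \<ge> 0"
      have "{u \<in> S. g u > t} = {u \<in> S. f u > t + \<alpha>}" using gl[OF _ t] by auto
      moreover have "{u \<in> S. g u \<le> t} = {u \<in> S. f u \<le> t + \<alpha>}" using gl[OF _ t] by (auto simp flip: not_less)
      ultimately show "\<phi> * card {u \<in> S. g u > t} \<le> cut_weight a {u \<in> S. g u > t} {u \<in> S. g u \<le> t}"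
        using level[of "t + \<alpha>"] t \<alpha> by simp
    qed (use g0 P_def in auto)
    have eq: "\<bar>f u - f v\<bar> = \<bar>g u - g v\<bar> + \<alpha> * (if (u \<in> P) \<noteq> (v \<in> P) then 1 else 0)" if "u \<in> S" "v \<in> S" for u v
      using fz[of u] fz[of v] le[of u] le[of v] that \<alpha> by (auto simp: g_def)
    have "{u \<in> S. f u \<le> 0} = S - P" by (auto simp: P_def)
    then have "\<phi> * card P \<le> cut_weight a P (S - P)" using level[of 0] by (simp add: P_def)
    then have "\<alpha> * (2 * (\<phi> * card P)) \<le> \<alpha> * (2 * cut_weight a P (S - P))"
      using \<alpha> by simp
    also have "\<dots> = (\<Sum>u\<in>S. \<Sum>v\<in>S. a u v * (\<alpha> * (if (u \<in> P) \<noteq> (v \<in> P) then 1 else 0)))"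
      unfolding sum_separated_pairs[OF S PS sym, symmetric] sum_distrib_left
      by (simp add: mult_ac)
    finally have B: "\<alpha> * (2 * (\<phi> * card P)) \<le>
      (\<Sum>u\<in>S. \<Sum>v\<in>S. a u v * (\<alpha> * (if (u \<in> P) \<noteq> (v \<in> P) then 1 else 0)))" .
    have "(\<Sum>u\<in>S. f u) = (\<Sum>u\<in>S. g u + (if u \<in> P then \<alpha> else 0))" by (simp add: g_def)
    also have "\<dots> = (\<Sum>u\<in>S. g u) + \<alpha> * card P"
      using S PS by (simp add: sum.distrib sum.inter_restrict[symmetric] Int_absorb1)
    finally have "2 * \<phi> * (\<Sum>u\<in>S. f u) = 2 * \<phi> * (\<Sum>u\<in>S. g u) + \<alpha> * (2 * (\<phi> * card P))"
      by (simp add: algebra_simps)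
    also have "\<dots> \<le> (\<Sum>u\<in>S. \<Sum>v\<in>S. a u v * \<bar>g u - g v\<bar>) +
        (\<Sum>u\<in>S. \<Sum>v\<in>S. a u v * (\<alpha> * (if (u \<in> P) \<noteq> (v \<in> P) then 1 else 0)))"
      using IH B by linarith
    also have "\<dots> = (\<Sum>u\<in>S. \<Sum>v\<in>S. a u v * \<bar>f u - f v\<bar>)"
      unfolding sum.distrib[symmetric] distrib_left[symmetric]
      by (intro sum.cong refl arg_cong2[where f = "(*)"] eq[symmetric])
    finally show ?thesis .
  qed
qed

text \<open>The coarea bound is applied to z^2, whose superlevel sets are those of \<open>z\<close>.
  Then |z(u)^2 - z(v)^2| = |z(u) - z(v)| |z(u) + z(v)| is split by a weighted arithmetic-geometric
  mean inequality into an energy term and a degree term.\<close>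

lemma cheeger_nonneg_function:
  fixes a :: "'a \<Rightarrow> 'a \<Rightarrow> real" and \<phi> :: real
  assumes S: "finite S" and sym: "\<And>u v. a u v = a v u" and nonneg: "\<And>u v. a u v \<ge> 0"
    and deg: "\<And>u. u \<in> S \<Longrightarrow> (\<Sum>v\<in>S. a u v) \<le> \<Delta>" and \<Delta>: "\<Delta> > 0" and \<phi>: "\<phi> > 0"
    and z0: "\<And>u. u \<in> S \<Longrightarrow> z u \<ge> 0"
    and level: "\<And>t. t \<ge> 0 \<Longrightarrow> \<phi> * card {u \<in> S. z u > t} \<le> cut_weight a {u \<in> S. z u > t} {u \<in> S. z u \<le> t}"
  shows "\<phi>\<^sup>2 * (\<Sum>u\<in>S. (z u)\<^sup>2) \<le> \<Delta> * energy a S z"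
proof -
  \<comment> \<open>The weight makes the degree term 2 \<Delta> N / s equal to \<phi> N, half of the
    left-hand side 2 \<phi> N, which can then absorb it.\<close>
  define s where "s = 2 * \<Delta> / \<phi>"
  have s: "s > 0" using \<Delta> \<phi> by (simp add: s_def)
  define N where "N = (\<Sum>u\<in>S. (z u)\<^sup>2)"
  have lvl: "(z u)\<^sup>2 > t \<longleftrightarrow> z u > sqrt t" if "u \<in> S" "t \<ge> 0" for u t
    using z0[OF that(1)] that(2) by (metis real_less_lsqrt real_less_rsqrt not_less_iff_gr_or_eq
        order_less_asym real_sqrt_abs real_sqrt_less_iff abs_of_nonneg)
  have "2 * \<phi> * N \<le> (\<Sum>u\<in>S. \<Sum>v\<in>S. a u v * \<bar>(z u)\<^sup>2 - (z v)\<^sup>2\<bar>)"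
    unfolding N_def
  proof (rule coarea[OF S sym nonneg])
    fix t :: real assume t: "t \<ge> 0"
    have "{u \<in> S. (z u)\<^sup>2 > t} = {u \<in> S. z u > sqrt t}" using lvl[OF _ t] by auto
    moreover have "{u \<in> S. (z u)\<^sup>2 \<le> t} = {u \<in> S. z u \<le> sqrt t}" using lvl[OF _ t] by (auto simp flip: not_less)
    ultimately show "\<phi> * card {u \<in> S. (z u)\<^sup>2 > t} \<le> cut_weight a {u \<in> S. (z u)\<^sup>2 > t} {u \<in> S. (z u)\<^sup>2 \<le> t}"
      using level[of "sqrt t"] t by simp
  qed auto
  also have "\<dots> \<le> (\<Sum>u\<in>S. \<Sum>v\<in>S. a u v * (s / 2 * (z u - z v)\<^sup>2 + ((z u)\<^sup>2 + (z v)\<^sup>2) / s))"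
  proof (intro sum_mono mult_left_mono nonneg)
    fix u v assume "u \<in> S" "v \<in> S"
    define p q where "p = \<bar>z u - z v\<bar>" and "q = \<bar>z u + z v\<bar>"
    have "0 \<le> (s * p - q)\<^sup>2 / (2 * s)" using s by simp
    also have "\<dots> = s / 2 * p\<^sup>2 + q\<^sup>2 / (2 * s) - p * q"
      using s by (simp add: power2_eq_square field_simps)
    finally have "p * q \<le> s / 2 * p\<^sup>2 + q\<^sup>2 / (2 * s)" by simp
    moreover have "\<bar>(z u)\<^sup>2 - (z v)\<^sup>2\<bar> = p * q"
      by (simp add: p_def q_def power2_eq_square square_diff_square_factored abs_mult[symmetric] mult.commute)
    moreover have "q\<^sup>2 \<le> 2 * ((z u)\<^sup>2 + (z v)\<^sup>2)"
      using sum_squares_bound[of "z u" "z v"] by (simp add: q_def power2_eq_square algebra_simps)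
    then have "q\<^sup>2 / (2 * s) \<le> ((z u)\<^sup>2 + (z v)\<^sup>2) / s"
      using s by (simp add: field_simps)
    moreover have "p\<^sup>2 = (z u - z v)\<^sup>2" by (simp add: p_def)
    ultimately show "\<bar>(z u)\<^sup>2 - (z v)\<^sup>2\<bar> \<le> s / 2 * (z u - z v)\<^sup>2 + ((z u)\<^sup>2 + (z v)\<^sup>2) / s"
      by simp
  qed
  also have "\<dots> = s / 2 * energy a S z + ((\<Sum>u\<in>S. \<Sum>v\<in>S. a u v * (z u)\<^sup>2) + (\<Sum>u\<in>S. \<Sum>v\<in>S. a u v * (z v)\<^sup>2)) / s"
    by (simp add: energy_def sum_distrib_left sum_divide_distrib sum.distrib distrib_left add_divide_distrib mult_ac)
  also have "(\<Sum>u\<in>S. \<Sum>v\<in>S. a u v * (z v)\<^sup>2) = (\<Sum>u\<in>S. \<Sum>v\<in>S. a u v * (z u)\<^sup>2)"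
    by (subst sum.swap) (simp add: sym)
  also have "(\<Sum>u\<in>S. \<Sum>v\<in>S. a u v * (z u)\<^sup>2) \<le> \<Delta> * N"
    unfolding N_def sum_distrib_left sum_distrib_right[symmetric]
    by (intro sum_mono mult_right_mono deg) auto
  then have "s / 2 * energy a S z + ((\<Sum>u\<in>S. \<Sum>v\<in>S. a u v * (z u)\<^sup>2) + (\<Sum>u\<in>S. \<Sum>v\<in>S. a u v * (z u)\<^sup>2)) / s \<le>
      s / 2 * energy a S z + (\<Delta> * N + \<Delta> * N) / s"
    using s by (intro add_left_mono divide_right_mono add_mono) auto
  also have "\<dots> = \<Delta> * energy a S z / \<phi> + \<phi> * N"
    using \<Delta> \<phi> by (simp add: s_def field_simps)
  finally have "\<phi> * N \<le> \<Delta> * energy a S z / \<phi>" by (simp add: mult.commute)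
  then have "\<phi> * (\<phi> * N) \<le> \<Delta> * energy a S z"
    using \<phi> by (simp add: field_simps)
  then show ?thesis by (simp add: N_def power2_eq_square mult.assoc)
qed

text \<open>The least value with at most half of \<open>S\<close> strictly above it will do. The
  next smaller value \<open>d\<close> fails that test, so more than half of \<open>S\<close> lies
  above \<open>d\<close>, that is, at or above the chosen value.\<close>

lemma median_exists:
  fixes x :: "'a \<Rightarrow> real"
  assumes "finite S" "S \<noteq> {}"
  obtains c where "c \<in> x ` S" "2 * card {u \<in> S. x u > c} \<le> card S" "2 * card {u \<in> S. x u < c} \<le> card S"
proof -
  define T where "T = {c \<in> x ` S. 2 * card {u \<in> S. x u > c} \<le> card S}"
  have "Max (x ` S) \<in> T"
  proof -
    have "{u \<in> S. x u > Max (x ` S)} = {}" using assms by (auto simp: not_less)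
    then have "card {u \<in> S. x u > Max (x ` S)} = 0" by (metis card.empty)
    moreover have "Max (x ` S) \<in> x ` S" using assms by (intro Max_in) auto
    ultimately show ?thesis unfolding T_def by simp
  qed
  moreover have finT: "finite T" using assms by (simp add: T_def)
  ultimately have c: "Min T \<in> T" and least: "\<And>d. d \<in> T \<Longrightarrow> Min T \<le> d" by (auto intro: Min_in)
  have "2 * card {u \<in> S. x u < Min T} \<le> card S"
  proof (cases "{u \<in> S. x u < Min T} = {}")
    case True
    then show ?thesis by (metis card.empty mult_0_right zero_le)
  next
    case False
    let ?B = "{u \<in> S. x u < Min T}"
    define d where "d = Max (x ` ?B)"
    have "d \<in> x ` ?B" unfolding d_def using False assms by (intro Max_in) auto
    then have d: "d \<in> x ` S" "d < Min T" by auto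
    have le: "x u \<le> d" if "u \<in> ?B" for u unfolding d_def using that assms by (intro Max_ge) auto
    have "d \<notin> T" using least d by force
    then have "2 * card {u \<in> S. x u > d} > card S" using d by (auto simp: T_def)
    moreover have "{u \<in> S. x u > d} = S - ?B" using le d by force
    then have "card {u \<in> S. x u > d} = card S - card ?B" using assms by (simp add: card_Diff_subset)
    ultimately show ?thesis by linarith
  qed
  then show ?thesis using that[of "Min T"] c by (auto simp: T_def)
qed

text \<open>Cutting \<open>x\<close> at a median leaves two nonnegative parts \<open>p\<close> and
  \<open>q\<close> supported on at most half of the vertices each. On their level sets the minimum
  in the sweep hypothesis is the size of the level set, so the bound for nonnegative functions
  applies. Returning from the median to the mean \<open>m\<close> is free, since the mean minimizes
  the sum of squared deviations.\<close>

lemma cheeger_sweep: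
  fixes a :: "'a \<Rightarrow> 'a \<Rightarrow> real" and \<phi> :: real
  assumes S: "finite S" and sym: "\<And>u v. a u v = a v u" and nonneg: "\<And>u v. a u v \<ge> 0"
    and deg: "\<And>u. u \<in> S \<Longrightarrow> (\<Sum>v\<in>S. a u v) \<le> \<Delta>" and \<Delta>: "\<Delta> > 0" and \<phi>: "\<phi> > 0"
    and sweep: "\<And>w. w \<in> S \<Longrightarrow> \<phi> * min (card {u \<in> S. x u > x w}) (card S - card {u \<in> S. x u > x w})
        \<le> cut_weight a {u \<in> S. x u > x w} (S - {u \<in> S. x u > x w})"
    and mean: "(\<Sum>u\<in>S. x u - m) = 0"
  shows "\<phi>\<^sup>2 * (\<Sum>u\<in>S. (x u - m)\<^sup>2) \<le> \<Delta> * energy a S x"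
proof (cases "S = {}")
  case True
  then show ?thesis by (simp add: energy_def)
next
  case False
  obtain c where c: "c \<in> x ` S" "2 * card {u \<in> S. x u > c} \<le> card S" "2 * card {u \<in> S. x u < c} \<le> card S"
    using median_exists[OF S False] by blast
  define p q where "p u = max 0 (x u - c)" and "q u = max 0 (c - x u)" for u
  have P: "\<phi>\<^sup>2 * (\<Sum>u\<in>S. (p u)\<^sup>2) \<le> \<Delta> * energy a S p"
  proof (rule cheeger_nonneg_function[OF S sym nonneg deg \<Delta> \<phi>])
    fix t :: real assume t: "t \<ge> 0"
    let ?W = "{u \<in> S. x u \<le> c + t}"
    have ne: "?W \<noteq> {}" using c t by force
    \<comment> \<open>Only cuts at values attained by \<open>x\<close> are tested. The largest such
      value not exceeding c + t, attained at \<open>w\<close>, gives the same cut as c + t.\<close>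
    define d where "d = Max (x ` ?W)"
    have "d \<in> x ` ?W" unfolding d_def using ne S by (intro Max_in) auto
    then obtain w where w: "w \<in> S" "x w = d" "d \<le> c + t" by auto
    have le: "x u \<le> d" if "u \<in> ?W" for u unfolding d_def using that S by (intro Max_ge) auto
    have e1: "{u \<in> S. p u > t} = {u \<in> S. x u > x w}" using w le t by (force simp: p_def)
    have e2: "{u \<in> S. p u \<le> t} = S - {u \<in> S. x u > x w}" unfolding e1[symmetric] by auto
    have "card {u \<in> S. p u > t} \<le> card {u \<in> S. x u > c}"
      using S t by (intro card_mono) (auto simp: p_def)
    then have "min (card {u \<in> S. x u > x w}) (card S - card {u \<in> S. x u > x w}) = card {u \<in> S. p u > t}"
      using c(2) e1 by simp
    then show "\<phi> * card {u \<in> S. p u > t} \<le> cut_weight a {u \<in> S. p u > t} {u \<in> S. p u \<le> t}"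
      using sweep[OF w(1)] unfolding e2 e1 by simp
  qed (auto simp: p_def)
  have Q: "\<phi>\<^sup>2 * (\<Sum>u\<in>S. (q u)\<^sup>2) \<le> \<Delta> * energy a S q"
  proof (rule cheeger_nonneg_function[OF S sym nonneg deg \<Delta> \<phi>])
    fix t :: real assume t: "t \<ge> 0"
    let ?W = "{u \<in> S. x u < c - t}"
    have W: "{u \<in> S. q u > t} = ?W" using t by (auto simp: q_def)
    have W': "{u \<in> S. q u \<le> t} = S - ?W" using t by (auto simp: q_def)
    show "\<phi> * card {u \<in> S. q u > t} \<le> cut_weight a {u \<in> S. q u > t} {u \<in> S. q u \<le> t}"
    proof (cases "?W = {}")
      case True
      then have "card {u \<in> S. q u > t} = 0" unfolding W by (metis card.empty)
      then show ?thesis using cut_weight_nonneg[of a] nonneg by simp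
    next
      case False
      define d where "d = Max (x ` ?W)"
      have "d \<in> x ` ?W" unfolding d_def using False S by (intro Max_in) auto
      then obtain w where w: "w \<in> S" "x w = d" "d < c - t" by auto
      have le: "x u \<le> d" if "u \<in> ?W" for u unfolding d_def using that S by (intro Max_ge) auto
      \<comment> \<open>Below the median the tested cut is the complement of the level set; cut
        weight and smaller side do not distinguish the two.\<close>
      have e1: "{u \<in> S. x u > x w} = S - ?W" using w le by force
      have e2: "S - (S - ?W) = ?W" by blast
      have "card ?W \<le> card {u \<in> S. x u < c}" using S t by (intro card_mono) auto
      moreover have "card {u \<in> S. x u > x w} = card S - card ?W"
        unfolding e1 using S by (intro card_Diff_subset) auto
      moreover have "card ?W \<le> card S" using S by (intro card_mono) auto
      ultimately have "min (card {u \<in> S. x u > x w}) (card S - card {u \<in> S. x u > x w}) = card ?W"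
        using c(3) by simp
      then have "\<phi> * card ?W \<le> cut_weight a (S - ?W) ?W" using sweep[OF w(1)] unfolding e1 e2 by simp
      also have "\<dots> = cut_weight a ?W (S - ?W)" by (rule cut_weight_commute[OF sym])
      finally show ?thesis unfolding W W' .
    qed
  qed (auto simp: q_def)
  \<comment> \<open>\<open>p\<close> and \<open>q\<close> have disjoint supports, so the cross term
    -2 (p u - p v) (q u - q v) equals 2 (p u q v + p v q u) \<ge> 0.\<close>
  have "energy a S p + energy a S q \<le> energy a S x"
    unfolding energy_def sum.distrib[symmetric] distrib_left[symmetric]
  proof (intro sum_mono mult_left_mono nonneg)
    fix u v
    have "(x u - x v)\<^sup>2 = (p u - p v)\<^sup>2 + (q u - q v)\<^sup>2 - 2 * (p u - p v) * (q u - q v)"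
    proof -
      have "x u - x v = (p u - p v) - (q u - q v)" by (simp add: p_def q_def max_def)
      then show ?thesis by (simp add: power2_diff)
    qed
    moreover have "(p u - p v) * (q u - q v) = - (p u * q v + p v * q u)"
    proof -
      have z: "p w * q w = 0" for w by (auto simp: p_def q_def max_def)
      show ?thesis using z[of u] z[of v] by (simp add: algebra_simps del: mult_eq_0_iff)
    qed
    moreover have "p u * q v + p v * q u \<ge> 0" by (simp add: p_def q_def)
    ultimately show "(p u - p v)\<^sup>2 + (q u - q v)\<^sup>2 \<le> (x u - x v)\<^sup>2" by linarith
  qed
  then have "\<Delta> * energy a S p + \<Delta> * energy a S q \<le> \<Delta> * energy a S x"
    using \<Delta> by (simp flip: distrib_left)
  moreover have "(\<Sum>u\<in>S. (x u - c)\<^sup>2) = (\<Sum>u\<in>S. (p u)\<^sup>2) + (\<Sum>u\<in>S. (q u)\<^sup>2)"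
    unfolding sum.distrib[symmetric]
    by (rule sum.cong) (auto simp: p_def q_def max_def power2_commute)
  ultimately have "\<phi>\<^sup>2 * (\<Sum>u\<in>S. (x u - c)\<^sup>2) \<le> \<Delta> * energy a S x"
    using P Q by (simp add: distrib_left)
  moreover have "(\<Sum>u\<in>S. (x u - m)\<^sup>2) \<le> (\<Sum>u\<in>S. (x u - c)\<^sup>2)"
  proof -
    have "(\<Sum>u\<in>S. (x u - c)\<^sup>2) = (\<Sum>u\<in>S. (x u - m)\<^sup>2 + 2 * (m - c) * (x u - m) + (m - c)\<^sup>2)"
      by (rule sum.cong) (auto simp: power2_eq_square algebra_simps)
    also have "\<dots> = (\<Sum>u\<in>S. (x u - m)\<^sup>2) + 2 * (m - c) * (\<Sum>u\<in>S. x u - m) + card S * (m - c)\<^sup>2"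
      by (simp add: sum.distrib sum_distrib_left)
    finally show ?thesis using mean by simp
  qed
  ultimately show ?thesis
    by (meson mult_left_mono order_trans zero_le_power2)
qed

section \<open>Power iteration\<close>

lemma weighted_cauchy_schwarz:
  fixes a x y :: "'a \<Rightarrow> real"
  assumes "finite S" "\<And>u. u \<in> S \<Longrightarrow> a u \<ge> 0"
  shows "(\<Sum>u\<in>S. a u * x u * y u)\<^sup>2 \<le> (\<Sum>u\<in>S. a u * (x u)\<^sup>2) * (\<Sum>u\<in>S. a u * (y u)\<^sup>2)"
proof -
  define X Y B where "X = (\<Sum>u\<in>S. a u * (x u)\<^sup>2)" and "Y = (\<Sum>u\<in>S. a u * (y u)\<^sup>2)"
    and "B = (\<Sum>u\<in>S. a u * x u * y u)"
  have X0: "X \<ge> 0" unfolding X_def using assms by (intro sum_nonneg) auto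
  show ?thesis
  proof (cases "X = 0")
    case True
    then have "\<forall>u\<in>S. a u * (x u)\<^sup>2 = 0"
      unfolding X_def using assms by (subst (asm) sum_nonneg_eq_0_iff) auto
    then have "B = 0" unfolding B_def by (intro sum.neutral) auto
    then show ?thesis using True by (simp add: X_def B_def)
  next
    case False
    have "0 \<le> (\<Sum>u\<in>S. a u * (X * y u - B * x u)\<^sup>2)"
      using assms by (intro sum_nonneg) auto
    also have "\<dots> = (\<Sum>u\<in>S. X\<^sup>2 * (a u * (y u)\<^sup>2) - 2 * X * B * (a u * x u * y u) + B\<^sup>2 * (a u * (x u)\<^sup>2))"
      by (intro sum.cong) (auto simp: power2_eq_square algebra_simps)
    also have "\<dots> = X\<^sup>2 * Y - 2 * X * B * B + B\<^sup>2 * X"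
      by (simp add: sum.distrib sum_subtractf X_def Y_def B_def sum_distrib_left)
    also have "\<dots> = X * (X * Y - B\<^sup>2)" by (simp add: power2_eq_square algebra_simps)
    finally have "X * Y - B\<^sup>2 \<ge> 0" using False X0 by (simp add: zero_le_mult_iff)
    then show ?thesis by (simp add: X_def Y_def B_def)
  qed
qed

text \<open>Cauchy-Schwarz at each vertex. As \<open>energy\<close> is twice the quadratic form of
  the Laplacian L, this is the operator inequality L^2 \<le> 2 \<Delta> L.\<close>

lemma sum_lap_square_le:
  assumes S: "finite S" and nonneg: "\<And>u v. a u v \<ge> 0"
    and deg: "\<And>u. u \<in> S \<Longrightarrow> (\<Sum>v\<in>S. a u v) \<le> \<Delta>"
  shows "(\<Sum>u\<in>S. (lap a S x u)\<^sup>2) \<le> \<Delta> * energy a S x"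
  unfolding energy_def sum_distrib_left
proof (rule sum_mono)
  fix u assume u: "u \<in> S"
  have "(lap a S x u)\<^sup>2 \<le> (\<Sum>v\<in>S. a u v) * (\<Sum>v\<in>S. a u v * (x u - x v)\<^sup>2)"
    using weighted_cauchy_schwarz[of S "a u" "\<lambda>_. 1" "\<lambda>v. x u - x v"] S nonneg by (simp add: lap_def)
  also have "\<dots> \<le> \<Delta> * (\<Sum>v\<in>S. a u v * (x u - x v)\<^sup>2)"
    using deg[OF u] nonneg by (intro mult_right_mono sum_nonneg) auto
  finally show "(lap a S x u)\<^sup>2 \<le> (\<Sum>v\<in>S. \<Delta> * (a u v * (x u - x v)\<^sup>2))" by (simp add: sum_distrib_left)
qed

lemma lap_diff_const: "lap a S (\<lambda>u. x u - c) = lap a S x"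
  by (simp add: lap_def fun_eq_iff)

lemma energy_diff_const: "energy a S (\<lambda>u. x u - c) = energy a S x"
  by (simp add: energy_def)

text \<open>Iterates of 2 D I - L on a unit vector, not normalized, so that they stay integral for
  integral \<open>D\<close> and 0/1 weights. For D \<ge> \<Delta> the shift exceeds the spectrum of
  L, and the small eigenvalues of L become the dominant ones.\<close>

fun power_vec :: "('a \<Rightarrow> 'a \<Rightarrow> real) \<Rightarrow> 'a set \<Rightarrow> real \<Rightarrow> 'a \<Rightarrow> nat \<Rightarrow> 'a \<Rightarrow> real" where
  "power_vec a S D i 0 u = (if u = i then 1 else 0)"
| "power_vec a S D i (Suc t) u = 2 * D * power_vec a S D i t u - lap a S (power_vec a S D i t) u"

text \<open>With the mean removed, |2 D y - L y|^2 = 4 D^2 |y|^2 - 2 D energy + |L y|^2, where |L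
  y|^2 \<le> D energy; \<open>decay\<close> bounds the remaining - D energy by - 2 D \<mu> |y|^2.
  The mean is multiplied by 2 D in each step, because L y has sum 0.\<close>

lemma power_vec_energy_decay:
  assumes S: "finite S" "i \<in> S" and sym: "\<And>u v. a u v = a v u" and nonneg: "\<And>u v. a u v \<ge> 0"
    and deg: "\<And>u. u \<in> S \<Longrightarrow> (\<Sum>v\<in>S. a u v) \<le> \<Delta>" and D: "\<Delta> \<le> D" and \<mu>: "0 \<le> \<mu>" "\<mu> \<le> 2 * D"
    and decay: "\<And>t m. t < k \<Longrightarrow> (\<Sum>u\<in>S. power_vec a S D i t u - m) = 0 \<Longrightarrow>
      2 * \<mu> * (\<Sum>u\<in>S. (power_vec a S D i t u - m)\<^sup>2) \<le> energy a S (power_vec a S D i t)"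
  shows "\<exists>m. (\<Sum>u\<in>S. power_vec a S D i k u - m) = 0 \<and>
    (\<Sum>u\<in>S. (power_vec a S D i k u - m)\<^sup>2) \<le> (4 * D\<^sup>2 - 2 * D * \<mu>) ^ k"
  using decay
proof (induction k)
  case 0
  define m where "m = 1 / real (card S)"
  have c: "card S > 0" using S by (auto simp: card_gt_0_iff)
  have s1: "(\<Sum>u\<in>S. (if u = i then 1 else 0) :: real) = 1" using S by simp
  have "(\<Sum>u\<in>S. ((if u = i then 1 else 0) - m)\<^sup>2) =
      (\<Sum>u\<in>S. (1 - 2 * m) * (if u = i then 1 else 0) + m\<^sup>2)"
    by (intro sum.cong) (auto simp: power2_eq_square algebra_simps)
  also have "\<dots> = (1 - 2 * m) + real (card S) * m\<^sup>2"
    using S by (simp add: sum.distrib flip: sum_distrib_left)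
  also have "\<dots> = 1 - m" using c by (simp add: m_def power2_eq_square field_simps)
  also have "\<dots> \<le> 1" by (simp add: m_def)
  finally show ?case using c S by (intro exI[of _ m]) (auto simp: sum_subtractf m_def)
next
  case (Suc k)
  then obtain m where m: "(\<Sum>u\<in>S. power_vec a S D i k u - m) = 0"
    "(\<Sum>u\<in>S. (power_vec a S D i k u - m)\<^sup>2) \<le> (4 * D\<^sup>2 - 2 * D * \<mu>) ^ k" by force
  define y where "y u = power_vec a S D i k u - m" for u
  have D0: "D \<ge> 0" using \<mu> by simp
  have step: "power_vec a S D i (Suc k) u - 2 * D * m = 2 * D * y u - lap a S y u" for u
  proof -
    have "lap a S (power_vec a S D i k) u = lap a S y u"
      unfolding y_def lap_diff_const ..
    then show ?thesis by (simp add: y_def algebra_simps)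
  qed
  have "(\<Sum>u\<in>S. power_vec a S D i (Suc k) u - 2 * D * m) = 2 * D * (\<Sum>u\<in>S. y u) - (\<Sum>u\<in>S. lap a S y u)"
    unfolding step by (simp add: sum_subtractf sum_distrib_left)
  also have "\<dots> = 0" using m(1) sum_lap[where a = a, OF sym] by (simp add: y_def)
  finally have mean: "(\<Sum>u\<in>S. power_vec a S D i (Suc k) u - 2 * D * m) = 0" .
  have en: "2 * \<mu> * (\<Sum>u\<in>S. (y u)\<^sup>2) \<le> energy a S y"
    using Suc.prems[OF _ m(1)] unfolding y_def energy_diff_const by simp
  have "(\<Sum>u\<in>S. (power_vec a S D i (Suc k) u - 2 * D * m)\<^sup>2) =
      (\<Sum>u\<in>S. 4 * D\<^sup>2 * (y u)\<^sup>2 - 4 * D * (y u * lap a S y u) + (lap a S y u)\<^sup>2)"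
    unfolding step by (intro sum.cong) (auto simp: power2_eq_square algebra_simps)
  also have "\<dots> = 4 * D\<^sup>2 * (\<Sum>u\<in>S. (y u)\<^sup>2) - 4 * D * (energy a S y / 2) + (\<Sum>u\<in>S. (lap a S y u)\<^sup>2)"
    using sum_mult_lap_eq_energy[where a = a, OF sym, of y S]
    by (simp add: sum.distrib sum_subtractf flip: sum_distrib_left)
  also have "\<dots> \<le> 4 * D\<^sup>2 * (\<Sum>u\<in>S. (y u)\<^sup>2) - 4 * D * (energy a S y / 2) + D * energy a S y"
    using sum_lap_square_le[where a = a and x = y, OF S(1) nonneg deg]
      mult_right_mono[OF D energy_nonneg[of a S y]] nonneg by fastforce
  also have "\<dots> = 4 * D\<^sup>2 * (\<Sum>u\<in>S. (y u)\<^sup>2) - D * energy a S y" by simp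
  also have "\<dots> \<le> 4 * D\<^sup>2 * (\<Sum>u\<in>S. (y u)\<^sup>2) - D * (2 * \<mu> * (\<Sum>u\<in>S. (y u)\<^sup>2))"
    using mult_left_mono[OF en D0] by simp
  also have "\<dots> = (4 * D\<^sup>2 - 2 * D * \<mu>) * (\<Sum>u\<in>S. (y u)\<^sup>2)" by (simp add: algebra_simps)
  also have "\<dots> \<le> (4 * D\<^sup>2 - 2 * D * \<mu>) * (4 * D\<^sup>2 - 2 * D * \<mu>) ^ k"
  proof (rule mult_left_mono)
    show "(\<Sum>u\<in>S. (y u)\<^sup>2) \<le> (4 * D\<^sup>2 - 2 * D * \<mu>) ^ k" using m(2) by (simp add: y_def)
    have "D * \<mu> \<le> D * (2 * D)" using \<mu> D0 by (intro mult_left_mono) auto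
    then show "0 \<le> 4 * D\<^sup>2 - 2 * D * \<mu>" by (simp add: power2_eq_square)
  qed
  finally show ?case using mean by (intro exI[of _ "2 * D * m"]) simp
qed

text \<open>Self-adjointness moves L onto the eigenvector, so the component along \<open>x\<close>
  is multiplied by exactly 2 D - l per step. This is set against the upper bound on the norm of the
  iterates.\<close>

lemma power_vec_eigenvector:
  assumes S: "finite S" "i \<in> S" and sym: "\<And>u v. a u v = a v u"
    and ev: "\<And>u. u \<in> S \<Longrightarrow> lap a S x u = l * x u"
  shows "(\<Sum>u\<in>S. x u * power_vec a S D i k u) = (2 * D - l) ^ k * x i"
proof (induction k)
  case 0
  have "(\<Sum>u\<in>S. x u * (if u = i then 1 else 0)) = (\<Sum>u\<in>S. if u = i then x u else 0)"
    by (intro sum.cong) auto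
  then show ?case using S by simp
next
  case (Suc k)
  let ?y = "power_vec a S D i k"
  have "(\<Sum>u\<in>S. x u * power_vec a S D i (Suc k) u) =
      2 * D * (\<Sum>u\<in>S. x u * ?y u) - (\<Sum>u\<in>S. x u * lap a S ?y u)"
    by (simp add: sum_subtractf sum_distrib_left algebra_simps)
  also have "(\<Sum>u\<in>S. x u * lap a S ?y u) = (\<Sum>u\<in>S. ?y u * lap a S x u)"
    by (rule sum_mult_lap_commute[OF sym])
  also have "\<dots> = l * (\<Sum>u\<in>S. x u * ?y u)"
    by (simp add: ev sum_distrib_left mult_ac)
  finally show ?case by (simp add: Suc.IH algebra_simps)
qed

text \<open>A k-th root taken by Bernoulli's inequality: if q exceeded p (1 + m / k), its k-th power
  would exceed p^k (1 + m). The factor \<open>m\<close> thus costs only the additive term r m /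
  k.\<close>

lemma power_le_mult_power_imp_le:
  fixes p q :: real
  assumes p: "0 \<le> p" "p \<le> r" and m: "0 < m" and k: "0 < k" and le: "\<bar>q\<bar> ^ k \<le> m * p ^ k"
  shows "q \<le> p + r * m / real k"
proof (rule ccontr)
  assume "\<not> q \<le> p + r * m / real k"
  moreover have "p * (m / real k) \<le> r * (m / real k)" using p m k by (intro mult_right_mono) auto
  ultimately have q: "q > p * (1 + m / real k)" by (simp add: algebra_simps)
  have p0: "p * (1 + m / real k) \<ge> 0" using p m k by (intro mult_nonneg_nonneg add_nonneg_nonneg) auto
  have "(1 + m) \<le> (1 + m / real k) ^ k"
    using Bernoulli_inequality[of "m / real k" k] m k by (smt (verit, best) divide_nonneg_nonneg
        nonzero_mult_div_cancel_left of_nat_0_less_iff times_divide_eq_right)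
  then have "p ^ k * (1 + m) \<le> p ^ k * (1 + m / real k) ^ k" using p by (intro mult_left_mono) auto
  also have "\<dots> = (p * (1 + m / real k)) ^ k" by (simp add: power_mult_distrib)
  also have "\<dots> < \<bar>q\<bar> ^ k" using q p0 k by (intro power_strict_mono) auto
  also have "\<dots> \<le> m * p ^ k" by (rule le)
  finally have "p ^ k < 0" by (simp add: algebra_simps)
  then show False using p by (simp add: not_less[symmetric])
qed

text \<open>The k-th centred iterate has squared norm at most \<open>P ^ k\<close>, while its inner
  product with the eigenvector is (2 D - l)^k x(i). Starting at a vertex where |x| is largest gives
  x(i)^2 \<ge> |x|^2 / |S|, so Cauchy-Schwarz loses only a factor |S|, and the k-th root turns it
  into the additive error 2 D |S| / k.\<close>

theorem power_vec_sweep: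
  fixes a :: "'a \<Rightarrow> 'a \<Rightarrow> real" and \<phi> :: real
  assumes S: "finite S" and sym: "\<And>u v. a u v = a v u" and nonneg: "\<And>u v. a u v \<ge> 0"
    and deg: "\<And>u. u \<in> S \<Longrightarrow> (\<Sum>v\<in>S. a u v) \<le> \<Delta>" and \<Delta>: "0 < \<Delta>" and D: "\<Delta> \<le> D" and \<phi>: "\<phi> > 0" "\<phi> \<le> 2 * \<Delta>"
    and k: "k > 0"
    and sweep: "\<And>i t w. i \<in> S \<Longrightarrow> t < k \<Longrightarrow> w \<in> S \<Longrightarrow>
      (let A = {u \<in> S. power_vec a S D i t u > power_vec a S D i t w} in
        \<phi> * min (card A) (card S - card A) \<le> cut_weight a A (S - A))"
    and x: "\<exists>u\<in>S. x u \<noteq> 0" "(\<Sum>u\<in>S. x u) = 0" and ev: "\<And>u. u \<in> S \<Longrightarrow> lap a S x u = l * x u"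
  shows "\<phi>\<^sup>2 / (2 * \<Delta>) \<le> 2 * l + 2 * D * card S / k"
proof -
  define \<mu> where "\<mu> = \<phi>\<^sup>2 / (2 * \<Delta>)"
  have \<mu>0: "\<mu> \<ge> 0" using \<Delta> by (simp add: \<mu>_def)
  have "\<phi>\<^sup>2 \<le> (2 * \<Delta>)\<^sup>2" using \<phi> by (intro power_mono) auto
  then have "\<mu> \<le> (2 * \<Delta>)\<^sup>2 / (2 * \<Delta>)" unfolding \<mu>_def using \<Delta> by (intro divide_right_mono) auto
  then have \<mu>2: "\<mu> \<le> 2 * D" using \<Delta> D by (simp add: power2_eq_square)
  have "S \<noteq> {}" using x by auto
  obtain i where i: "i \<in> S" "\<And>u. u \<in> S \<Longrightarrow> (x u)\<^sup>2 \<le> (x i)\<^sup>2"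
  proof -
    have "Max ((\<lambda>u. (x u)\<^sup>2) ` S) \<in> (\<lambda>u. (x u)\<^sup>2) ` S" using S \<open>S \<noteq> {}\<close> by (intro Max_in) auto
    then obtain i where "i \<in> S" "(x i)\<^sup>2 = Max ((\<lambda>u. (x u)\<^sup>2) ` S)" by force
    then show ?thesis using that[of i] S by simp
  qed
  have xi: "(x i)\<^sup>2 > 0"
  proof -
    obtain u where "u \<in> S" "x u \<noteq> 0" using x by blast
    then have "0 < (x u)\<^sup>2" by simp
    then show ?thesis using i(2)[OF \<open>u \<in> S\<close>] by (rule order_less_le_trans)
  qed
  define P where "P = 4 * D\<^sup>2 - 2 * D * \<mu>"
  have D0: "D > 0" using \<Delta> D by simp
  have "D * \<mu> \<le> D * (2 * D)" using \<mu>2 D0 by (intro mult_left_mono) auto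
  then have P0: "P \<ge> 0" by (simp add: P_def power2_eq_square)
  have P1: "P \<le> 4 * D\<^sup>2" using \<mu>0 D0 by (simp add: P_def)
  obtain m where m: "(\<Sum>u\<in>S. power_vec a S D i k u - m) = 0"
    "(\<Sum>u\<in>S. (power_vec a S D i k u - m)\<^sup>2) \<le> P ^ k"
  proof (atomize_elim, unfold P_def, rule power_vec_energy_decay[OF S i(1) sym nonneg deg D \<mu>0 \<mu>2])
    fix t m assume t: "t < k" and mean: "(\<Sum>u\<in>S. power_vec a S D i t u - m) = 0"
    have "\<phi>\<^sup>2 * (\<Sum>u\<in>S. (power_vec a S D i t u - m)\<^sup>2) \<le> \<Delta> * energy a S (power_vec a S D i t)"
      by (rule cheeger_sweep[OF S sym nonneg deg \<Delta> \<phi>(1) _ mean]) (use sweep[OF i(1) t] in \<open>auto simp: Let_def\<close>)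
    then show "2 * \<mu> * (\<Sum>u\<in>S. (power_vec a S D i t u - m)\<^sup>2) \<le> energy a S (power_vec a S D i t)"
      using \<Delta> by (simp add: \<mu>_def field_simps)
  qed
  let ?y = "\<lambda>u. power_vec a S D i k u - m"
  \<comment> \<open>Removing the mean does not change the inner product with \<open>x\<close>, which
    has sum 0.\<close>
  have "(\<Sum>u\<in>S. x u * ?y u) = (\<Sum>u\<in>S. x u * power_vec a S D i k u) - m * (\<Sum>u\<in>S. x u)"
    by (simp add: sum_subtractf sum_distrib_left algebra_simps)
  then have "(\<Sum>u\<in>S. x u * ?y u) = (2 * D - l) ^ k * x i"
    using power_vec_eigenvector[OF S i(1) sym ev] x by simp
  then have "((2 * D - l) ^ k * x i)\<^sup>2 \<le> (\<Sum>u\<in>S. (x u)\<^sup>2) * (\<Sum>u\<in>S. (?y u)\<^sup>2)"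
    using weighted_cauchy_schwarz[of S "\<lambda>_. 1" x ?y] S by simp
  also have "\<dots> \<le> (real (card S) * (x i)\<^sup>2) * P ^ k"
  proof (intro mult_mono m(2))
    show "(\<Sum>u\<in>S. (x u)\<^sup>2) \<le> real (card S) * (x i)\<^sup>2"
      using sum_bounded_above[of S "\<lambda>u. (x u)\<^sup>2" "(x i)\<^sup>2"] i(2) by simp
  qed (auto intro: sum_nonneg)
  finally have "(x i)\<^sup>2 * ((2 * D - l)\<^sup>2) ^ k \<le> (x i)\<^sup>2 * (real (card S) * P ^ k)"
    by (simp add: power_mult_distrib mult_ac power_mult[symmetric])
  then have "((2 * D - l)\<^sup>2) ^ k \<le> real (card S) * P ^ k" using xi by simp
  then have "(2 * D - l)\<^sup>2 \<le> P + 4 * D\<^sup>2 * card S / real k"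
    using S \<open>S \<noteq> {}\<close> k by (intro power_le_mult_power_imp_le P0 P1) (auto simp: card_gt_0_iff)
  moreover have "(2 * D - l)\<^sup>2 \<ge> 4 * D\<^sup>2 - 4 * D * l" by (simp add: power2_eq_square algebra_simps)
  ultimately have "2 * D * \<mu> \<le> 4 * D * l + 4 * D\<^sup>2 * card S / real k" by (simp add: P_def)
  then have "(2 * D) * \<mu> \<le> (2 * D) * (2 * l + 2 * D * card S / k)"
    by (simp add: power2_eq_square algebra_simps)
  then have "\<mu> \<le> 2 * l + 2 * D * card S / k"
    by (rule mult_left_le_imp_le) (use D0 in simp)
  then show ?thesis unfolding \<mu>_def .
qed

section \<open>Total correctness and running time of programs\<close>

fun writes :: "com \<Rightarrow> string set" where
  "writes Skip = {}"
| "writes (Store x a b) = {x}"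
| "writes (Seq c d) = writes c \<union> writes d"
| "writes (If b c d) = writes c \<union> writes d"
| "writes (While b c) = writes c"

lemma exec_frame: "exec c s t s' \<Longrightarrow> x \<notin> writes c \<Longrightarrow> s' x = s x"
  by (induction rule: exec.induct) auto

text \<open>\<open>B\<close> acts as a word length. The bound covers all cells of all banks, so the
  content of a cell is short whatever its address.\<close>

definition bounded :: "nat \<Rightarrow> state \<Rightarrow> bool" where
  "bounded B s \<longleftrightarrow> (\<forall>x i. \<bar>s x i\<bar> \<le> 2 ^ B)"

text \<open>Bounds the bit length of the value in units of the word length. Lengths add for sums as
  well as for products, as 2^p + 2^q \<le> 2^(p + q) for p, q \<ge> 1.\<close>

fun val_size :: "aexp \<Rightarrow> nat" where
  "val_size (Const i) = bit_size i"
| "val_size (Cell x a) = 1"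
| "val_size (Op f a b) = val_size a + val_size b"

fun cost_size :: "aexp \<Rightarrow> nat" where
  "cost_size (Const i) = bit_size i"
| "cost_size (Cell x a) = cost_size a + 3 * val_size a + 3"
| "cost_size (Op f a b) = cost_size a + cost_size b + 3 * val_size a + 3 * val_size b"

lemma val_size_pos: "val_size a \<ge> 1"
  by (induction a) (auto simp: bit_size_def)

lemma abs_le_bit_size: "\<bar>i\<bar> \<le> 2 ^ bit_size i"
proof (cases "i = 0")
  case False
  then have "nat \<bar>i\<bar> < 2 ^ floorlog 2 (nat \<bar>i\<bar>)" 
    using floorlog_bounds[of "nat \<bar>i\<bar>" 2] by simp
  also have "\<dots> \<le> 2 ^ bit_size i" by (simp add: bit_size_def)
  finally show ?thesis by (simp add: nat_less_iff)
qed simp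

lemma bit_size_le:
  assumes "\<bar>i\<bar> \<le> 2 ^ w"
  shows "bit_size i \<le> w + 2"
proof -
  have "nat \<bar>i\<bar> \<le> 2 ^ w" using assms by (simp add: nat_le_iff)
  then have "floorlog 2 (nat \<bar>i\<bar>) \<le> floorlog 2 (1 * 2 ^ w)" by (intro floorlog_mono) simp
  also have "\<dots> = floorlog 2 1 + w" by (rule floorlog_power) auto
  also have "floorlog 2 1 = 1" by (simp add: floorlog_def)
  finally show ?thesis by (simp add: bit_size_def)
qed

text \<open>Rounding down can enlarge a negative quotient in absolute value, but never beyond the
  integer obtained with divisor 1 or -1; division by 0 gives 0.\<close>

lemma abs_div_le: "\<bar>x div y\<bar> \<le> \<bar>x :: int\<bar>"
proof -
  consider "y = 0" | "y > 0" "x \<ge> 0" | "y > 0" "x < 0" | "y < 0" "x > 0" | "y < 0" "x \<le> 0" by linarith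
  then show ?thesis
  proof cases
    case 2
    then show ?thesis by (simp add: div_int_pos_iff zdiv_mono2 int_div_less_self order_trans[OF zdiv_mono2[of x 1 y]])
  next
    case 3
    then have "x div y < 0" "x div 1 \<le> x div y" 
      using zdiv_mono2_neg[of x 1 y] by (auto simp: neg_imp_zdiv_neg_iff pos_imp_zdiv_neg_iff)
    then show ?thesis using 3 by simp
  next
    case 4
    then have "(- x) div 1 \<le> (- x) div (- y)" "(- x) div (- y) < 0"
      using zdiv_mono2_neg[of "- x" 1 "- y"] by (auto simp del: div_minus_minus simp: pos_imp_zdiv_neg_iff)
    then show ?thesis using 4 by simp
  next
    case 5
    then have "(- x) div (- y) \<le> (- x) div 1" "(- x) div (- y) \<ge> 0"
      using zdiv_mono2[of "- x" 1 "- y"] by (auto simp del: div_minus_minus simp: pos_imp_zdiv_nonneg_iff)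
    then show ?thesis using 5 by simp
  qed simp
qed

lemma abs_aval_le:
  assumes "bounded B s" "B \<ge> 1"
  shows "\<bar>aval a s\<bar> \<le> 2 ^ (val_size a * B)"
proof (induction a)
  case (Const i)
  have "\<bar>i\<bar> \<le> 2 ^ bit_size i" by (rule abs_le_bit_size)
  also have "\<dots> \<le> 2 ^ (bit_size i * B)" using assms(2) by (intro power_increasing) auto
  finally show ?case by simp
next
  case (Cell x a)
  then show ?case using assms by (simp add: bounded_def)
next
  case (Op f a b)
  define p q where "p = val_size a * B" and "q = val_size b * B"
  have pq: "p \<ge> 1" "q \<ge> 1" using assms(2) val_size_pos[of a] val_size_pos[of b] by (simp_all add: p_def q_def)
  have A: "\<bar>aval a s\<bar> \<le> 2 ^ p" and B: "\<bar>aval b s\<bar> \<le> 2 ^ q" using Op by (simp_all add: p_def q_def)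
  have pw: "(2::int) ^ (p + q) = 2 ^ p * 2 ^ q" by (simp add: power_add)
  have "(2::int) ^ 1 \<le> 2 ^ p" "(2::int) ^ 1 \<le> 2 ^ q" using pq by (intro power_increasing; simp)+
  then have P: "(2::int) \<le> 2 ^ p" "(2::int) \<le> 2 ^ q" by simp_all
  then have "0 \<le> ((2::int) ^ p - 1) * (2 ^ q - 1) - 1" 
    using mult_mono[of 1 "(2::int) ^ p - 1" 1 "2 ^ q - 1"] by simp
  then have sum: "(2::int) ^ p + 2 ^ q \<le> 2 ^ (p + q)" unfolding pw by (simp add: algebra_simps)
  have "\<bar>arith_val f (aval a s) (aval b s)\<bar> \<le> 2 ^ (p + q)"
  proof (cases f)
    case Mul
    then show ?thesis using A B unfolding pw by (simp add: abs_mult mult_mono)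
  next
    case Div
    have "\<bar>aval a s div aval b s\<bar> \<le> \<bar>aval a s\<bar>" by (rule abs_div_le)
    also note A
    also have "(2::int) ^ p \<le> 2 ^ (p + q)" by (intro power_increasing) auto
    finally show ?thesis using Div by simp
  qed (use A B sum in auto)
  then show ?case by (simp add: p_def q_def distrib_right)
qed

text \<open>The factor 3 absorbs the additive 2 of \<open>bit_size_le\<close>, because
  \<open>val_size a * B\<close> is at least 1.\<close>

lemma bit_size_aval_le:
  assumes "bounded B s" "B \<ge> 1"
  shows "bit_size (aval a s) \<le> 3 * val_size a * B"
proof -
  define p where "p = val_size a * B"
  have "p \<ge> 1" using val_size_pos[of a] assms(2) by (simp add: p_def)
  moreover have "bit_size (aval a s) \<le> p + 2" unfolding p_def by (rule bit_size_le[OF abs_aval_le[OF assms]])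
  ultimately have "bit_size (aval a s) \<le> 3 * p" by linarith
  then show ?thesis by (simp add: p_def mult.assoc)
qed

lemma acost_le:
  assumes "bounded B s" "B \<ge> 1"
  shows "acost a s \<le> cost_size a * B"
proof (induction a)
  case (Const i)
  then show ?case using assms(2) by simp
next
  case (Cell x a)
  have "bit_size (s x (aval a s)) \<le> 3 * B"
    using bit_size_aval_le[OF assms, of "Cell x a"] by simp
  then show ?case using Cell bit_size_aval_le[OF assms, of a] by (simp add: algebra_simps)
next
  case (Op f a b)
  then show ?case using bit_size_aval_le[OF assms, of a] bit_size_aval_le[OF assms, of b]
    by (simp add: algebra_simps)
qed

text \<open>A bound on the running time in units of the word size, valid when every loop makes at most \<open>M\<close>
  iterations each time it is entered.\<close>
fun cost :: "nat \<Rightarrow> com \<Rightarrow> nat" where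
  "cost M Skip = 1"
| "cost M (Store x a b) = cost_size a + cost_size b + 3 * val_size a + 3 * val_size b"
| "cost M (Seq c d) = cost M c + cost M d"
| "cost M (If b c d) = cost_size b + 3 * val_size b + cost M c + cost M d"
| "cost M (While b c) = M * (cost_size b + 3 * val_size b + cost M c) + cost_size b + 3 * val_size b"

text \<open>Only loops multiply by \<open>M\<close>, so the degree is at most the nesting depth of
  the loops.\<close>

lemma cost_poly: "\<exists>p :: nat poly. \<forall>M. cost M c = poly p M"
proof (induction c)
  case Skip
  show ?case by (rule exI[of _ "[:1:]"]) simp
next
  case (Store x a b)
  show ?case by (rule exI[of _ "[:cost_size a + cost_size b + 3 * val_size a + 3 * val_size b:]"]) simp
next
  case (Seq c d)
  then obtain p q where "\<forall>M. cost M c = poly p M" "\<forall>M. cost M d = poly q M" by blast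
  then show ?case by (intro exI[of _ "p + q"]) simp
next
  case (If b c d)
  then obtain p q where "\<forall>M. cost M c = poly p M" "\<forall>M. cost M d = poly q M" by blast
  then show ?case by (intro exI[of _ "[:cost_size b + 3 * val_size b:] + p + q"]) simp
next
  case (While b c)
  then obtain p where "\<forall>M. cost M c = poly p M" by blast
  then show ?case
    by (intro exI[of _ "[:0,1:] * ([:cost_size b + 3 * val_size b:] + p) + [:cost_size b + 3 * val_size b:]"])
      (simp add: algebra_simps)
qed

section \<open>Total-correctness rules with time and word-size bounds\<close>

definition same_outside :: "string set \<Rightarrow> state \<Rightarrow> state \<Rightarrow> bool" where
  "same_outside X s s' \<longleftrightarrow> (\<forall>x. x \<notin> X \<longrightarrow> s' x = s x)"

lemma same_outsideD: "same_outside X s s' \<Longrightarrow> x \<notin> X \<Longrightarrow> s' x = s x"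
  by (simp add: same_outside_def)

text \<open>Boundedness is assumed before and guaranteed after, so only values written by
  \<open>Store\<close> are ever checked against \<open>B\<close>. The time bound is always the
  syntactic cost, so specifications need not mention time.\<close>

definition wp :: "nat \<Rightarrow> nat \<Rightarrow> com \<Rightarrow> (state \<Rightarrow> bool) \<Rightarrow> state \<Rightarrow> bool" where
  "wp M B c Q s \<longleftrightarrow> (bounded B s \<longrightarrow>
     (\<exists>t s'. exec c s t s' \<and> t \<le> cost M c * B \<and> bounded B s' \<and> Q s'))"

context
  fixes M B :: nat
  assumes B: "B \<ge> 1"
begin

text \<open>The frame condition is supplied for free when the postcondition is changed; this is how
  facts about untouched banks survive a command.\<close>

lemma wp_mono:
  assumes "wp M B c Q s" "\<And>s'. Q s' \<Longrightarrow> same_outside (writes c) s s' \<Longrightarrow> Q' s'"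
  shows "wp M B c Q' s"
  using assms exec_frame unfolding wp_def same_outside_def by metis

lemma wp_Skip: "Q s \<Longrightarrow> wp M B Skip Q s"
  unfolding wp_def using exec.Skip[of s] B by auto

lemma wp_Store:
  assumes "bounded B s \<Longrightarrow> \<bar>aval b s\<bar> \<le> 2 ^ B" "Q (s(x := (s x)(aval a s := aval b s)))"
  shows "wp M B (Store x a b) Q s"
  unfolding wp_def
proof
  assume bd: "bounded B s"
  have "acost a s + acost b s + bit_size (aval a s) + bit_size (aval b s) \<le> cost M (Store x a b) * B"
    using acost_le[OF bd B, of a] acost_le[OF bd B, of b]
      bit_size_aval_le[OF bd B, of a] bit_size_aval_le[OF bd B, of b] by (simp add: algebra_simps)
  moreover have "bounded B (s(x := (s x)(aval a s := aval b s)))"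
    using bd assms(1) by (auto simp: bounded_def)
  ultimately show "\<exists>t s'. exec (Store x a b) s t s' \<and> t \<le> cost M (Store x a b) * B \<and> bounded B s' \<and> Q s'"
    using exec.Store[of x a b s] assms(2) by blast
qed

lemma wp_Seq:
  assumes "wp M B c (wp M B d Q) s"
  shows "wp M B (Seq c d) Q s"
  unfolding wp_def
proof
  assume "bounded B s"
  then obtain t s' where 1: "exec c s t s'" "t \<le> cost M c * B" "bounded B s'" "wp M B d Q s'"
    using assms unfolding wp_def[of _ _ c] by blast
  then obtain t' s'' where 2: "exec d s' t' s''" "t' \<le> cost M d * B" "bounded B s''" "Q s''"
    unfolding wp_def by blast
  have "exec (Seq c d) s (t + t') s''" using 1 2 by (intro exec.Seq)
  moreover have "t + t' \<le> cost M (Seq c d) * B" using 1 2 by (simp add: distrib_right)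
  ultimately show "\<exists>t s'. exec (Seq c d) s t s' \<and> t \<le> cost M (Seq c d) * B \<and> bounded B s' \<and> Q s'"
    using 2 by blast
qed

lemma wp_If:
  assumes "aval b s > 0 \<Longrightarrow> wp M B c Q s" "\<not> aval b s > 0 \<Longrightarrow> wp M B d Q s"
  shows "wp M B (If b c d) Q s"
  unfolding wp_def
proof
  assume bd: "bounded B s"
  have guard: "acost b s + bit_size (aval b s) \<le> (cost_size b + 3 * val_size b) * B"
    using acost_le[OF bd B, of b] bit_size_aval_le[OF bd B, of b] by (simp add: algebra_simps)
  show "\<exists>t s'. exec (If b c d) s t s' \<and> t \<le> cost M (If b c d) * B \<and> bounded B s' \<and> Q s'"
  proof (cases "aval b s > 0")
    case True
    then obtain t s' where 1: "exec c s t s'" "t \<le> cost M c * B" "bounded B s'" "Q s'"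
      using assms(1) bd unfolding wp_def by blast
    moreover have "acost b s + bit_size (aval b s) + t \<le> cost M (If b c d) * B"
      using guard 1(2) by (simp add: distrib_right)
    ultimately show ?thesis using exec.IfTrue[OF True] by blast
  next
    case False
    then obtain t s' where 1: "exec d s t s'" "t \<le> cost M d * B" "bounded B s'" "Q s'"
      using assms(2) bd unfolding wp_def by blast
    moreover have "acost b s + bit_size (aval b s) + t \<le> cost M (If b c d) * B"
      using guard 1(2) by (simp add: distrib_right)
    ultimately show ?thesis using exec.IfFalse[OF False] by blast
  qed
qed

text \<open>The number \<open>n\<close> of iterations is fixed in advance and the invariant is
  indexed by the iterations done; termination and the factor \<open>M\<close> follow
  together.\<close>

lemma wp_While:
  assumes "I 0 s" "n \<le> M"
    and step: "\<And>j s. j < n \<Longrightarrow> I j s \<Longrightarrow> aval b s > 0 \<and> wp M B c (I (Suc j)) s"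
    and exit: "\<And>s. I n s \<Longrightarrow> \<not> aval b s > 0 \<and> Q s"
  shows "wp M B (While b c) Q s"
  unfolding wp_def
proof
  assume bd: "bounded B s"
  define g where "g = cost_size b + 3 * val_size b"
  have guard: "acost b s + bit_size (aval b s) \<le> g * B" if "bounded B s" for s
    using acost_le[OF that B, of b] bit_size_aval_le[OF that B, of b] by (simp add: g_def algebra_simps)
  have "\<exists>t s'. exec (While b c) s t s' \<and> t \<le> (j * (g + cost M c) + g) * B \<and> bounded B s' \<and> Q s'"
    if "j \<le> n" "I (n - j) s" "bounded B s" for j s
    using that
  proof (induction j arbitrary: s)
    case 0
    then have "\<not> aval b s > 0" "Q s" using exit by auto
    then show ?case using exec.WhileFalse guard[OF 0(3)] 0(3) by fastforce
  next
    case (Suc j)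
    have le: "n - Suc j < n" and S: "Suc (n - Suc j) = n - j" using Suc.prems(1) by auto
    from step[OF le Suc.prems(2)] S have b: "aval b s > 0" and w: "wp M B c (I (n - j)) s" by auto
    then obtain t s' where 1: "exec c s t s'" "t \<le> cost M c * B" "bounded B s'" "I (n - j) s'"
      using Suc.prems(3) unfolding wp_def by blast
    from Suc.IH[OF _ 1(4) 1(3)] Suc.prems(1) obtain t' s'' where
      2: "exec (While b c) s' t' s''" "t' \<le> (j * (g + cost M c) + g) * B" "bounded B s''" "Q s''" by auto
    have "acost b s + bit_size (aval b s) + t + t' \<le> (Suc j * (g + cost M c) + g) * B"
      using guard[OF Suc.prems(3)] 1(2) 2(2) by (simp add: algebra_simps)
    then show ?case using exec.WhileTrue[OF b 1(1) 2(1)] 2 by blast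
  qed
  from this[of n s] obtain t s' where "exec (While b c) s t s'" "t \<le> (n * (g + cost M c) + g) * B"
    "bounded B s'" "Q s'" using assms(1) bd by auto
  moreover have "(n * (g + cost M c) + g) * B \<le> cost M (While b c) * B"
    using assms(2) by (simp add: g_def add.assoc)
  ultimately show "\<exists>t s'. exec (While b c) s t s' \<and> t \<le> cost M (While b c) * B \<and> bounded B s' \<and> Q s'"
    by (meson order_trans)
qed

end

abbreviation V :: "string \<Rightarrow> aexp" where
  "V x \<equiv> Cell x (Const 0)"

abbreviation Assign :: "string \<Rightarrow> aexp \<Rightarrow> com" where
  "Assign x e \<equiv> Store x (Const 0) e"

definition For :: "string \<Rightarrow> aexp \<Rightarrow> com \<Rightarrow> com" where
  "For i e c = Seq (Assign i (Const 0))
     (While (Op Sub e (V i)) (Seq c (Assign i (Op Add (V i) (Const 1)))))"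

lemma writes_For [simp]: "writes (For i e c) = insert i (writes c)"
  by (simp add: For_def)

text \<open>The bound \<open>e\<close> is evaluated anew before each iteration, hence it must keep
  its value in every state that differs only where the loop writes. The body has to establish the
  invariant for the state with the counter already advanced.\<close>

lemma wp_For:
  assumes B: "B \<ge> 1" and i: "i \<notin> writes c" and n: "n \<le> M" "int n \<le> 2 ^ B"
    and e: "\<And>s'. same_outside (insert i (writes c)) s s' \<Longrightarrow> aval e s' = int n"
    and init: "I 0 (s(i := (s i)(0 := 0)))"
    and step: "\<And>j s'. j < n \<Longrightarrow> I j s' \<Longrightarrow> s' i 0 = int j \<Longrightarrow> same_outside (insert i (writes c)) s s' \<Longrightarrow>
      wp M B c (\<lambda>s''. I (Suc j) (s''(i := (s'' i)(0 := int (Suc j))))) s'"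
    and exit: "\<And>s'. I n s' \<Longrightarrow> same_outside (insert i (writes c)) s s' \<Longrightarrow> Q s'"
  shows "wp M B (For i e c) Q s"
  unfolding For_def
proof (rule wp_Seq[OF B], rule wp_Store[OF B])
  let ?J = "\<lambda>j s'. I j s' \<and> s' i 0 = int j \<and> same_outside (insert i (writes c)) s s'"
  let ?s = "s(i := (s i)(aval (Const 0) s := aval (Const 0) s))"
  show "wp M B (While (Op Sub e (V i)) (Seq c (Assign i (Op Add (V i) (Const 1))))) Q ?s"
  proof (rule wp_While[OF B, of ?J _ n])
    show "?J 0 ?s" using init by (simp add: same_outside_def)
    fix j s' assume j: "j < n" and J: "?J j s'"
    have "wp M B (Seq c (Assign i (Op Add (V i) (Const 1)))) (?J (Suc j)) s'"
    proof (rule wp_Seq[OF B], rule wp_mono[OF B step[OF j]])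
      fix s'' assume I: "I (Suc j) (s''(i := (s'' i)(0 := int (Suc j))))" and f: "same_outside (writes c) s' s''"
      have i'': "s'' i 0 = int j" using f i J by (simp add: same_outside_def)
      show "wp M B (Assign i (Op Add (V i) (Const 1))) (?J (Suc j)) s''"
      proof (rule wp_Store[OF B])
        have "int j + 1 \<le> 2 ^ B" using j n(2) by linarith
        then show "\<bar>aval (Op Add (V i) (Const 1)) s''\<bar> \<le> 2 ^ B" using i'' by simp
      next
        have "aval (Op Add (V i) (Const 1)) s'' = int (Suc j)" using i'' by simp
        then show "?J (Suc j) (s''(i := (s'' i)(aval (Const 0) s'' := aval (Op Add (V i) (Const 1)) s'')))"
          using I f J by (auto simp: same_outside_def add.commute)
      qed
    qed (use J in auto)
    then show "aval (Op Sub e (V i)) s' > 0 \<and> wp M B (Seq c (Assign i (Op Add (V i) (Const 1)))) (?J (Suc j)) s'"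
      using e[of s'] J j by simp
  qed (use n e exit in auto)
qed simp

section \<open>The algorithm\<close>

abbreviation nE :: aexp where "nE \<equiv> Cell ''in'' (Const 0)"

text \<open>The offset 3 skips \<open>n\<close> and the two integers that represent
  \<delta>.\<close>

abbreviation adjE :: "aexp \<Rightarrow> aexp \<Rightarrow> aexp" where
  "adjE a b \<equiv> Cell ''in'' (Op Add (Const 3) (Op Add (Op Mul a nE) b))"

text \<open>Positive iff the operands are equal.\<close>
abbreviation eqE :: "aexp \<Rightarrow> aexp \<Rightarrow> aexp" where
  "eqE a b \<equiv> Op Sub (Const 1) (Op Mul (Op Sub a b) (Op Sub a b))"

text \<open>With \<open>8 n\<^sup>5\<close> iterations the error of the power method is below the square of the
  least positive cut ratio, so that it can be absorbed.\<close>
definition kE :: aexp where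
  "kE = Op Mul (Const 8) (Op Mul nE (Op Mul nE (Op Mul nE (Op Mul nE nE))))"

text \<open>Bank \<open>lab\<close> labels the vertices by their pieces. The current piece \<open>S\<close> has size \<open>m\<close>, and its best cut so far is
  \<open>C\<close>, of ratio \<open>be / bm\<close> (initially \<open>1 / 0\<close>). The best ratio \<open>Be / Bm\<close> of a large piece starts as \<open>0 / 1\<close>.\<close>

definition pick_com :: com where
  "pick_com = Seq (Assign ''q'' (Const (-1))) (For ''v'' nE (For ''u'' nE
     (If (Op Sub (V ''u'') (V ''v''))
       (If (eqE (Cell ''lab'' (V ''u'')) (Cell ''lab'' (V ''v''))) (Assign ''q'' (Cell ''lab'' (V ''v''))) Skip)
       Skip)))"

definition collect_com :: com where
  "collect_com = Seq (Assign ''m'' (Const 0)) (For ''v'' nE (Seq (Store ''C'' (V ''v'') (Const 0))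
     (If (eqE (Cell ''lab'' (V ''v'')) (V ''q''))
       (Seq (Store ''S'' (V ''v'') (Const 1)) (Assign ''m'' (Op Add (V ''m'') (Const 1))))
       (Store ''S'' (V ''v'') (Const 0)))))"

text \<open>As \<open>S\<close> holds 0 or 1, positivity of the product expresses the conjunction of
  u \<in> S and x(u) > x(w).\<close>

definition threshold_com :: com where
  "threshold_com = Seq (Assign ''sz'' (Const 0)) (For ''u'' nE
     (If (Op Mul (Cell ''S'' (V ''u'')) (Op Sub (Cell ''x'' (V ''u'')) (Cell ''x'' (V ''w''))))
       (Seq (Store ''B'' (V ''u'') (Const 1)) (Assign ''sz'' (Op Add (V ''sz'') (Const 1))))
       (Store ''B'' (V ''u'') (Const 0))))"

definition count_com :: com where
  "count_com = Seq (Assign ''e'' (Const 0)) (For ''u'' nE (For ''v'' nE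
     (Assign ''e'' (Op Add (V ''e'') (Op Mul (adjE (V ''u'') (V ''v''))
       (Op Mul (Cell ''B'' (V ''u'')) (Op Sub (Cell ''S'' (V ''v'')) (Cell ''B'' (V ''v'')))))))))"

text \<open>Ratios are compared by cross multiplication. Against the initial 1 / 0 the test reads
  \<open>mn\<close> > 0, so the first proper cut is accepted, and a cut with an empty side never
  is.\<close>

definition improve_com :: com where
  "improve_com = Seq
     (If (Op Sub (V ''sz'') (Op Sub (V ''m'') (V ''sz''))) (Assign ''mn'' (Op Sub (V ''m'') (V ''sz''))) (Assign ''mn'' (V ''sz'')))
     (If (Op Sub (Op Mul (V ''be'') (V ''mn'')) (Op Mul (V ''e'') (V ''bm'')))
       (Seq (Assign ''be'' (V ''e'')) (Seq (Assign ''bm'' (V ''mn''))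
         (For ''u'' nE (Store ''C'' (V ''u'') (Cell ''B'' (V ''u''))))))
       Skip)"

definition sweep_com :: com where
  "sweep_com = Seq threshold_com (Seq count_com improve_com)"

text \<open>The buffer \<open>y\<close> makes the update simultaneous; the factor S(u) S(v)
  restricts the graph to the current piece.\<close>

definition step_com :: com where
  "step_com = Seq
     (For ''u'' nE (Seq (Store ''y'' (V ''u'') (Op Mul (Op Mul (Const 2) nE) (Cell ''x'' (V ''u''))))
       (For ''v'' nE (Store ''y'' (V ''u'') (Op Sub (Cell ''y'' (V ''u''))
         (Op Mul (Op Mul (adjE (V ''u'') (V ''v'')) (Op Mul (Cell ''S'' (V ''u'')) (Cell ''S'' (V ''v''))))
           (Op Sub (Cell ''x'' (V ''u'')) (Cell ''x'' (V ''v'')))))))))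
     (For ''u'' nE (Store ''x'' (V ''u'') (Cell ''y'' (V ''u''))))"

definition power_com :: com where
  "power_com = For ''i'' nE (Seq (For ''u'' nE (Store ''x'' (V ''u'') (Const 0)))
     (Seq (Store ''x'' (V ''i'') (Const 1)) (For ''t'' kE (Seq (For ''w'' nE sweep_com) step_com))))"

text \<open>Adding 1 turns the strict test into 8 |S| den \<ge> 3 num n, the size requirement for
  \<delta> = num / den. Here the larger ratio wins, in contrast to the search for a cut within a
  piece.\<close>

definition record_com :: com where
  "record_com = If (Op Add (Op Sub (Op Mul (Const 8) (Op Mul (V ''m'') (Cell ''in'' (Const 2))))
       (Op Mul (Const 3) (Op Mul (Cell ''in'' (Const 1)) nE))) (Const 1))
     (If (Op Sub (Op Mul (V ''be'') (V ''Bm'')) (Op Mul (V ''Be'') (V ''bm'')))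
       (Seq (Assign ''Be'' (V ''be'')) (Seq (Assign ''Bm'' (V ''bm''))
         (For ''v'' nE (Store ''out'' (V ''v'') (Cell ''S'' (V ''v''))))))
       Skip)
     Skip"

text \<open>Before round \<open>r\<close> all labels are at most \<open>r\<close>, so r + 1 is
  fresh; the other side keeps its label.\<close>

definition split_com :: com where
  "split_com = For ''v'' nE (If (Cell ''C'' (V ''v'')) (Store ''lab'' (V ''v'') (Op Add (V ''r'') (Const 1))) Skip)"

definition round_com :: com where
  "round_com = Seq pick_com (Seq collect_com (Seq (Assign ''be'' (Const 1)) (Seq (Assign ''bm'' (Const 0))
     (Seq power_com (Seq record_com split_com)))))"

text \<open>The whole vertex set with ratio 0 / 1 is a valid answer from the start; the 0 and the
  common initial label 0 come from the blank memory. Each round that finds a splittable piece adds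
  one label, so \<open>n\<close> rounds end in singletons.\<close>

definition main_com :: com where
  "main_com = Seq (For ''v'' nE (Store ''out'' (V ''v'') (Const 1))) (Seq (Assign ''Bm'' (Const 1))
     (For ''r'' nE round_com))"

lemma writes_coms [simp]:
  "writes pick_com = {''q'', ''v'', ''u''}"
  "writes collect_com = {''m'', ''v'', ''C'', ''S''}"
  "writes threshold_com = {''sz'', ''u'', ''B''}"
  "writes count_com = {''e'', ''u'', ''v''}"
  "writes improve_com = {''mn'', ''be'', ''bm'', ''u'', ''C''}"
  "writes sweep_com = {''sz'', ''u'', ''B'', ''e'', ''v'', ''mn'', ''be'', ''bm'', ''C''}"
  "writes step_com = {''u'', ''y'', ''v'', ''x''}"
  "writes power_com = {''i'', ''t'', ''w'', ''sz'', ''u'', ''B'', ''e'', ''v'', ''mn'', ''be'', ''bm'', ''C'', ''y'', ''x''}"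
  "writes record_com = {''Be'', ''Bm'', ''v'', ''out''}"
  "writes split_com = {''v'', ''lab''}"
  "writes round_com = {''q'', ''m'', ''S'', ''i'', ''t'', ''w'', ''sz'', ''u'', ''B'', ''e'', ''v'', ''mn'', ''be'', ''bm'',
     ''C'', ''y'', ''x'', ''Be'', ''Bm'', ''out'', ''lab''}"
  by (auto simp: pick_com_def collect_com_def threshold_com_def count_com_def improve_com_def sweep_com_def
      step_com_def power_com_def record_com_def split_com_def round_com_def)

section \<open>Integer and set models of the data of the program\<close>

lemma square_diff_less_one:
  fixes a b :: int
  shows "(a - b) * (a - b) < 1 \<longleftrightarrow> a = b" and "1 \<le> (a - b) * (a - b) \<longleftrightarrow> a \<noteq> b"
proof -
  have "a \<noteq> b \<Longrightarrow> 0 < (a - b) * (a - b)" by (auto simp: zero_less_mult_iff linorder_neq_iff)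
  then show "(a - b) * (a - b) < 1 \<longleftrightarrow> a = b" by fastforce
  then show "1 \<le> (a - b) * (a - b) \<longleftrightarrow> a \<noteq> b" by linarith
qed

definition ind :: "nat \<Rightarrow> state \<Rightarrow> string \<Rightarrow> nat set \<Rightarrow> bool" where
  "ind n s x A \<longleftrightarrow> A \<subseteq> {..<n} \<and> (\<forall>v<n. s x (int v) = (if v \<in> A then 1 else 0))"

definition adj_int :: "nat set set \<Rightarrow> nat \<Rightarrow> nat \<Rightarrow> int" where
  "adj_int E u v = (if {u, v} \<in> E then 1 else 0)"

definition cut_int :: "nat set set \<Rightarrow> nat set \<Rightarrow> nat set \<Rightarrow> int" where
  "cut_int E S A = (\<Sum>u\<in>A. \<Sum>v\<in>S - A. adj_int E u v)"

definition min_side :: "nat set \<Rightarrow> nat set \<Rightarrow> int" where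
  "min_side S A = min (int (card A)) (int (card S) - int (card A))"

text \<open>The pair \<open>be\<close>, \<open>bm\<close> is a fraction, with 1 / 0 for no cut yet;
  in that case the last clause forces the smaller side of every cut in \<C> to be empty.\<close>

definition best :: "nat set set \<Rightarrow> nat set \<Rightarrow> nat set set \<Rightarrow> int \<Rightarrow> int \<Rightarrow> nat set \<Rightarrow> bool" where
  "best E S \<C> be bm C \<longleftrightarrow> C \<subseteq> S \<and>
     (be = 1 \<and> bm = 0 \<and> C = {} \<or> bm > 0 \<and> be = cut_int E S C \<and> bm = min_side S C) \<and>
     (\<forall>A\<in>\<C>. be * min_side S A \<le> cut_int E S A * bm)"

lemma cut_int_nonneg: "cut_int E S A \<ge> 0"
  unfolding cut_int_def by (intro sum_nonneg) (auto simp: adj_int_def)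

lemma min_side_nonneg: "finite S \<Longrightarrow> A \<subseteq> S \<Longrightarrow> min_side S A \<ge> 0"
  using card_mono[of S A] by (simp add: min_side_def)

lemma best_subset: "best E S \<C> be bm C \<Longrightarrow> \<C>' \<subseteq> \<C> \<Longrightarrow> best E S \<C>' be bm C"
  unfolding best_def by blast

lemma best_keep:
  "best E S \<C> be bm C \<Longrightarrow> \<not> be * min_side S A - cut_int E S A * bm > 0 \<Longrightarrow> best E S (insert A \<C>) be bm C"
  unfolding best_def by auto

text \<open>Transitivity of the order of fractions: for bm > 0 the cross-multiplied inequalities are
  chained and bm is cancelled; for bm = 0 all earlier cuts have smaller side 0.\<close>

lemma best_replace:
  assumes S: "finite S" "A \<subseteq> S" and best: "best E S \<C> be bm C"
    and gt: "be * min_side S A - cut_int E S A * bm > 0"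
    and sub: "\<And>A'. A' \<in> \<C> \<Longrightarrow> A' \<subseteq> S"
  shows "best E S (insert A \<C>) (cut_int E S A) (min_side S A) A"
proof -
  have bm: "bm \<ge> 0" and be: "be \<ge> 0" using best cut_int_nonneg by (auto simp: best_def)
  have m0: "min_side S A \<ge> 0" by (rule min_side_nonneg[OF S])
  have "cut_int E S A * bm \<ge> 0" using bm cut_int_nonneg by simp
  then have m: "min_side S A > 0" using gt m0 by (cases "min_side S A = 0") auto
  have "cut_int E S A * min_side S A' \<le> cut_int E S A' * min_side S A" if A': "A' \<in> \<C>" for A'
  proof -
    have old: "be * min_side S A' \<le> cut_int E S A' * bm" using best A' by (simp add: best_def)
    have m': "min_side S A' \<ge> 0" by (rule min_side_nonneg[OF S(1) sub[OF A']])
    show ?thesis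
    proof (cases "bm = 0")
      case True
      then have "be = 1" using best by (auto simp: best_def)
      then have "min_side S A' = 0" using old m' True by simp
      then show ?thesis using cut_int_nonneg m by simp
    next
      case False
      have "bm * (cut_int E S A * min_side S A') = (cut_int E S A * bm) * min_side S A'" by simp
      also have "\<dots> \<le> (be * min_side S A) * min_side S A'" using gt m' by (intro mult_right_mono) auto
      also have "\<dots> = (be * min_side S A') * min_side S A" by simp
      also have "\<dots> \<le> (cut_int E S A' * bm) * min_side S A" using old m by (intro mult_right_mono) auto
      also have "\<dots> = bm * (cut_int E S A' * min_side S A)" by simp
      finally show ?thesis using False bm by simp
    qed
  qed
  then show ?thesis using S m by (auto simp: best_def)
qed

definition step_int :: "nat \<Rightarrow> nat set set \<Rightarrow> nat set \<Rightarrow> (nat \<Rightarrow> int) \<Rightarrow> nat \<Rightarrow> int" where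
  "step_int n E S X u = 2 * int n * X u -
     (\<Sum>v<n. (adj_int E u v * ((if u \<in> S then 1 else 0) * (if v \<in> S then 1 else 0))) * (X u - X v))"

fun power_int :: "nat \<Rightarrow> nat set set \<Rightarrow> nat set \<Rightarrow> nat \<Rightarrow> nat \<Rightarrow> nat \<Rightarrow> int" where
  "power_int n E S i 0 u = (if u = i then 1 else 0)"
| "power_int n E S i (Suc t) u = step_int n E S (power_int n E S i t) u"

text \<open>The shifted matrix has nonnegative entries, since at most \<open>n\<close> is subtracted
  from the diagonal entry 2 n, and its row sums are 2 n; so entries grow by a factor of at most 2 n.
  The bounds are proved for partial sums because the program stores each of them.\<close>

lemma partial_step_bounds:
  fixes X :: "nat \<Rightarrow> int" and c :: "nat \<Rightarrow> int"
  assumes X: "\<And>v. v < n \<Longrightarrow> 0 \<le> X v \<and> X v \<le> L" and c: "\<And>v. v < n \<Longrightarrow> 0 \<le> c v \<and> c v \<le> 1"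
    and j: "j \<le> n" and u: "u < n"
  shows "0 \<le> 2 * int n * X u - (\<Sum>v<j. c v * (X u - X v))"
    and "2 * int n * X u - (\<Sum>v<j. c v * (X u - X v)) \<le> 2 * int n * L"
proof -
  have "(\<Sum>v<j. c v * (X u - X v)) \<le> (\<Sum>v<j. X u)"
  proof (rule sum_mono)
    fix v assume "v \<in> {..<j}"
    then have v: "v < n" using j by simp
    have "c v * (X u - X v) \<le> c v * X u" using X[OF v] c[OF v] by (intro mult_left_mono) auto
    also have "\<dots> \<le> 1 * X u" using c[OF v] X[OF u] by (intro mult_right_mono) auto
    finally show "c v * (X u - X v) \<le> X u" by simp
  qed
  also have "\<dots> \<le> int n * X u" using j X[OF u] by (simp add: mult_right_mono)
  also have "\<dots> \<le> 2 * int n * X u" using X[OF u] by simp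
  finally show "0 \<le> 2 * int n * X u - (\<Sum>v<j. c v * (X u - X v))" by simp
  have "(\<Sum>v<j. c v * (X v - X u)) \<le> (\<Sum>v<j. L - X u)"
  proof (rule sum_mono)
    fix v assume "v \<in> {..<j}"
    then have v: "v < n" using j by simp
    have "c v * (X v - X u) \<le> c v * (L - X u)" using X[OF v] c[OF v] by (intro mult_left_mono) auto
    also have "\<dots> \<le> 1 * (L - X u)" using c[OF v] X[OF u] by (intro mult_right_mono) auto
    finally show "c v * (X v - X u) \<le> L - X u" by simp
  qed
  also have "\<dots> \<le> 2 * int n * (L - X u)" using j X[OF u] by (auto intro: mult_right_mono)
  finally have "(\<Sum>v<j. c v * (X v - X u)) \<le> 2 * int n * L - 2 * int n * X u" by (simp add: algebra_simps)
  moreover have "(\<Sum>v<j. c v * (X v - X u)) = - (\<Sum>v<j. c v * (X u - X v))"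
    by (simp add: sum_negf[symmetric] algebra_simps)
  ultimately show "2 * int n * X u - (\<Sum>v<j. c v * (X u - X v)) \<le> 2 * int n * L" by simp
qed

lemma power_int_bounds:
  "u < n \<Longrightarrow> 0 \<le> power_int n E S i t u \<and> power_int n E S i t u \<le> (2 * int n) ^ t"
proof (induction t arbitrary: u)
  case (Suc t)
  show ?case
    using partial_step_bounds[of n "power_int n E S i t" "(2 * int n) ^ t"
        "\<lambda>v. adj_int E u v * ((if u \<in> S then 1 else 0) * (if v \<in> S then 1 else 0))" n u] Suc
    by (auto simp: step_int_def adj_int_def)
qed simp

definition threshold_cut :: "nat \<Rightarrow> nat set set \<Rightarrow> nat set \<Rightarrow> nat \<Rightarrow> nat \<Rightarrow> nat \<Rightarrow> nat set" where
  "threshold_cut n E S i t w = {u \<in> S. power_int n E S i t u > power_int n E S i t w}"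

definition threshold_cuts :: "nat \<Rightarrow> nat set set \<Rightarrow> nat set \<Rightarrow> nat set set" where
  "threshold_cuts n E S = {threshold_cut n E S i t w | i t w. i < n \<and> t < 8 * n ^ 5 \<and> w < n}"

text \<open>\<open>M\<close> bounds the iterations of every loop, \<open>B\<close> the bit length of
  every stored number: loop counters, edge counts up to n^2, and the iterates, whose bound (2 n)^(8
  n^5) still has only polynomially many bits.\<close>

locale ram_run =
  fixes n :: nat and E :: "nat set set" and num den :: int and M B :: nat
  assumes B1: "B \<ge> 1" and nM: "n \<le> M" and kM: "8 * n ^ 5 \<le> M"
    and kB: "8 * int n ^ 5 \<le> 2 ^ B" and nB: "int n * int n + 2 \<le> 2 ^ B"
    and powB: "(2 * int n) ^ (8 * n ^ 5) \<le> 2 ^ B"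
begin

definition is_input :: "(int \<Rightarrow> int) \<Rightarrow> bool" where
  "is_input f \<longleftrightarrow> f 0 = int n \<and> f 1 = num \<and> f 2 = den \<and>
     (\<forall>u<n. \<forall>v<n. f (3 + (int u * int n + int v)) = adj_int E u v)"

lemmas seq = wp_Seq[OF B1] and ifI = wp_If[OF B1] and store = wp_Store[OF B1]
  and skip = wp_Skip[OF B1] and mono = wp_mono[OF B1]

lemma nB': "int n + 2 \<le> 2 ^ B" "1 \<le> (2::int) ^ B" "2 \<le> (2::int) ^ B"
proof -
  have "int n \<le> int n * int n" by (cases n) auto
  then show "int n + 2 \<le> 2 ^ B" using nB by linarith
  then show "2 \<le> (2::int) ^ B" "1 \<le> (2::int) ^ B" by linarith+
qed

lemma for_n:
  assumes inp: "is_input (s ''in'')" and i: "i \<notin> writes c" "i \<noteq> ''in''" "''in'' \<notin> writes c"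
    and init: "I 0 (s(i := (s i)(0 := 0)))"
    and step: "\<And>j s'. j < n \<Longrightarrow> I j s' \<Longrightarrow> s' i 0 = int j \<Longrightarrow> same_outside (insert i (writes c)) s s' \<Longrightarrow>
      is_input (s' ''in'') \<Longrightarrow> wp M B c (\<lambda>s''. I (Suc j) (s''(i := (s'' i)(0 := int (Suc j))))) s'"
    and exit: "\<And>s'. I n s' \<Longrightarrow> same_outside (insert i (writes c)) s s' \<Longrightarrow> Q s'"
  shows "wp M B (For i nE c) Q s"
proof (rule wp_For[OF B1 i(1) nM, where I = I])
  show "int n \<le> 2 ^ B" using nB' by linarith
  show "aval nE s' = int n" if "same_outside (insert i (writes c)) s s'" for s'
    using same_outsideD[OF that, of "''in''"] i inp by (simp add: is_input_def)
  show "wp M B c (\<lambda>s''. I (Suc j) (s''(i := (s'' i)(0 := int (Suc j))))) s'"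
    if "j < n" "I j s'" "s' i 0 = int j" "same_outside (insert i (writes c)) s s'" for j s'
    using step[OF that] same_outsideD[OF that(4), of "''in''"] i inp by simp
qed (use init exit in auto)

section \<open>Correctness of the commands of a round\<close>

lemma wp_pick:
  assumes inp: "is_input (s ''in'')"
  shows "wp M B pick_com (\<lambda>s'.
     (s' ''q'' 0 = -1 \<and> (\<forall>u<n. \<forall>v<n. s ''lab'' (int u) = s ''lab'' (int v) \<longrightarrow> u = v)) \<or>
     (\<exists>u<n. \<exists>v<n. u \<noteq> v \<and> s ''lab'' (int u) = s ''lab'' (int v) \<and> s' ''q'' 0 = s ''lab'' (int v))) s"
    (is "wp M B pick_com ?Q s")
proof -
  define F where "F x \<longleftrightarrow> (\<exists>u<n. \<exists>v<n. u \<noteq> v \<and> s ''lab'' (int u) = s ''lab'' (int v) \<and> x = s ''lab'' (int v))" for x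
  have F: "F (s ''lab'' (int j))" if "k < n" "j < n" "j < k" "s ''lab'' (int k) = s ''lab'' (int j)" for j k
    unfolding F_def using that by (intro exI[of _ k] conjI exI[of _ j]) auto
  let ?found = "\<lambda>s'. F (s' ''q'' 0)"
  \<comment> \<open>Pairs are organized by their smaller vertex, the outer counter; the inner loop
    runs through the candidates for the larger one.\<close>
  let ?none = "\<lambda>j s'. s' ''q'' 0 = (-1::int) \<and> (\<forall>v<j. \<forall>u<n. v < u \<longrightarrow> s ''lab'' (int u) \<noteq> s ''lab'' (int v))"
  let ?s0 = "s(''q'' := (s ''q'')(aval (Const 0) s := aval (Const (-1)) s))"
  show ?thesis unfolding pick_com_def
  proof (rule seq, rule store)
    show "\<bar>aval (Const (-1)) s\<bar> \<le> 2 ^ B" using nB' by simp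
    show "wp M B (For ''v'' nE (For ''u'' nE
     (If (Op Sub (V ''u'') (V ''v''))
       (If (eqE (Cell ''lab'' (V ''u'')) (Cell ''lab'' (V ''v''))) (Assign ''q'' (Cell ''lab'' (V ''v''))) Skip)
       Skip))) ?Q ?s0"
    proof (rule for_n[where I = "\<lambda>j s'. ?none j s' \<or> ?found s'"])
      fix j s1
      assume j: "j < n" and I: "?none j s1 \<or> ?found s1" and v: "s1 ''v'' 0 = int j"
        and f1: "same_outside (insert ''v'' (writes (For ''u'' nE
           (If (Op Sub (V ''u'') (V ''v''))
           (If (eqE (Cell ''lab'' (V ''u'')) (Cell ''lab'' (V ''v''))) (Assign ''q'' (Cell ''lab'' (V ''v''))) Skip)
           Skip)))) ?s0 s1"
        and inp1: "is_input (s1 ''in'')"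
      have l1: "s1 ''lab'' = s ''lab''" using f1 by (simp add: same_outside_def)
      show "wp M B (For ''u'' nE (If (Op Sub (V ''u'') (V ''v''))
           (If (eqE (Cell ''lab'' (V ''u'')) (Cell ''lab'' (V ''v''))) (Assign ''q'' (Cell ''lab'' (V ''v''))) Skip)
           Skip)) (\<lambda>s''. (\<lambda>s'. ?none (Suc j) s' \<or> ?found s') (s''(''v'' := (s'' ''v'')(0 := int (Suc j))))) s1"
      proof (rule for_n[where I = "\<lambda>k s'. ?none j s' \<and> (\<forall>u<k. j < u \<longrightarrow> s ''lab'' (int u) \<noteq> s ''lab'' (int j)) \<or> ?found s'"], goal_cases)
        case (6 k s2)
        have l2: "s2 ''lab'' = s ''lab''" "s2 ''v'' 0 = int j"
          using 6(4) l1 v by (simp_all add: same_outside_def)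
        have bd: "\<bar>s2 ''lab'' (int j)\<bar> \<le> 2 ^ B" if "bounded B s2" using that by (simp add: bounded_def)
        show ?case
          by (intro ifI store skip)
            (use 6 j l2 bd F in \<open>auto simp: square_diff_less_one less_Suc_eq\<close>)
      next
        case (7 s2)
        then show ?case by (auto simp: less_Suc_eq)
      qed (use I inp1 in auto)
    next
      fix s1 :: state assume "?none n s1 \<or> ?found s1"
      then show "?Q s1" unfolding F_def by (metis nat_neq_iff)
    qed (use inp in auto)
  qed
qed

lemma wp_collect:
  assumes inp: "is_input (s ''in'')"
  defines "S \<equiv> {v. v < n \<and> s ''lab'' (int v) = s ''q'' 0}"
  shows "wp M B collect_com (\<lambda>s'. ind n s' ''S'' S \<and> ind n s' ''C'' {} \<and> s' ''m'' 0 = int (card S)) s"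
    (is "wp M B collect_com ?Q s")
proof -
  let ?S = "\<lambda>j. {v. v < j \<and> s ''lab'' (int v) = s ''q'' 0}"
  have card: "card (?S (Suc j)) = card (?S j) + (if s ''lab'' (int j) = s ''q'' 0 then 1 else 0)" for j
  proof -
    have "?S (Suc j) = (if s ''lab'' (int j) = s ''q'' 0 then insert j (?S j) else ?S j)"
      by (auto simp: less_Suc_eq)
    then show ?thesis by simp
  qed
  have le: "card (?S j) \<le> j" for j using card_mono[of "{..<j}" "?S j"] by auto
  show ?thesis unfolding collect_com_def
  proof (rule seq, rule store, goal_cases)
    case 2
    show ?case
    proof (rule for_n[where I = "\<lambda>j s'. (\<forall>v<j. s' ''S'' (int v) = (if v \<in> S then 1 else 0)) \<and>
        (\<forall>v<j. s' ''C'' (int v) = 0) \<and> s' ''m'' 0 = int (card (?S j))"], goal_cases)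
      case (6 j s1)
      have l1: "s1 ''lab'' = s ''lab''" "s1 ''q'' = s ''q''" using 6(4) by (simp_all add: same_outside_def)
      have "int (card (?S j)) + 1 \<le> 2 ^ B" using le[of j] 6(1) nB' by linarith
      then show ?case
        by (intro seq ifI store skip)
          (use 6 l1 nB' card[of j] in \<open>auto simp: square_diff_less_one less_Suc_eq S_def\<close>)
    next
      case (7 s1)
      then show ?case by (auto simp: ind_def S_def)
    qed (use inp in auto)
  qed simp
qed

lemma wp_threshold:
  assumes inp: "is_input (s ''in'')" and S: "ind n s ''S'' S" and w: "s ''w'' 0 = int w" "w < n"
  defines "A \<equiv> {u \<in> S. s ''x'' (int u) > s ''x'' (int w)}"
  shows "wp M B threshold_com (\<lambda>s'. ind n s' ''B'' A \<and> s' ''sz'' 0 = int (card A)) s"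
proof -
  let ?A = "\<lambda>j. {u \<in> A. u < j}"
  have An: "A \<subseteq> {..<n}" using S by (auto simp: A_def ind_def)
  have card: "card (?A (Suc j)) = card (?A j) + (if j \<in> A then 1 else 0)" for j
  proof -
    have "?A (Suc j) = (if j \<in> A then insert j (?A j) else ?A j)" by (auto simp: less_Suc_eq)
    then show ?thesis by simp
  qed
  have le: "card (?A j) \<le> j" for j using card_mono[of "{..<j}" "?A j"] by auto
  have An': "?A n = A" using An by auto
  show ?thesis unfolding threshold_com_def
  proof (rule seq, rule store, goal_cases)
    case 2
    show ?case
    proof (rule for_n[where I = "\<lambda>j s'. (\<forall>u<j. s' ''B'' (int u) = (if u \<in> A then 1 else 0)) \<and>
        s' ''sz'' 0 = int (card (?A j))"], goal_cases)
      case (6 j s1)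
      have l1: "s1 ''S'' = s ''S''" "s1 ''x'' = s ''x''" "s1 ''w'' 0 = int w"
        using 6(4) w by (simp_all add: same_outside_def)
      have jA: "j \<in> A \<longleftrightarrow> s ''S'' (int j) * (s ''x'' (int j) - s ''x'' (int w)) > 0"
        using S 6(1) by (auto simp: A_def ind_def)
      have "int (card (?A j)) + 1 \<le> 2 ^ B" using le[of j] 6(1) nB' by linarith
      then show ?case
        by (intro seq ifI store skip)
          (use 6 l1 nB' card[of j] jA in \<open>auto simp: less_Suc_eq\<close>)
    next
      case (7 s1)
      then show ?case using An An' by (auto simp: ind_def)
    qed (use inp in auto)
  qed simp
qed

lemma wp_count:
  assumes inp: "is_input (s ''in'')" and S: "ind n s ''S'' S" and A: "ind n s ''B'' A" "A \<subseteq> S"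
  shows "wp M B count_com (\<lambda>s'. s' ''e'' 0 = cut_int E S A) s"
proof -
  define g where "g u v = adj_int E u v * ((if u \<in> A then 1 else 0) * ((if v \<in> S then 1 else 0) - (if v \<in> A then 1 else 0)))" for u v
  have g: "0 \<le> g u v \<and> g u v \<le> 1" for u v using A(2) by (auto simp: g_def adj_int_def)
  \<comment> \<open>At every stage of the double loop the counter is at most n^2, hence within the
    word size.\<close>
  have sums: "0 \<le> (\<Sum>u<j. \<Sum>v<n. g u v) + (\<Sum>v<k. g j v) \<and> (\<Sum>u<j. \<Sum>v<n. g u v) + (\<Sum>v<k. g j v) + 1 \<le> 2 ^ B"
    if "j < n" "k \<le> n" for j k
  proof -
    have b: "(\<Sum>v<k. g u v) \<le> int k" for u k using sum_bounded_above[of "{..<k}" "g u" 1] g by simp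
    have "(\<Sum>u<j. \<Sum>v<n. g u v) \<le> int j * int n"
      using sum_bounded_above[of "{..<j}" "\<lambda>u. \<Sum>v<n. g u v" "int n"] b by simp
    moreover have "(\<Sum>v<k. g j v) \<le> int n" using b[of j k] that by linarith
    moreover have "int j * int n + int n \<le> int n * int n"
    proof -
      have "int j * int n + int n = (int j + 1) * int n" by (simp add: algebra_simps)
      also have "\<dots> \<le> int n * int n" using that by (intro mult_right_mono) auto
      finally show ?thesis .
    qed
    moreover have "0 \<le> (\<Sum>u<j. \<Sum>v<n. g u v)" "0 \<le> (\<Sum>v<k. g j v)"
      using g by (auto intro!: sum_nonneg)
    ultimately show ?thesis using nB by linarith
  qed
  have final: "(\<Sum>u<n. \<Sum>v<n. g u v) = cut_int E S A"
  proof -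
    have "(\<Sum>v<n. g u v) = (if u \<in> A then \<Sum>v\<in>S - A. adj_int E u v else 0)" for u
    proof -
      have "(\<Sum>v<n. g u v) = (\<Sum>v<n. if v \<in> S - A then (if u \<in> A then adj_int E u v else 0) else 0)"
        using A(2) by (intro sum.cong) (auto simp: g_def)
      also have "\<dots> = (\<Sum>v\<in>{..<n} \<inter> (S - A). if u \<in> A then adj_int E u v else 0)"
        by (rule sum.inter_restrict[symmetric]) simp
      also have "{..<n} \<inter> (S - A) = S - A" using S by (auto simp: ind_def)
      finally show ?thesis by simp
    qed
    then have "(\<Sum>u<n. \<Sum>v<n. g u v) = (\<Sum>u<n. if u \<in> A then \<Sum>v\<in>S - A. adj_int E u v else 0)" by simp
    also have "\<dots> = (\<Sum>u\<in>{..<n} \<inter> A. \<Sum>v\<in>S - A. adj_int E u v)"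
      by (rule sum.inter_restrict[symmetric]) simp
    also have "{..<n} \<inter> A = A" using A by (auto simp: ind_def)
    finally show ?thesis by (simp add: cut_int_def)
  qed
  show ?thesis unfolding count_com_def
  proof (rule seq, rule store, goal_cases)
    case 2
    show ?case
    proof (rule for_n[where I = "\<lambda>j s'. s' ''e'' 0 = (\<Sum>u<j. \<Sum>v<n. g u v)"], goal_cases)
      case (6 j s1)
      note o6 = 6
      show ?case
      proof (rule for_n[where I = "\<lambda>k s'. s' ''e'' 0 = (\<Sum>u<j. \<Sum>v<n. g u v) + (\<Sum>v<k. g j v)"], goal_cases)
        case (6 k s2)
        have l2: "s2 ''S'' = s ''S''" "s2 ''B'' = s ''B''" "s2 ''u'' 0 = int j"
          using 6(4) o6(3,4) by (simp_all add: same_outside_def)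
        have "s2 ''in'' (3 + (int j * s2 ''in'' 0 + int k)) * (s2 ''B'' (int j) * (s2 ''S'' (int k) - s2 ''B'' (int k))) = g j k"
          using 6(1,5) o6(1) l2 S A by (simp add: is_input_def ind_def g_def)
        then have val: "aval (Op Add (V ''e'') (Op Mul (adjE (V ''u'') (V ''v''))
       (Op Mul (Cell ''B'' (V ''u'')) (Op Sub (Cell ''S'' (V ''v'')) (Cell ''B'' (V ''v'')))))) s2 =
          (\<Sum>u<j. \<Sum>v<n. g u v) + (\<Sum>v<Suc k. g j v)"
          using 6(2,3) l2 by simp
        show ?case
        proof (rule store, unfold val)
          show "\<bar>(\<Sum>u<j. \<Sum>v<n. g u v) + (\<Sum>v<Suc k. g j v)\<bar> \<le> 2 ^ B"
            using sums[OF o6(1), of "Suc k"] 6(1) by linarith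
        qed simp
      next
        case (7 s2)
        then show ?case by simp
      qed (use o6 in auto)
    next
      case (7 s1)
      then show ?case using final by simp
    qed (use inp in auto)
  qed simp
qed

end

lemma ind_upd [simp]: "x \<noteq> y \<Longrightarrow> ind n (s(x := f)) y A = ind n s y A"
  by (simp add: ind_def)

definition best_state :: "nat \<Rightarrow> nat set set \<Rightarrow> nat set \<Rightarrow> nat set set \<Rightarrow> state \<Rightarrow> bool" where
  "best_state n E S \<C> s \<longleftrightarrow> (\<exists>C. ind n s ''C'' C \<and> best E S \<C> (s ''be'' 0) (s ''bm'' 0) C)"

lemma best_state_upd [simp]:
  "x \<noteq> ''C'' \<Longrightarrow> x \<noteq> ''be'' \<Longrightarrow> x \<noteq> ''bm'' \<Longrightarrow> best_state n E S \<C> (s(x := f)) = best_state n E S \<C> s"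
  by (simp add: best_state_def)

lemma best_state_subset: "best_state n E S \<C> s \<Longrightarrow> \<C>' \<subseteq> \<C> \<Longrightarrow> best_state n E S \<C>' s"
  unfolding best_state_def using best_subset by blast

lemma best_state_cong:
  "s' ''C'' = s ''C'' \<Longrightarrow> s' ''be'' = s ''be'' \<Longrightarrow> s' ''bm'' = s ''bm'' \<Longrightarrow> best_state n E S \<C> s' = best_state n E S \<C> s"
  by (simp add: best_state_def ind_def)

lemma ind_cong: "s' x = s x \<Longrightarrow> ind n s' x A = ind n s x A"
  by (simp add: ind_def)

lemma boundedD: "bounded B s \<Longrightarrow> \<bar>aval (Cell x a) s\<bar> \<le> 2 ^ B"
  by (simp add: bounded_def)

context ram_run
begin

lemma wp_copy:
  assumes "is_input (s ''in'')" "distinct [i, x, y, ''in'']" and A: "ind n s y A"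
  shows "wp M B (For i nE (Store x (V i) (Cell y (V i)))) (\<lambda>s'. ind n s' x A) s"
proof (rule for_n[where I = "\<lambda>j s'. \<forall>u<j. s' x (int u) = (if u \<in> A then 1 else 0)"], goal_cases)
  case (6 j s1)
  have "s1 y = s y" using 6(4) assms(2) by (auto simp: same_outside_def)
  then have y: "s1 y (int j) = (if j \<in> A then 1 else 0)" using A 6(1) by (simp add: ind_def)
  show ?case
    by (rule store) (use 6 y assms(2) nB' in \<open>auto simp: less_Suc_eq\<close>)
next
  case (7 s1)
  then show ?case using A by (auto simp: ind_def)
qed (use assms in auto)

lemma wp_improve:
  assumes inp: "is_input (s ''in'')" and A: "ind n s ''B'' A" "A \<subseteq> S" "S \<subseteq> {..<n}"
    and sz: "s ''sz'' 0 = int (card A)" and m: "s ''m'' 0 = int (card S)" and e: "s ''e'' 0 = cut_int E S A"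
    and best: "best_state n E S \<C> s" and sub: "\<And>A'. A' \<in> \<C> \<Longrightarrow> A' \<subseteq> S"
  shows "wp M B improve_com (best_state n E S (insert A \<C>)) s"
proof -
  have fin: "finite S" using A(3) finite_subset by blast
  have cA: "card A \<le> card S" "card S \<le> n" using card_mono[OF fin A(2)] card_mono[OF _ A(3)] by auto
  have cB: "int (card A) \<le> 2 ^ B" "int (card S) - int (card A) \<le> 2 ^ B" using cA nB' by linarith+
  show ?thesis unfolding improve_com_def
  proof (rule seq, rule mono[where Q = "\<lambda>s'. s' ''mn'' 0 = min_side S A"], goal_cases)
    case 1
    show ?case by (intro ifI store) (use sz m cB cA in \<open>auto simp: min_side_def\<close>)
  next
    case (2 s1)
    have l1: "s1 ''in'' = s ''in''" "s1 ''e'' = s ''e''" "s1 ''be'' = s ''be''" "s1 ''bm'' = s ''bm''"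
      "s1 ''C'' = s ''C''" "s1 ''B'' = s ''B''" using 2(2) by (simp_all add: same_outside_def)
    have b1: "best_state n E S \<C> s1" using best best_state_cong[of s1 s] l1 by simp
    then obtain C where C: "ind n s1 ''C'' C" "best E S \<C> (s1 ''be'' 0) (s1 ''bm'' 0) C"
      by (auto simp: best_state_def)
    have val: "aval (Op Sub (Op Mul (V ''be'') (V ''mn'')) (Op Mul (V ''e'') (V ''bm''))) s1 =
        s1 ''be'' 0 * min_side S A - cut_int E S A * s1 ''bm'' 0"
      using 2(1) e l1 by simp
    show ?case
    proof (rule ifI)
      assume gt: "0 < aval (Op Sub (Op Mul (V ''be'') (V ''mn'')) (Op Mul (V ''e'') (V ''bm''))) s1"
      have new: "best E S (insert A \<C>) (cut_int E S A) (min_side S A) A"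
        using best_replace[OF fin A(2) C(2) _ sub] gt unfolding val by blast
      show "wp M B (Seq (Assign ''be'' (V ''e'')) (Seq (Assign ''bm'' (V ''mn''))
         (For ''u'' nE (Store ''C'' (V ''u'') (Cell ''B'' (V ''u'')))))) (best_state n E S (insert A \<C>)) s1"
      proof (rule seq, rule store, goal_cases)
        case 2
        show ?case
        proof (rule seq, rule store, goal_cases)
          case 2
          show ?case
          proof (rule mono[OF wp_copy[where A = A]], goal_cases)
            case (4 s2)
            then show ?case
              using new e l1 \<open>s1 ''mn'' 0 = min_side S A\<close>
              by (auto simp: best_state_def same_outside_def)
          qed (use inp A l1 in \<open>auto simp: ind_cong[of s1 "''B''" s]\<close>)
        qed (erule boundedD)
      qed (erule boundedD)
    next
      assume "\<not> 0 < aval (Op Sub (Op Mul (V ''be'') (V ''mn'')) (Op Mul (V ''e'') (V ''bm''))) s1"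
      then have "best E S (insert A \<C>) (s1 ''be'' 0) (s1 ''bm'' 0) C"
        unfolding val by (rule best_keep[OF C(2)])
      then show "wp M B Skip (best_state n E S (insert A \<C>)) s1"
        using C(1) by (intro skip) (auto simp: best_state_def)
    qed
  qed
qed

lemma wp_sweep:
  assumes inp: "is_input (s ''in'')" and S: "ind n s ''S'' S" and w: "s ''w'' 0 = int w" "w < n"
    and m: "s ''m'' 0 = int (card S)"
    and best: "best_state n E S \<C> s" and sub: "\<And>A'. A' \<in> \<C> \<Longrightarrow> A' \<subseteq> S"
  shows "wp M B sweep_com (best_state n E S (insert {u \<in> S. s ''x'' (int u) > s ''x'' (int w)} \<C>)) s"
proof -
  let ?A = "{u \<in> S. s ''x'' (int u) > s ''x'' (int w)}"
  show ?thesis unfolding sweep_com_def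
  proof (rule seq, rule mono[OF wp_threshold[where s = s, OF inp S w]])
    fix s1 assume A: "ind n s1 ''B'' ?A \<and> s1 ''sz'' 0 = int (card ?A)" and f: "same_outside (writes threshold_com) s s1"
    have l1: "s1 ''in'' = s ''in''" "s1 ''S'' = s ''S''" "s1 ''be'' = s ''be''" "s1 ''bm'' = s ''bm''"
      "s1 ''C'' = s ''C''" "s1 ''m'' = s ''m''" using f by (simp_all add: same_outside_def)
    show "wp M B (Seq count_com improve_com) (best_state n E S (insert ?A \<C>)) s1"
    proof (rule seq, rule mono[OF wp_count[where S = S and A = ?A]], goal_cases)
      case (5 s2)
      have l2: "s2 ''in'' = s ''in''" "s2 ''S'' = s ''S''" "s2 ''be'' = s ''be''" "s2 ''bm'' = s ''bm''"
        "s2 ''C'' = s ''C''" "s2 ''m'' = s ''m''" "s2 ''B'' = s1 ''B''" "s2 ''sz'' = s1 ''sz''"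
        using 5(2) l1 by (simp_all add: same_outside_def)
      show ?case
      proof (rule wp_improve, goal_cases)
        case 2
        then show ?case using A l2 by (simp add: ind_cong[of s2 "''B''" s1])
      next
        case 4
        then show ?case using S by (simp add: ind_def)
      next
        case 7
        show ?case by (rule 5(1))
      next
        case 8
        then show ?case using best best_state_cong[of s2 s] l2 by simp
      qed (use inp l2 A m sub in auto)
    qed (use inp l1 S A in \<open>auto simp: ind_cong[of s1 "''S''" s]\<close>)
  qed
qed

lemma wp_step:
  assumes inp: "is_input (s ''in'')" and S: "ind n s ''S'' S"
    and x: "\<And>u. u < n \<Longrightarrow> s ''x'' (int u) = X u" and X: "\<And>u. u < n \<Longrightarrow> 0 \<le> X u \<and> X u \<le> L"
    and L: "2 * int n * L \<le> 2 ^ B"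
  shows "wp M B step_com (\<lambda>s'. \<forall>u<n. s' ''x'' (int u) = step_int n E S X u) s"
proof -
  define c where "c u v = adj_int E u v * ((if u \<in> S then 1 else 0) * (if v \<in> S then 1 else 0))" for u v
  have c: "0 \<le> c u v \<and> c u v \<le> 1" for u v by (auto simp: c_def adj_int_def)
  \<comment> \<open>\<open>p u k\<close> is the content of cell \<open>u\<close> of bank
    \<open>y\<close> after \<open>k\<close> passes of the inner loop.\<close>
  define p where "p u k = 2 * int n * X u - (\<Sum>v<k. c u v * (X u - X v))" for u k
  have p: "\<bar>p u k\<bar> \<le> 2 ^ B" if "u < n" "k \<le> n" for u k
    using partial_step_bounds[of n X L "c u" k u] X c that L by (fastforce simp: p_def)
  have p0: "p u 0 = 2 * int n * X u" and pS: "p u (Suc k) = p u k - c u k * (X u - X k)" for u k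
    by (simp_all add: p_def)
  have pn: "p u n = step_int n E S X u" for u by (simp add: p_def step_int_def c_def)
  show ?thesis unfolding step_com_def
  proof (rule seq, rule mono[OF for_n[where I = "\<lambda>j s'. \<forall>u<j. s' ''y'' (int u) = p u n"
        and Q = "\<lambda>s'. \<forall>u<n. s' ''y'' (int u) = p u n"]], goal_cases)
    case (6 j s1)
    note o = 6
    have l1: "s1 ''in'' = s ''in''" "s1 ''S'' = s ''S''" "s1 ''x'' = s ''x''" using 6(4) by (simp_all add: same_outside_def)
    have n: "s ''in'' 0 = int n" using inp by (simp add: is_input_def)
    have val: "aval (Op Mul (Op Mul (Const 2) nE) (Cell ''x'' (V ''u''))) s1 = p j 0"
      using o(1,3) l1 x n by (simp add: p0)
    show ?case
    proof (rule seq, rule store, unfold val, goal_cases)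
      case 1
      show ?case using p[of j 0] o(1) by simp
    next
      case 2
      show ?case
      proof (rule for_n[where I = "\<lambda>k s'. (\<forall>u<j. s' ''y'' (int u) = p u n) \<and> s' ''y'' (int j) = p j k"], goal_cases)
        case (6 k s2)
        have l2: "s2 ''in'' = s ''in''" "s2 ''S'' = s ''S''" "s2 ''x'' = s ''x''" "s2 ''u'' 0 = int j"
          using 6(4) l1 o(3) by (simp_all add: same_outside_def)
        have adj: "s ''in'' (3 + (int j * int n + int k)) = adj_int E j k"
          using inp 6(1) o(1) by (simp add: is_input_def)
        have val2: "aval (Op Sub (Cell ''y'' (V ''u''))
         (Op Mul (Op Mul (adjE (V ''u'') (V ''v'')) (Op Mul (Cell ''S'' (V ''u'')) (Cell ''S'' (V ''v''))))
           (Op Sub (Cell ''x'' (V ''u'')) (Cell ''x'' (V ''v''))))) s2 = p j (Suc k)"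
          using 6(1-3) o(1) l2 x S adj n by (simp add: pS c_def ind_def)
        show ?case
        proof (rule store, unfold val2)
          show "\<bar>p j (Suc k)\<bar> \<le> 2 ^ B" using p[of j "Suc k"] 6(1) o(1) by simp
        qed (use 6(2) l2 in \<open>auto\<close>)
      next
        case (7 s2)
        then show ?case by (auto simp: less_Suc_eq)
      qed (use o in auto)
    qed
  next
    case (8 s1)
    have l1: "s1 ''in'' = s ''in''" using 8(2) by (simp add: same_outside_def)
    show ?case
    proof (rule for_n[where I = "\<lambda>j s'. \<forall>u<j. s' ''x'' (int u) = step_int n E S X u"], goal_cases)
      case (6 j s2)
      have l2: "s2 ''y'' = s1 ''y''" using 6(4) by (simp add: same_outside_def)
      show ?case by (rule store, erule boundedD) (use 6 l2 8(1) pn in \<open>auto simp: less_Suc_eq\<close>)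
    qed (use inp l1 in auto)
  qed (use inp in auto)
qed

lemma wp_power:
  assumes inp: "is_input (s ''in'')" and S: "ind n s ''S'' S"
    and m: "s ''m'' 0 = int (card S)" and best: "best_state n E S {} s"
  shows "wp M B power_com (best_state n E S (threshold_cuts n E S)) s"
proof -
  let ?K = "8 * n ^ 5"
  let ?cut = "threshold_cut n E S"
  \<comment> \<open>The cuts examined when the counters of the three nested loops have reached given
    values; \<open>c1\<close> to \<open>c4\<close> pass from a finished inner loop to the next value
    of the outer counter.\<close>
  define \<C>i where "\<C>i i = {?cut i' t w | i' t w. i' < i \<and> t < ?K \<and> w < n}" for i
  define \<C>t where "\<C>t i t = \<C>i i \<union> {?cut i t' w | t' w. t' < t \<and> w < n}" for i t
  define \<C>w where "\<C>w i t w = \<C>t i t \<union> {?cut i t w' | w'. w' < w}" for i t w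
  have sub: "A \<subseteq> S" if "A \<in> \<C>w i t w" for A i t w
    using that by (auto simp: \<C>w_def \<C>t_def \<C>i_def threshold_cut_def)
  have c1: "\<C>w i t (Suc w) \<subseteq> insert (?cut i t w) (\<C>w i t w)" for i t w
    by (auto simp: \<C>w_def less_Suc_eq)
  have c2: "\<C>t i (Suc t) \<subseteq> \<C>w i t n" for i t by (auto simp: \<C>w_def \<C>t_def less_Suc_eq)
  have c3: "\<C>i (Suc i) \<subseteq> \<C>t i ?K" for i by (auto simp: \<C>t_def \<C>i_def less_Suc_eq)
  have c4: "threshold_cuts n E S \<subseteq> \<C>i n" by (auto simp: threshold_cuts_def \<C>i_def)
  show ?thesis unfolding power_com_def
  proof (rule for_n[where I = "\<lambda>i. best_state n E S (\<C>i i)"], goal_cases)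
    case 5
    show ?case using best by (simp add: \<C>i_def)
  next
    case (6 i s1)
    note oi = 6
    have l1: "s1 ''in'' = s ''in''" "s1 ''S'' = s ''S''" "s1 ''m'' = s ''m''"
      using 6(4) by (simp_all add: same_outside_def)
    show ?case
    proof (rule seq, rule mono[OF for_n[where I = "\<lambda>j s'. \<forall>u<j. s' ''x'' (int u) = 0"
          and Q = "\<lambda>s'. \<forall>u<n. s' ''x'' (int u) = 0"]], goal_cases)
      case (6 j s2)
      show ?case by (rule store) (use 6 in \<open>auto simp: less_Suc_eq\<close>)
    next
      case (8 s2)
      have l2: "s2 ''in'' = s ''in''" "s2 ''S'' = s ''S''" "s2 ''m'' = s ''m''" "s2 ''i'' 0 = int i"
        "s2 ''C'' = s1 ''C''" "s2 ''be'' = s1 ''be''" "s2 ''bm'' = s1 ''bm''"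
        using 8(2) l1 oi(3) by (simp_all add: same_outside_def)
      have b2: "best_state n E S (\<C>i i) s2" using oi(2) best_state_cong[of s2 s1] l2 by simp
      show ?case
      proof (rule seq, rule store, goal_cases)
        case 2
        let ?s3 = "s2(''x'' := (s2 ''x'')(aval (V ''i'') s2 := aval (Const 1) s2))"
        show ?case
        proof (rule wp_For[OF B1, where n = ?K and I = "\<lambda>t s'. (\<forall>u<n. s' ''x'' (int u) = power_int n E S i t u)
              \<and> best_state n E S (\<C>t i t) s'"], goal_cases)
          case (4 s')
          then have "s' ''in'' = s ''in''" using l2 by (simp add: same_outside_def)
          then show ?case using inp by (simp add: kE_def is_input_def power_def numeral_eq_Suc)
        next
          case 5
          show ?case using 8(1) l2 b2 by (simp add: \<C>t_def)
        next
          case (6 t s4)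
          note ot = 6
          have l4: "s4 ''in'' = s ''in''" "s4 ''S'' = s ''S''" "s4 ''m'' = s ''m''"
            using 6(4) l2 by (simp_all add: same_outside_def)
          show ?case
          proof (rule seq, rule mono[OF for_n[where I = "\<lambda>w. best_state n E S (\<C>w i t w)"
                and Q = "best_state n E S (\<C>w i t n)"]], goal_cases)
            case 5
            show ?case using ot(2) by (simp add: \<C>w_def)
          next
            case (6 w s5)
            have l5: "s5 ''S'' = s ''S''" "s5 ''m'' = s ''m''" "s5 ''x'' = s4 ''x''"
              using 6(4) l4 by (simp_all add: same_outside_def)
            have "{u \<in> S. s5 ''x'' (int u) > s5 ''x'' (int w)} = ?cut i t w"
              using ot(2) l5 6(1) S by (auto simp: threshold_cut_def ind_def)
            then have "wp M B sweep_com (best_state n E S (insert (?cut i t w) (\<C>w i t w))) s5"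
              using wp_sweep[where s = s5 and S = S and w = w, OF 6(5) _ 6(3) 6(1) _ 6(2) sub] S m l5 ind_cong[of s5 "''S''" s] by simp
            then show ?case by (rule mono) (use best_state_subset[OF _ c1] in auto)
          next
            case (8 s5)
            have l5: "s5 ''in'' = s ''in''" "s5 ''S'' = s ''S''" "s5 ''x'' = s4 ''x''"
              using 8(2) l4 by (simp_all add: same_outside_def)
            show ?case
            proof (rule mono[OF wp_step[where X = "power_int n E S i t" and L = "(2 * int n) ^ t" and S = S]], goal_cases)
              case 5
              show ?case
              proof (cases "n = 0")
                case True
                then show ?thesis by simp
              next
                case False
                have "2 * int n * (2 * int n) ^ t = (2 * int n) ^ Suc t" by simp
                also have "\<dots> \<le> (2 * int n) ^ ?K" using ot(1) False by (intro power_increasing) auto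
                finally show ?thesis using powB by simp
              qed
            next
              case (6 s6)
              have "s6 ''C'' = s5 ''C''" "s6 ''be'' = s5 ''be''" "s6 ''bm'' = s5 ''bm''"
                using 6(2) by (simp_all add: same_outside_def)
              then have "best_state n E S (\<C>t i (Suc t)) s6"
                using best_state_subset[OF 8(1) c2] best_state_cong[of s6 s5] by simp
              then show ?case using 6(1) by simp
            qed (use inp l5 ot(2) S power_int_bounds ind_cong[of s5 "''S''" s] in auto)
          qed (use inp l4 in auto)
        next
          case (7 s')
          then show ?case using best_state_subset[OF _ c3] by auto
        qed (use kM kB in auto)
      qed (use nB' in auto)
    qed (use inp l1 in auto)
  next
    case (7 s1)
    then show ?case using best_state_subset[OF _ c4] by auto
  qed (use inp in auto)
qed

lemma wp_record:
  assumes inp: "is_input (s ''in'')" and S: "ind n s ''S'' S" and m: "s ''m'' 0 = int (card S)"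
  shows "wp M B record_com (\<lambda>s'.
    if 3 * (num * int n) \<le> 8 * (int (card S) * den) \<and> s ''Be'' 0 * s ''bm'' 0 < s ''be'' 0 * s ''Bm'' 0
    then s' ''Be'' 0 = s ''be'' 0 \<and> s' ''Bm'' 0 = s ''bm'' 0 \<and> ind n s' ''out'' S
    else s' ''Be'' = s ''Be'' \<and> s' ''Bm'' = s ''Bm'' \<and> s' ''out'' = s ''out'') s"
  unfolding record_com_def
proof (rule ifI, rule ifI, goal_cases)
  case 1
  show ?case
  proof (rule seq, rule store, goal_cases)
    case 2
    show ?case
    proof (rule seq, rule store, goal_cases)
      case 2
      show ?case
      proof (rule mono[OF wp_copy[where A = S]], goal_cases)
        case (4 s2)
        then show ?case using 1 inp m by (auto simp: same_outside_def is_input_def)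
      qed (use inp S in auto)
    qed (erule boundedD)
  qed (erule boundedD)
qed (use inp m in \<open>auto intro!: skip simp: is_input_def\<close>)

lemma wp_split:
  assumes inp: "is_input (s ''in'')" and C: "ind n s ''C'' C" and r: "s ''r'' 0 = int r" "r < n"
  shows "wp M B split_com (\<lambda>s'. \<forall>v<n. s' ''lab'' (int v) = (if v \<in> C then int r + 1 else s ''lab'' (int v))) s"
  unfolding split_com_def
proof (rule for_n[where I = "\<lambda>j s'. (\<forall>v<j. s' ''lab'' (int v) = (if v \<in> C then int r + 1 else s ''lab'' (int v))) \<and>
    (\<forall>v. j \<le> v \<longrightarrow> s' ''lab'' (int v) = s ''lab'' (int v))"], goal_cases)
  case (6 j s1)
  have l1: "s1 ''C'' = s ''C''" "s1 ''r'' = s ''r''" using 6(4) by (simp_all add: same_outside_def)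
  have "int r + 1 \<le> 2 ^ B" using r nB' by linarith
  then show ?case
    by (intro ifI store skip) (use 6 l1 C r in \<open>auto simp: less_Suc_eq ind_def split: if_splits\<close>)
qed (use inp in auto)

text \<open>The effect of a round with all working banks hidden. It separates the machine from the
  combinatorial analysis, which refers only to labels, recorded ratio and output.\<close>

definition round_rel :: "nat \<Rightarrow> state \<Rightarrow> state \<Rightarrow> bool" where
  "round_rel r s s' \<longleftrightarrow> (\<exists>q S C be bm.
     ((q = -1 \<and> (\<forall>u<n. \<forall>v<n. s ''lab'' (int u) = s ''lab'' (int v) \<longrightarrow> u = v)) \<or>
      (\<exists>u<n. \<exists>v<n. u \<noteq> v \<and> s ''lab'' (int u) = s ''lab'' (int v) \<and> q = s ''lab'' (int v))) \<and>
     S = {v. v < n \<and> s ''lab'' (int v) = q} \<and>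
     best E S (threshold_cuts n E S) be bm C \<and>
     (if 3 * (num * int n) \<le> 8 * (int (card S) * den) \<and> s ''Be'' 0 * bm < be * s ''Bm'' 0
      then s' ''Be'' 0 = be \<and> s' ''Bm'' 0 = bm \<and> ind n s' ''out'' S
      else s' ''Be'' = s ''Be'' \<and> s' ''Bm'' = s ''Bm'' \<and> s' ''out'' = s ''out'') \<and>
     (\<forall>v<n. s' ''lab'' (int v) = (if v \<in> C then int r + 1 else s ''lab'' (int v))))"

lemma wp_round:
  assumes inp: "is_input (s ''in'')" and r: "s ''r'' 0 = int r" "r < n"
  shows "wp M B round_com (round_rel r s) s"
  unfolding round_com_def
proof (rule seq, rule mono[OF wp_pick[where s = s, OF inp]], goal_cases)
  case (1 s1)
  note pick = 1(1)
  have l1: "s1 ''in'' = s ''in''" "s1 ''lab'' = s ''lab''" "s1 ''Be'' = s ''Be''" "s1 ''Bm'' = s ''Bm''" "s1 ''out'' = s ''out''" "s1 ''r'' = s ''r''"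
    using 1(2) by (simp_all add: same_outside_def)
  define q where "q = s1 ''q'' 0"
  define S where "S = {v. v < n \<and> s ''lab'' (int v) = q}"
  have inp1: "is_input (s1 ''in'')" using inp l1 by simp
  show ?case
  proof (rule seq, rule mono[OF wp_collect[where s = s1, OF inp1]], goal_cases)
    case (1 s2)
    have l2: "s2 ''in'' = s ''in''" "s2 ''lab'' = s ''lab''" "s2 ''Be'' = s ''Be''" "s2 ''Bm'' = s ''Bm''" "s2 ''out'' = s ''out''" "s2 ''r'' = s ''r''"
      using 1(2) l1 by (simp_all add: same_outside_def)
    have S2: "ind n s2 ''S'' S" "ind n s2 ''C'' {}" "s2 ''m'' 0 = int (card S)"
      using 1(1) l1 by (simp_all add: S_def q_def)
    show ?case
    proof (rule seq, rule store, goal_cases)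
      case 2
      show ?case
      proof (rule seq, rule store, goal_cases)
        case 2
        show ?case
        proof (rule seq, rule mono[OF wp_power[where S = S]], goal_cases)
          case 4
          show ?case using S2 by (auto simp: best_state_def best_def)
        next
          case (5 s3)
          have l3: "s3 ''in'' = s ''in''" "s3 ''lab'' = s ''lab''" "s3 ''Be'' = s ''Be''" "s3 ''Bm'' = s ''Bm''" "s3 ''out'' = s ''out''"
            "s3 ''r'' = s ''r''" "s3 ''S'' = s2 ''S''" "s3 ''m'' = s2 ''m''"
            using 5(2) l2 by (simp_all add: same_outside_def)
          obtain C where C: "ind n s3 ''C'' C" "best E S (threshold_cuts n E S) (s3 ''be'' 0) (s3 ''bm'' 0) C"
            using 5(1) by (auto simp: best_state_def)
          have S3: "ind n s3 ''S'' S" using S2(1) l3 ind_cong[of s3 "''S''" s2] by simp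
          show ?case
          proof (rule seq, rule mono[OF wp_record[where s = s3, OF _ S3]], goal_cases)
            case (3 s4)
            have l4: "s4 ''in'' = s ''in''" "s4 ''lab'' = s ''lab''" "s4 ''r'' = s ''r''" "s4 ''C'' = s3 ''C''"
              using 3(2) l3 by (simp_all add: same_outside_def)
            show ?case
            proof (rule mono[OF wp_split[where C = C and r = r]], goal_cases)
              case (5 s5)
              have l5: "s5 ''Be'' = s4 ''Be''" "s5 ''Bm'' = s4 ''Bm''" "s5 ''out'' = s4 ''out''"
                using 5(2) by (simp_all add: same_outside_def)
              have pick': "(q = -1 \<and> (\<forall>u<n. \<forall>v<n. s ''lab'' (int u) = s ''lab'' (int v) \<longrightarrow> u = v)) \<or>
                (\<exists>u<n. \<exists>v<n. u \<noteq> v \<and> s ''lab'' (int u) = s ''lab'' (int v) \<and> q = s ''lab'' (int v))"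
                unfolding q_def by (rule pick)
              have rec: "if 3 * (num * int n) \<le> 8 * (int (card S) * den) \<and> s ''Be'' 0 * s3 ''bm'' 0 < s3 ''be'' 0 * s ''Bm'' 0
                then s5 ''Be'' 0 = s3 ''be'' 0 \<and> s5 ''Bm'' 0 = s3 ''bm'' 0 \<and> ind n s5 ''out'' S
                else s5 ''Be'' = s ''Be'' \<and> s5 ''Bm'' = s ''Bm'' \<and> s5 ''out'' = s ''out''"
                using 3(1) l3 l5 ind_cong[of s5 "''out''" s4] by simp
              have lab: "\<forall>v<n. s5 ''lab'' (int v) = (if v \<in> C then int r + 1 else s ''lab'' (int v))"
                using 5(1) l4 by simp
              show ?case
                unfolding round_rel_def
                by (rule exI[of _ q], rule exI[of _ S], rule exI[of _ C], rule exI[of _ "s3 ''be'' 0"],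
                    rule exI[of _ "s3 ''bm'' 0"]) (use pick' C(2) rec lab S_def in blast)
            qed (use inp l4 r C ind_cong[of s4 "''C''" s3] in auto)
          qed (use inp l3 S2 in auto)
        qed (use inp l2 S2 in auto)
      qed simp
    qed (use nB' in simp)
  qed
qed

text \<open>The premise \<open>cong\<close> makes the invariant insensitive to the round counter,
  which the loop itself advances.\<close>

lemma wp_main:
  assumes inp: "is_input (s ''in'')"
    and init: "\<And>s'. ind n s' ''out'' {..<n} \<Longrightarrow> s' ''Be'' = s ''Be'' \<Longrightarrow> s' ''Bm'' 0 = 1 \<Longrightarrow> s' ''lab'' = s ''lab'' \<Longrightarrow> I 0 s'"
    and cong: "\<And>j f s'. I j (s'(''r'' := f)) = I j s'"
    and step: "\<And>j s' s''. j < n \<Longrightarrow> I j s' \<Longrightarrow> round_rel j s' s'' \<Longrightarrow> I (Suc j) s''"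
  shows "wp M B main_com (I n) s"
  unfolding main_com_def
proof (rule seq, rule mono[OF for_n[where I = "\<lambda>j s'. \<forall>v<j. s' ''out'' (int v) = 1"
      and Q = "\<lambda>s'. \<forall>v<n. s' ''out'' (int v) = 1"]], goal_cases)
  case (6 j s1)
  show ?case by (rule store) (use 6 nB' in \<open>auto simp: less_Suc_eq\<close>)
next
  case (8 s1)
  have l1: "s1 ''in'' = s ''in''" "s1 ''Be'' = s ''Be''" "s1 ''lab'' = s ''lab''"
    using 8(2) by (simp_all add: same_outside_def)
  show ?case
  proof (rule seq, rule store, goal_cases)
    case 2
    show ?case
    proof (rule for_n[where I = I], goal_cases)
      case 5
      show ?case unfolding cong by (rule init) (use 8 l1 in \<open>auto simp: ind_def\<close>)
    next
      case (6 j s2)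
      show ?case unfolding cong
        by (rule mono[OF wp_round[where s = s2, OF 6(5) 6(3) 6(1)]]) (use step[OF 6(1,2)] in auto)
    qed (use inp l1 in auto)
  qed (use nB' in auto)
qed (use inp in auto)

end

section \<open>Quality of the cuts\<close>

lemma cut_weight_mono:
  assumes "finite A'" "finite B'" "A \<subseteq> A'" "B \<subseteq> B'" "\<And>u v. a u v \<ge> 0"
  shows "cut_weight a A B \<le> cut_weight a A' B'"
proof -
  have "cut_weight a A B \<le> (\<Sum>u\<in>A. \<Sum>v\<in>B'. a u v)"
    unfolding cut_weight_def using assms by (intro sum_mono sum_mono2) auto
  also have "\<dots> \<le> cut_weight a A' B'"
    unfolding cut_weight_def using assms by (intro sum_mono2 sum_nonneg) auto
  finally show ?thesis .
qed

lemma cut_weight_Un_right: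
  "finite B \<Longrightarrow> finite C \<Longrightarrow> B \<inter> C = {} \<Longrightarrow> cut_weight a A (B \<union> C) = cut_weight a A B + cut_weight a A C"
  by (simp add: cut_weight_def sum.union_disjoint sum.distrib)

lemma cut_weight_le_degree:
  assumes "\<And>u. u \<in> A \<Longrightarrow> (\<Sum>v\<in>S. a u v) \<le> \<Delta>" "finite S" "B \<subseteq> S" "\<And>u v. a u v \<ge> 0"
  shows "cut_weight a A B \<le> \<Delta> * card A"
proof -
  have "(\<Sum>v\<in>B. a u v) \<le> \<Delta>" if "u \<in> A" for u
    using sum_mono2[of S B "a u"] assms that by force
  then have "cut_weight a A B \<le> real (card A) * \<Delta>" unfolding cut_weight_def by (intro sum_bounded_above) auto
  then show ?thesis by (simp add: mult.commute)
qed

lemma simple_graph_edge: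
  "simple_graph W E \<Longrightarrow> e \<in> E \<Longrightarrow> \<exists>u v. u \<noteq> v \<and> e = {u, v}"
  unfolding simple_graph_def by blast

lemma simple_graph_finite_edges: "simple_graph W E \<Longrightarrow> finite E"
proof -
  assume "simple_graph W E"
  then have "E \<subseteq> Pow W" "finite W" by (auto simp: simple_graph_def)
  then show "finite E" by (meson finite_Pow_iff finite_subset)
qed

lemma regular_graph_degree_le:
  assumes reg: "regular_graph W E \<Delta>" and u: "u \<in> W" and S: "S \<subseteq> W"
  shows "(\<Sum>v\<in>S. adj E u v) \<le> real \<Delta>"
proof -
  have fin: "finite S" "finite E" using reg S simple_graph_finite_edges finite_subset
    by (auto simp: regular_graph_def simple_graph_def)
  have "(\<Sum>v\<in>S. adj E u v) = real (card {v \<in> S. {u, v} \<in> E})"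
    using fin by (simp add: adj_def sum.If_cases Int_def)
  also have "card {v \<in> S. {u, v} \<in> E} = card ((\<lambda>v. {u, v}) ` {v \<in> S. {u, v} \<in> E})"
    by (intro card_image[symmetric] inj_onI) (auto simp: doubleton_eq_iff)
  also have "\<dots> \<le> card {e \<in> E. u \<in> e}" using fin by (intro card_mono) auto
  also have "\<dots> = \<Delta>" using reg u by (simp add: regular_graph_def)
  finally show ?thesis by simp
qed

text \<open>Makes \<open>n\<close> an admissible shift \<open>D\<close> of the power iteration, so
  that the program can do without \<Delta>.\<close>

lemma regular_graph_degree_less_card:
  assumes reg: "regular_graph W E \<Delta>" and u: "u \<in> W"
  shows "\<Delta> \<le> card W"
proof -
  have W: "finite W" using reg by (simp add: regular_graph_def simple_graph_def)
  have "{e \<in> E. u \<in> e} \<subseteq> (\<lambda>v. {u, v}) ` W"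
    using reg by (fastforce simp: regular_graph_def simple_graph_def)
  then have "card {e \<in> E. u \<in> e} \<le> card W" using W by (meson card_image_le card_mono finite_imageI le_trans)
  then show ?thesis using reg u by (simp add: regular_graph_def)
qed

text \<open>The easy direction of Cheeger's inequality: the variational bound at the centred
  indicator of \<open>R\<close>, whose squared norm is |R| |S - R| / |S| and whose energy is twice
  the cut.\<close>

lemma lambda2_induced_cut:
  assumes S: "finite S" and simple: "\<And>e. e \<in> E \<Longrightarrow> \<exists>u v. u \<noteq> v \<and> e = {u, v}" and R: "R \<subseteq> S"
  shows "lambda2_induced E S * (card R * card (S - R)) \<le> card S * cut_weight (adj E) R (S - R)"
proof (cases "S = {}")
  case False
  define m r where "m = real (card S)" and "r = real (card R)"
  have m: "m > 0" using False S by (simp add: m_def card_gt_0_iff)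
  have mr: "real (card (S - R)) = m - r"
    using S R by (simp add: m_def r_def card_Diff_subset card_mono finite_subset of_nat_diff)
  define x where "x u = (if u \<in> R then 1 else 0) - r / m" for u
  have ind: "(\<Sum>u\<in>S. if u \<in> R then 1 else 0) = r"
    using S R by (simp add: sum.inter_restrict[symmetric] Int_absorb1 r_def)
  have mean: "(\<Sum>u\<in>S. x u) = 0" using m by (simp add: x_def sum_subtractf ind m_def)
  have "lambda2_induced E S * (\<Sum>u\<in>S. (x u)\<^sup>2) \<le> energy (adj E) S x / 2"
    by (intro lambda2_induced_variational S mean) (rule simple)
  also have "energy (adj E) S x = (\<Sum>u\<in>S. \<Sum>v\<in>S. adj E u v * (if (u \<in> R) \<noteq> (v \<in> R) then 1 else 0))"
    unfolding energy_def by (intro sum.cong) (auto simp: x_def)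
  also have "\<dots> = 2 * cut_weight (adj E) R (S - R)" by (rule sum_separated_pairs[OF S R adj_sym])
  also have "(\<Sum>u\<in>S. (x u)\<^sup>2) = (\<Sum>u\<in>S. (1 - 2 * r / m) * (if u \<in> R then 1 else 0) + (r / m)\<^sup>2)"
    by (intro sum.cong) (auto simp: x_def power2_eq_square algebra_simps)
  also have "\<dots> = (1 - 2 * r / m) * r + m * (r / m)\<^sup>2"
    by (simp only: sum.distrib sum_distrib_left[symmetric] ind) (simp add: m_def)
  also have "\<dots> = r * (m - r) / m" using m by (simp add: power2_eq_square field_simps)
  finally have "lambda2_induced E S * (r * (m - r)) \<le> m * cut_weight (adj E) R (S - R)"
    using m by (simp add: field_simps)
  then show ?thesis using mr by (simp add: m_def r_def)
qed (use R in simp)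

section \<open>Ratio of the best cut against \<open>\<lambda>\<^sub>2\<close>\<close>

lemma real_cut_int: "real_of_int (cut_int E S A) = cut_weight (adj E) A (S - A)"
  by (simp add: cut_int_def cut_weight_def adj_int_def adj_def if_distrib cong: if_cong)

lemma real_min_side:
  "finite S \<Longrightarrow> A \<subseteq> S \<Longrightarrow> real_of_int (min_side S A) = min (card A) (card S - card A)"
  by (auto simp: min_side_def min_def card_mono of_nat_diff)

text \<open>The mask in \<open>step_int\<close> reduces its sum over all vertices to the sum over
  \<open>S\<close>, so on \<open>S\<close> the values outside never enter.\<close>

lemma power_vec_eq_power_int:
  assumes "S \<subseteq> {..<n}" "u \<in> S"
  shows "power_vec (adj E) S (real n) i t u = real_of_int (power_int n E S i t u)"
  using assms(2)
proof (induction t arbitrary: u)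
  case (Suc t)
  have "lap (adj E) S (power_vec (adj E) S (real n) i t) u =
      (\<Sum>v\<in>{..<n} \<inter> S. adj E u v * (real_of_int (power_int n E S i t u) - real_of_int (power_int n E S i t v)))"
    using assms(1) Suc by (simp add: lap_def Int_absorb1)
  also have "\<dots> = (\<Sum>v<n. if v \<in> S then adj E u v * (real_of_int (power_int n E S i t u) - real_of_int (power_int n E S i t v)) else 0)"
    by (rule sum.inter_restrict) simp
  also have "\<dots> = real_of_int (\<Sum>v<n. (adj_int E u v * ((if u \<in> S then 1 else 0) * (if v \<in> S then 1 else 0))) *
      (power_int n E S i t u - power_int n E S i t v))"
    unfolding of_int_sum using Suc.prems by (intro sum.cong) (auto simp: adj_def adj_int_def)
  finally show ?case using Suc by (simp add: step_int_def)
qed simp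

text \<open>A nonzero ratio \<phi> = be / bm has numerator at least 1 and denominator at most n, so
  \<phi> \<ge> 1 / n. The error 1 / (4 n^3) of the power method, multiplied by 2 \<Delta> \<le> 2 n,
  is then at most \<phi>^2 / 2; absorbing it on the left doubles the constant 4 to 8.\<close>

lemma best_ratio_square_le:
  assumes reg: "regular_graph {..<n} E \<Delta>" and S: "S \<subseteq> {..<n}" "card S \<ge> 2"
    and best: "best E S (threshold_cuts n E S) be bm C" and bm: "bm > 0"
  shows "(real_of_int be)\<^sup>2 \<le> 8 * real \<Delta> * lambda2_induced E S * (real_of_int bm)\<^sup>2"
proof -
  define l where "l = lambda2_induced E S"
  have fin: "finite S" using S finite_subset by blast
  have simple: "\<And>e. e \<in> E \<Longrightarrow> \<exists>u v. u \<noteq> v \<and> e = {u, v}"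
    using reg simple_graph_edge unfolding regular_graph_def by blast
  have l0: "l \<ge> 0" unfolding l_def by (rule lambda2_induced_nonneg[OF fin simple])
  have be: "be = cut_int E S C" "C \<subseteq> S" and bmC: "bm = min_side S C"
    using best bm by (auto simp: best_def)
  have be0: "be \<ge> 0" using be cut_int_nonneg by simp
  show ?thesis
  proof (cases "be = 0")
    case True
    then show ?thesis using l0 by (simp add: l_def)
  next
    case False
    then have be1: "be \<ge> 1" using be0 by simp
    define \<phi> where "\<phi> = real_of_int be / real_of_int bm"
    have \<phi>: "\<phi> > 0" using be1 bm by (simp add: \<phi>_def)
    obtain u0 where u0: "u0 \<in> S" using S by fastforce
    have n1: "n \<ge> 1" using u0 S by fastforce
    have deg: "\<And>u. u \<in> S \<Longrightarrow> (\<Sum>v\<in>S. adj E u v) \<le> real \<Delta>"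
      using regular_graph_degree_le[OF reg] S by blast
    \<comment> \<open>At most \<Delta> times its size many edges leave either side; taken for the
      smaller one this bounds \<phi> by \<Delta>, as the power method requires an upper bound on
      \<phi>.\<close>
    have cut1: "real_of_int be \<le> real \<Delta> * real (card C)"
      unfolding be(1) real_cut_int
      by (rule cut_weight_le_degree[where S = S]) (use deg be fin adj_nonneg in auto)
    have "cut_weight (adj E) C (S - C) = cut_weight (adj E) (S - C) C"
      by (rule cut_weight_commute[OF adj_sym])
    also have "\<dots> \<le> real \<Delta> * card (S - C)"
      by (rule cut_weight_le_degree[where S = S]) (use deg be fin adj_nonneg in auto)
    also have "card (S - C) = card S - card C" using be fin finite_subset by (intro card_Diff_subset) auto
    finally have cut2: "real_of_int be \<le> real \<Delta> * real (card S - card C)"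
      unfolding be(1) real_cut_int .
    have "real_of_int bm = min (card C) (card S - card C)" unfolding bmC by (rule real_min_side[OF fin be(2)])
    then have le: "real_of_int be \<le> real \<Delta> * real_of_int bm" using cut1 cut2 by (simp add: min_def split: if_splits)
    have \<Delta>: "real \<Delta> > 0"
    proof (rule ccontr)
      assume "\<not> real \<Delta> > 0"
      then show False using le be1 by simp
    qed
    have \<phi>2: "\<phi> \<le> 2 * real \<Delta>"
    proof -
      have "\<phi> \<le> real \<Delta>" using le bm by (simp add: \<phi>_def field_simps)
      then show ?thesis using \<Delta> by linarith
    qed
    have Dn: "real \<Delta> \<le> real n" using regular_graph_degree_less_card[OF reg, of u0] u0 S by auto
    obtain x where x: "\<exists>u\<in>S. x u \<noteq> 0" "(\<Sum>u\<in>S. x u) = 0" "\<And>u. u \<in> S \<Longrightarrow> lap (adj E) S x u = l * x u"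
      using lambda2_induced_eigenvector[OF fin simple S(2)] unfolding l_def by blast
    have "\<phi>\<^sup>2 / (2 * real \<Delta>) \<le> 2 * l + 2 * real n * card S / real (8 * n ^ 5)"
    proof (rule power_vec_sweep[OF fin adj_sym adj_nonneg deg \<Delta> Dn \<phi> \<phi>2 _ _ x(1,2,3)])
      show "0 < 8 * n ^ 5" using n1 by simp
      fix i t w assume i: "i \<in> S" and t: "t < 8 * n ^ 5" and w: "w \<in> S"
      let ?A = "{u \<in> S. power_vec (adj E) S (real n) i t u > power_vec (adj E) S (real n) i t w}"
      have A: "?A = threshold_cut n E S i t w"
        using power_vec_eq_power_int[OF S(1)] w by (auto simp: threshold_cut_def)
      have sub: "?A \<subseteq> S" by auto
      have "?A \<in> threshold_cuts n E S" unfolding A threshold_cuts_def using i t w S by blast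
      then have "be * min_side S ?A \<le> cut_int E S ?A * bm" using best by (simp add: best_def)
      then have "real_of_int (be * min_side S ?A) \<le> real_of_int (cut_int E S ?A * bm)" by (simp only: of_int_le_iff)
      then have "real_of_int be * min (card ?A) (card S - card ?A) \<le> cut_weight (adj E) ?A (S - ?A) * real_of_int bm"
        unfolding of_int_mult real_min_side[OF fin sub] real_cut_int .
      then show "let A = ?A in \<phi> * min (card A) (card S - card A) \<le> cut_weight (adj E) A (S - A)"
        unfolding Let_def \<phi>_def using bm by (simp add: field_simps)
    qed auto
    moreover have "2 * real n * card S / real (8 * n ^ 5) \<le> 1 / (4 * real n ^ 3)"
    proof -
      have "card S \<le> n" using card_mono[OF _ S(1)] by simp
      then have "2 * real n * card S \<le> 2 * real n * real n" by (intro mult_left_mono) auto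
      then have "2 * real n * card S / real (8 * n ^ 5) \<le> 2 * real n * real n / real (8 * n ^ 5)"
        by (intro divide_right_mono) auto
      also have "\<dots> = 1 / (4 * real n ^ 3)" using n1 by (simp add: field_simps power_def numeral_eq_Suc)
      finally show ?thesis .
    qed
    ultimately have "\<phi>\<^sup>2 / (2 * real \<Delta>) \<le> 2 * l + 1 / (4 * real n ^ 3)" by linarith
    then have "2 * real \<Delta> * (\<phi>\<^sup>2 / (2 * real \<Delta>)) \<le> 2 * real \<Delta> * (2 * l + 1 / (4 * real n ^ 3))"
      using \<Delta> by (intro mult_left_mono) auto
    then have "\<phi>\<^sup>2 \<le> 4 * real \<Delta> * l + real \<Delta> * (1 / (2 * real n ^ 3))"
      using \<Delta> by (simp add: algebra_simps)
    also have "real \<Delta> * (1 / (2 * real n ^ 3)) \<le> real n * (1 / (2 * real n ^ 3))"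
      using Dn by (intro mult_right_mono) auto
    also have "\<dots> = (1 / real n)\<^sup>2 / 2" using n1 by (simp add: field_simps power_def numeral_eq_Suc)
    also have "\<dots> \<le> \<phi>\<^sup>2 / 2"
    proof -
      have "bm \<le> int n" using bmC card_mono[OF _ S(1)] be fin
        by (simp add: min_side_def)
      then have "1 / real n \<le> \<phi>" unfolding \<phi>_def
        using be1 bm n1 by (intro frac_le) auto
      then have "(1 / real n)\<^sup>2 \<le> \<phi>\<^sup>2" by (intro power_mono) auto
      then show ?thesis by simp
    qed
    finally have "\<phi>\<^sup>2 \<le> 8 * real \<Delta> * l" by simp
    then have "\<phi>\<^sup>2 * (real_of_int bm)\<^sup>2 \<le> 8 * real \<Delta> * l * (real_of_int bm)\<^sup>2" by (rule mult_right_mono) simp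
    then show ?thesis using bm by (simp add: \<phi>_def power_divide l_def)
  qed
qed

text \<open>Of a piece \<open>X\<close> on the path that follows \<open>T\<close>, the number of vertices outside \<open>X\<close> pays for the
  edges of \<open>T\<close> that have been cut.\<close>
definition heavy :: "('a \<Rightarrow> 'a \<Rightarrow> real) \<Rightarrow> 'a set \<Rightarrow> real \<Rightarrow> nat \<Rightarrow> 'a set \<Rightarrow> bool" where
  "heavy a T \<phi> n X \<longleftrightarrow> 3 * card T \<le> 4 * card (T \<inter> X) \<and>
     cut_weight a (T \<inter> X) (T - X) \<le> \<phi> * (real n - real (card X))"

text \<open>\<open>X\<close> is kept and \<open>Y\<close> discarded. Edges from T \<inter> X to the
  rest of \<open>T\<close> either leave the old piece, paid by the vertices outside it, or enter
  \<open>Y\<close>, paid by the vertices of \<open>Y\<close>. The larger share keeps at least 3/8 of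
  \<open>T\<close>, and the expansion of \<open>T\<close> lifts this back to 3/4.\<close>

lemma heavy_larger_half:
  fixes a :: "'a \<Rightarrow> 'a \<Rightarrow> real" and \<phi> \<kappa> :: real
  assumes fin: "finite T" "finite X" "finite Y" and XY: "X \<inter> Y = {}" and n: "card (X \<union> Y) \<le> n"
    and sym: "\<And>u v. a u v = a v u" and nonneg: "\<And>u v. a u v \<ge> 0"
    and expand: "\<And>R. R \<subseteq> T \<Longrightarrow> \<kappa> * (card R * card (T - R)) \<le> card T * cut_weight a R (T - R)"
    and \<phi>: "0 \<le> \<phi>" "8 * \<phi> * n \<le> \<kappa> * card T" and \<kappa>: "\<kappa> > 0" and T: "card T > 0"
    and heavy: "heavy a T \<phi> n (X \<union> Y)" and cut: "cut_weight a X Y \<le> \<phi> * card Y"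
    and half: "card (T \<inter> Y) \<le> card (T \<inter> X)"
  shows "heavy a T \<phi> n X"
proof -
  have "cut_weight a (T \<inter> X) (T - X) = cut_weight a (T \<inter> X) ((T - (X \<union> Y)) \<union> (T \<inter> Y))"
    by (rule arg_cong[where f = "cut_weight a (T \<inter> X)"]) (use XY in auto)
  also have "\<dots> = cut_weight a (T \<inter> X) (T - (X \<union> Y)) + cut_weight a (T \<inter> X) (T \<inter> Y)"
    by (rule cut_weight_Un_right) (use fin in auto)
  also have "cut_weight a (T \<inter> X) (T - (X \<union> Y)) \<le> cut_weight a (T \<inter> (X \<union> Y)) (T - (X \<union> Y))"
    by (rule cut_weight_mono) (use fin nonneg in auto)
  also have "\<dots> \<le> \<phi> * (real n - real (card (X \<union> Y)))" using heavy by (simp add: heavy_def)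
  also have "cut_weight a (T \<inter> X) (T \<inter> Y) \<le> cut_weight a X Y"
    by (rule cut_weight_mono) (use fin nonneg in auto)
  also note cut
  also have "\<phi> * (real n - real (card (X \<union> Y))) + \<phi> * card Y = \<phi> * (real n - real (card X))"
    using fin XY by (simp add: card_Un_disjoint algebra_simps)
  finally have bound: "cut_weight a (T \<inter> X) (T - X) \<le> \<phi> * (real n - real (card X))" by simp
  define p t where "p = real (card (T \<inter> X))" and "t = real (card T)"
  have t: "t > 0" using T by (simp add: t_def)
  have diff: "real (card (T - T \<inter> X)) = t - p"
    using fin by (simp add: t_def p_def card_Diff_subset card_mono of_nat_diff)
  have split: "card (T \<inter> (X \<union> Y)) = card (T \<inter> X) + card (T \<inter> Y)"
    unfolding Int_Un_distrib using fin XY by (intro card_Un_disjoint) auto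
  have p38: "3 * t \<le> 8 * p" using heavy half split by (simp add: heavy_def p_def t_def)
  have "T - T \<inter> X = T - X" by blast
  then have "\<kappa> * (p * (t - p)) \<le> t * cut_weight a (T \<inter> X) (T - X)"
    using expand[of "T \<inter> X"] diff by (simp add: p_def t_def)
  also have "\<dots> \<le> t * (\<phi> * (real n - real (card X)))" using bound t by (intro mult_left_mono) auto
  also have "\<dots> \<le> t * (\<phi> * real n)" using t \<phi> by (intro mult_left_mono) auto
  also have "\<dots> \<le> t * (\<kappa> * t / 8)" using t \<phi> by (intro mult_left_mono) (auto simp: t_def)
  finally have "\<kappa> * (p * (t - p)) \<le> \<kappa> * (t * t / 8)" by (simp add: algebra_simps)
  then have small: "p * (t - p) \<le> t * t / 8" using \<kappa> by (rule mult_left_le_imp_le)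
  have "3 * t \<le> 4 * p"
  proof (rule ccontr)
    assume "\<not> 3 * t \<le> 4 * p"
    \<comment> \<open>Between 3 t / 8 and 3 t / 4 this product is nonnegative, whereas p (t - p)
      \<le> t^2 / 8 and p t \<le> 3 t^2 / 4 bound its expansion by (4 + 3 - 9) t^2 < 0.\<close>
    then have "0 \<le> (8 * p - 3 * t) * (3 * t - 4 * p)" using p38 by simp
    moreover have "(8 * p - 3 * t) * (3 * t - 4 * p) = 32 * (p * (t - p)) + 4 * (p * t) - 9 * (t * t)"
      by (simp add: algebra_simps)
    moreover have "p * t \<le> 3 / 4 * t * t" using \<open>\<not> 3 * t \<le> 4 * p\<close> t by (intro mult_right_mono) auto
    moreover have "t * t > 0" using t by simp
    ultimately show False using small by linarith
  qed
  then have "3 * card T \<le> 4 * card (T \<inter> X)" unfolding p_def t_def by linarith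
  then show ?thesis using bound by (simp add: heavy_def)
qed

text \<open>The ratio is measured by the smaller side, so the cut is affordable whichever side is
  discarded, and the one with the larger share of \<open>T\<close> can be kept even if it is the
  smaller set.\<close>

lemma heavy_split:
  fixes a :: "'a \<Rightarrow> 'a \<Rightarrow> real" and \<phi> \<kappa> :: real
  assumes fin: "finite T" "finite S" and C: "C \<subseteq> S" and n: "card S \<le> n"
    and sym: "\<And>u v. a u v = a v u" and nonneg: "\<And>u v. a u v \<ge> 0"
    and expand: "\<And>R. R \<subseteq> T \<Longrightarrow> \<kappa> * (card R * card (T - R)) \<le> card T * cut_weight a R (T - R)"
    and \<phi>: "0 \<le> \<phi>" "8 * \<phi> * n \<le> \<kappa> * card T" and \<kappa>: "\<kappa> > 0" and T: "card T > 0"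
    and heavy: "heavy a T \<phi> n S" and cut: "cut_weight a C (S - C) \<le> \<phi> * min (card C) (card S - card C)"
  shows "heavy a T \<phi> n C \<or> heavy a T \<phi> n (S - C)"
proof -
  have finC: "finite C" using fin C finite_subset by blast
  have S1: "C \<union> (S - C) = S" "(S - C) \<union> C = S" using C by auto
  have cS: "card (S - C) = card S - card C" using C finC by (intro card_Diff_subset) auto
  have 1: "cut_weight a C (S - C) \<le> \<phi> * card (S - C)"
    using cut mult_left_mono[OF _ \<phi>(1), of "real (min (card C) (card S - card C))" "real (card (S - C))"] cS by simp
  have 2: "cut_weight a (S - C) C \<le> \<phi> * card C"
    using cut cut_weight_commute[where a = a and A = "S - C" and B = C, OF sym]
      mult_left_mono[OF _ \<phi>(1), of "real (min (card C) (card S - card C))" "real (card C)"] by simp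
  show ?thesis
  proof (cases "card (T \<inter> (S - C)) \<le> card (T \<inter> C)")
    case True
    have "heavy a T \<phi> n C"
      by (rule heavy_larger_half[of T C "S - C" n a \<kappa> \<phi>])
        (use fin finC n nonneg expand \<phi> \<kappa> T heavy 1 True S1 in \<open>auto intro: sym\<close>)
    then show ?thesis ..
  next
    case False
    have "heavy a T \<phi> n (S - C)"
      by (rule heavy_larger_half[of T "S - C" C n a \<kappa> \<phi>])
        (use fin finC n nonneg expand \<phi> \<kappa> T heavy 2 False S1 in \<open>auto intro: sym\<close>)
    then show ?thesis ..
  qed
qed

section \<open>Following the optimal set\<close>

context ram_run
begin

definition piece :: "state \<Rightarrow> int \<Rightarrow> nat set" where
  "piece s q = {v. v < n \<and> s ''lab'' (int v) = q}"

text \<open>The alternative in the second clause measures progress: while some piece is splittable,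
  j + 1 labels are in use, which is impossible for j = n. The spectral certificate is kept together
  with the recorded set, since that piece is itself split later. For \<phi> = 0 nothing has to be
  followed.\<close>

definition invariant :: "nat \<Rightarrow> nat set \<Rightarrow> real \<Rightarrow> nat \<Rightarrow> state \<Rightarrow> bool" where
  "invariant \<Delta> T \<phi> j s \<longleftrightarrow>
     (\<forall>v<n. 0 \<le> s ''lab'' (int v) \<and> s ''lab'' (int v) \<le> int j) \<and>
     (inj_on (\<lambda>v. s ''lab'' (int v)) {..<n} \<or> (\<lambda>v. s ''lab'' (int v)) ` {..<n} = {0..int j}) \<and>
     (\<exists>S. ind n s ''out'' S \<and> 3 * (num * int n) \<le> 8 * (int (card S) * den) \<and> s ''Bm'' 0 > 0 \<and> s ''Be'' 0 \<ge> 0 \<and>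
       (real_of_int (s ''Be'' 0))\<^sup>2 \<le> 8 * real \<Delta> * lambda2_induced E S * (real_of_int (s ''Bm'' 0))\<^sup>2) \<and>
     (\<phi> > 0 \<longrightarrow> \<phi> * real_of_int (s ''Bm'' 0) \<le> real_of_int (s ''Be'' 0) \<or> (\<exists>q. heavy (adj E) T \<phi> n (piece s q)))"

text \<open>For the last clause only the round that treats the heavy piece matters: with best ratio
  at least \<phi> the piece is large enough to compete for the record, otherwise one of its two
  parts is heavy. Other rounds leave the heavy piece intact.\<close>

lemma invariant_round:
  fixes \<phi> :: real
  assumes reg: "regular_graph {..<n} E \<Delta>" and T: "T \<subseteq> {..<n}" and num: "num > 0" and den: "den > 0"
    and size: "num * int n \<le> int (card T) * den"
    and \<phi>: "8 * \<phi> * n \<le> lambda2_induced E T * card T"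
    and pos: "\<phi> > 0 \<Longrightarrow> lambda2_induced E T > 0"
    and j: "j < n" and inv: "invariant \<Delta> T \<phi> j s" and round: "round_rel j s s'"
  shows "invariant \<Delta> T \<phi> (Suc j) s'"
proof -
  let ?l = "\<lambda>s v. s ''lab'' (int v)"
  have simple: "\<And>e. e \<in> E \<Longrightarrow> \<exists>u v. u \<noteq> v \<and> e = {u, v}"
    using reg simple_graph_edge unfolding regular_graph_def by blast
  from round obtain q S C be bm where
    pick: "(q = -1 \<and> (\<forall>u<n. \<forall>v<n. ?l s u = ?l s v \<longrightarrow> u = v)) \<or>
      (\<exists>u<n. \<exists>v<n. u \<noteq> v \<and> ?l s u = ?l s v \<and> q = ?l s v)" and
    S: "S = {v. v < n \<and> ?l s v = q}" and best: "best E S (threshold_cuts n E S) be bm C" and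
    rec: "if 3 * (num * int n) \<le> 8 * (int (card S) * den) \<and> s ''Be'' 0 * bm < be * s ''Bm'' 0
      then s' ''Be'' 0 = be \<and> s' ''Bm'' 0 = bm \<and> ind n s' ''out'' S
      else s' ''Be'' = s ''Be'' \<and> s' ''Bm'' = s ''Bm'' \<and> s' ''out'' = s ''out''" and
    lab: "\<forall>v<n. ?l s' v = (if v \<in> C then int j + 1 else ?l s v)"
    unfolding round_rel_def by blast
  have CS: "C \<subseteq> S" using best by (simp add: best_def)
  have Sn: "S \<subseteq> {..<n}" and finS: "finite S" using S by auto
  have range: "\<forall>v<n. 0 \<le> ?l s v \<and> ?l s v \<le> int j"
    and cover: "inj_on (?l s) {..<n} \<or> ?l s ` {..<n} = {0..int j}"
    and out: "\<exists>S. ind n s ''out'' S \<and> 3 * (num * int n) \<le> 8 * (int (card S) * den) \<and> s ''Bm'' 0 > 0 \<and> s ''Be'' 0 \<ge> 0 \<and>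
       (real_of_int (s ''Be'' 0))\<^sup>2 \<le> 8 * real \<Delta> * lambda2_induced E S * (real_of_int (s ''Bm'' 0))\<^sup>2"
    and good: "\<phi> > 0 \<longrightarrow> \<phi> * real_of_int (s ''Bm'' 0) \<le> real_of_int (s ''Be'' 0) \<or> (\<exists>q. heavy (adj E) T \<phi> n (piece s q))"
    using inv by (simp_all add: invariant_def)
  have Bm: "s ''Bm'' 0 > 0" using out by blast
  have range': "\<forall>v<n. 0 \<le> ?l s' v \<and> ?l s' v \<le> int (Suc j)" using range lab by auto
  from pick show ?thesis
  proof (elim disjE)
    assume q: "q = -1 \<and> (\<forall>u<n. \<forall>v<n. ?l s u = ?l s v \<longrightarrow> u = v)"
    \<comment> \<open>Labels are nonnegative, so -1 selects the empty piece, which fails the size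
      test because num * n > 0.\<close>
    then have S0: "S = {}" using range by (auto simp: S)
    then have C0: "C = {}" using CS by simp
    have "num * int n > 0" using num j by simp
    then have eq: "s' ''Be'' = s ''Be''" "s' ''Bm'' = s ''Bm''" "s' ''out'' = s ''out''"
      using rec S0 by (simp_all split: if_splits)
    have lab': "\<forall>v<n. ?l s' v = ?l s v" using lab C0 by simp
    then have "piece s' q = piece s q" for q by (auto simp: piece_def)
    moreover have "inj_on (?l s') {..<n}" using q lab' by (auto simp: inj_on_def)
    ultimately show ?thesis using range' out good eq ind_cong[of s' "''out''" s]
      by (simp add: invariant_def)
  next
    assume "\<exists>u<n. \<exists>v<n. u \<noteq> v \<and> ?l s u = ?l s v \<and> q = ?l s v"
    then obtain u v where u: "u < n" and v: "v < n" and uv: "u \<noteq> v" "?l s u = ?l s v" "q = ?l s v" by blast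
    have uS: "u \<in> S" "v \<in> S" using u v uv by (auto simp: S)
    have S2: "card S \<ge> 2" using card_mono[of S "{u,v}"] uS uv finS by simp
    have bm: "bm > 0"
    proof (rule ccontr)
      assume "\<not> bm > 0"
      then have b: "be = 1" "bm = 0" using best by (auto simp: best_def)
      \<comment> \<open>The initial vector e_u already separates \<open>u\<close> from
        \<open>v\<close>, so a nontrivial cut is always tested and 1 / 0 cannot survive.\<close>
      have "threshold_cut n E S u 0 v = {u}" using uS uv by (auto simp: threshold_cut_def)
      moreover have "threshold_cut n E S u 0 v \<in> threshold_cuts n E S"
        unfolding threshold_cuts_def using u v by (intro CollectI exI[of _ u] exI[of _ 0] exI[of _ v]) auto
      ultimately have "min_side S {u} \<le> 0" using best b by (auto simp: best_def)
      then show False using S2 by (simp add: min_side_def)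
    qed
    have be: "be = cut_int E S C" and bmC: "bm = min_side S C" using best bm by (auto simp: best_def)
    have be0: "be \<ge> 0" using be cut_int_nonneg by simp
    have ratio: "(real_of_int be)\<^sup>2 \<le> 8 * real \<Delta> * lambda2_induced E S * (real_of_int bm)\<^sup>2"
      by (rule best_ratio_square_le[OF reg Sn S2 best bm])
    have C1: "C \<noteq> {}" using bm bmC by (auto simp: min_side_def)
    have C2: "S - C \<noteq> {}"
    proof
      assume "S - C = {}"
      then have "C = S" using CS by blast
      then show False using bm bmC by (simp add: min_side_def)
    qed
    \<comment> \<open>Both sides of the cut are nonempty: \<open>C\<close> takes the label j + 1,
      and S - C keeps \<open>q\<close> in use.\<close>
    have cover': "?l s' ` {..<n} = {0..int (Suc j)}"
    proof -
      have "\<not> inj_on (?l s) {..<n}" using u v uv by (auto simp: inj_on_def)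
      then have img: "?l s ` {..<n} = {0..int j}" using cover by blast
      have "x \<in> ?l s' ` {..<n}" if x: "x \<in> {0..int (Suc j)}" for x
      proof (cases "x = int (Suc j)")
        case True
        obtain w where "w \<in> C" using C1 by blast
        then have "?l s' w = x" "w < n" using lab CS Sn True by auto
        then show ?thesis by blast
      next
        case False
        then have "x \<in> ?l s ` {..<n}" using x img by auto
        then obtain w where w: "w < n" "?l s w = x" by auto
        show ?thesis
        proof (cases "x = q")
          case True
          obtain w' where "w' \<in> S" "w' \<notin> C" using C2 by blast
          then have "?l s' w' = x" "w' < n" using lab S True by auto
          then show ?thesis by blast
        next
          case False
          then have "w \<notin> C" using w CS S by auto
          then have "?l s' w = x" using lab w by simp
          then show ?thesis using w by blast
        qed
      qed
      moreover have "?l s' ` {..<n} \<subseteq> {0..int (Suc j)}" using range' by auto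
      ultimately show ?thesis by blast
    qed
    let ?better = "3 * (num * int n) \<le> 8 * (int (card S) * den) \<and> s ''Be'' 0 * bm < be * s ''Bm'' 0"
    have out': "\<exists>S. ind n s' ''out'' S \<and> 3 * (num * int n) \<le> 8 * (int (card S) * den) \<and> s' ''Bm'' 0 > 0 \<and> s' ''Be'' 0 \<ge> 0 \<and>
       (real_of_int (s' ''Be'' 0))\<^sup>2 \<le> 8 * real \<Delta> * lambda2_induced E S * (real_of_int (s' ''Bm'' 0))\<^sup>2"
    proof (cases ?better)
      case True
      then show ?thesis using rec ratio bm be0 by (intro exI[of _ S]) auto
    next
      case False
      then have "s' ''Be'' = s ''Be''" "s' ''Bm'' = s ''Bm''" "s' ''out'' = s ''out''" using rec by auto
      then show ?thesis using out ind_cong[of s' "''out''" s] by simp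
    qed
    \<comment> \<open>The recorded ratio never decreases.\<close>
    have keep: "\<phi> * real_of_int (s' ''Bm'' 0) \<le> real_of_int (s' ''Be'' 0)"
      if \<phi>0: "\<phi> > 0" and ok: "\<phi> * real_of_int (s ''Bm'' 0) \<le> real_of_int (s ''Be'' 0)"
    proof (cases ?better)
      case True
      have "\<phi> * bm * s ''Bm'' 0 = (\<phi> * s ''Bm'' 0) * bm" by simp
      also have "\<dots> \<le> real_of_int (s ''Be'' 0) * real_of_int bm" using ok bm by (intro mult_right_mono) auto
      also have "\<dots> < real_of_int be * real_of_int (s ''Bm'' 0)" using True by (metis of_int_less_iff of_int_mult)
      finally have "\<phi> * bm \<le> be" using Bm by simp
      then show ?thesis using True rec by simp
    next
      case False
      then show ?thesis using rec ok by auto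
    qed
    have good': "\<phi> * real_of_int (s' ''Bm'' 0) \<le> real_of_int (s' ''Be'' 0) \<or> (\<exists>q. heavy (adj E) T \<phi> n (piece s' q))"
      if \<phi>0: "\<phi> > 0"
    proof -
      from good \<phi>0 consider "\<phi> * real_of_int (s ''Bm'' 0) \<le> real_of_int (s ''Be'' 0)"
        | q' where "heavy (adj E) T \<phi> n (piece s q')" by blast
      then show ?thesis
      proof cases
        case 1
        then show ?thesis using keep \<phi>0 by blast
      next
        case (2 q')
        have T2: "card T \<ge> 2"
        proof (rule ccontr)
          assume "\<not> card T \<ge> 2"
          then have "lambda2_induced E T = 0" by (simp add: lambda2_induced_small)
          then show False using pos[OF \<phi>0] by simp
        qed
        have finT: "finite T" using T finite_subset by blast
        have "T \<inter> piece s q' \<noteq> {}" using 2 T2 by (auto simp: heavy_def)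
        then obtain w where w: "w < n" "?l s w = q'" by (auto simp: piece_def)
        \<comment> \<open>This separates the heavy label from the fresh label j + 1, so the split of
          another piece does not touch the heavy one.\<close>
        have q'j: "q' \<le> int j" using range w by auto
        show ?thesis
        proof (cases "q' = q")
          case False
          have "piece s' q' = piece s q'"
            unfolding piece_def using lab CS S False q'j by auto
          then show ?thesis using 2 by metis
        next
          case True
          have PS: "piece s q' = S" by (simp add: piece_def S True)
          have heavyS: "heavy (adj E) T \<phi> n S" using 2 PS by simp
          show ?thesis
          proof (cases "\<phi> * bm \<le> be")
            case True
            \<comment> \<open>A heavy piece has at least 3/4 |T| \<ge> 3 \<delta> n / 4 vertices and
              so passes the size test; if it is not recorded, the record is already at least as
              good.\<close>
            have "card (T \<inter> S) \<le> card S" using finS by (intro card_mono) auto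
            then have "3 * card T \<le> 4 * card S" using heavyS by (simp add: heavy_def)
            then have "3 * (int (card T) * den) \<le> 4 * (int (card S) * den)"
              using den mult_right_mono[of "3 * int (card T)" "4 * int (card S)" den] by simp
            moreover have "int (card S) * den \<ge> 0" using den by simp
            ultimately have big: "3 * (num * int n) \<le> 8 * (int (card S) * den)" using size by linarith
            show ?thesis
            proof (cases ?better)
              case b: True
              then show ?thesis using rec True by simp
            next
              case b: False
              then have "be * s ''Bm'' 0 \<le> s ''Be'' 0 * bm" using big by linarith
              then have le: "real_of_int be * real_of_int (s ''Bm'' 0) \<le> real_of_int (s ''Be'' 0) * real_of_int bm"
                by (metis of_int_le_iff of_int_mult)
              have "\<phi> * s ''Bm'' 0 * bm = (\<phi> * bm) * s ''Bm'' 0" by simp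
              also have "\<dots> \<le> real_of_int be * real_of_int (s ''Bm'' 0)" using True Bm by (intro mult_right_mono) auto
              also note le
              finally have "\<phi> * s ''Bm'' 0 \<le> s ''Be'' 0" using bm by simp
              then show ?thesis using keep \<phi>0 by blast
            qed
          next
            case False
            have "cut_weight (adj E) C (S - C) \<le> \<phi> * min (card C) (card S - card C)"
              using False unfolding be bmC real_cut_int real_min_side[OF finS CS] by simp
            moreover have "card S \<le> n" using card_mono[OF _ Sn] by simp
            moreover have "lambda2_induced E T * (card R * card (T - R)) \<le> card T * cut_weight (adj E) R (T - R)"
              if "R \<subseteq> T" for R
              by (rule lambda2_induced_cut[OF finT _ that]) (rule simple)
            moreover have "card T > 0" "0 \<le> \<phi>" using T2 \<phi>0 by simp_all
            ultimately have "heavy (adj E) T \<phi> n C \<or> heavy (adj E) T \<phi> n (S - C)"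
              by (intro heavy_split[OF finT finS CS _ adj_sym adj_nonneg _ _ \<phi> pos[OF \<phi>0] _ heavyS])
            moreover have "v \<in> C \<longleftrightarrow> v < n \<and> ?l s' v = int j + 1" for v
            proof (cases "v < n \<and> v \<notin> C")
              case True
              then have "?l s' v = ?l s v" "?l s v \<le> int j" using lab range by auto
              then show ?thesis using True by simp
            next
              case False
              then show ?thesis using lab CS Sn by auto
            qed
            then have "C = piece s' (int j + 1)" by (auto simp: piece_def)
            moreover have "v \<in> S - C \<longleftrightarrow> v < n \<and> ?l s' v = q" for v
            proof (cases "v \<in> C")
              case True
              then have "?l s' v = int j + 1" using lab CS Sn by auto
              then show ?thesis using True q'j \<open>q' = q\<close> by simp
            next
              case False
              then show ?thesis using lab by (auto simp: S)
            qed
            then have "S - C = piece s' q" by (auto simp: piece_def)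
            ultimately show ?thesis by metis
          qed
        qed
      qed
    qed
    show ?thesis unfolding invariant_def using range' cover' out' good' by blast
  qed
qed

text \<open>On \<open>n\<close> vertices n + 1 labels are impossible, so all labels are distinct
  after \<open>n\<close> rounds. A heavy piece with at most one vertex would force |T| \<le> 1 and
  hence \<lambda> = 0; so for \<phi> > 0 a ratio of at least \<phi> has been recorded, and its
  certificate gives the bound.\<close>

lemma invariant_final:
  assumes reg: "regular_graph {..<n} E \<Delta>" and \<phi>0: "0 \<le> \<phi>"
    and pos: "\<phi> > 0 \<Longrightarrow> lambda2_induced E T > 0" and inv: "invariant \<Delta> T \<phi> n s"
  shows "\<exists>S. ind n s ''out'' S \<and> 3 * (num * int n) \<le> 8 * (int (card S) * den) \<and>
    \<phi>\<^sup>2 \<le> 8 * real \<Delta> * lambda2_induced E S"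
proof -
  let ?l = "\<lambda>v. s ''lab'' (int v)"
  have simple: "\<And>e. e \<in> E \<Longrightarrow> \<exists>u v. u \<noteq> v \<and> e = {u, v}"
    using reg simple_graph_edge unfolding regular_graph_def by blast
  obtain S where S: "ind n s ''out'' S" "3 * (num * int n) \<le> 8 * (int (card S) * den)" "s ''Bm'' 0 > 0"
    and ratio: "(real_of_int (s ''Be'' 0))\<^sup>2 \<le> 8 * real \<Delta> * lambda2_induced E S * (real_of_int (s ''Bm'' 0))\<^sup>2"
    using inv by (auto simp: invariant_def)
  have finS: "finite S" using S(1) finite_subset by (auto simp: ind_def)
  have "\<phi>\<^sup>2 \<le> 8 * real \<Delta> * lambda2_induced E S"
  proof (cases "\<phi> = 0")
    case True
    then show ?thesis using lambda2_induced_nonneg[OF finS simple] by simp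
  next
    case False
    then have \<phi>1: "\<phi> > 0" using \<phi>0 by simp
    have "?l ` {..<n} \<noteq> {0..int n}"
    proof
      assume eq: "?l ` {..<n} = {0..int n}"
      have "card (?l ` {..<n}) \<le> n" using card_image_le[of "{..<n}" ?l] by simp
      then show False unfolding eq by simp
    qed
    then have inj: "inj_on ?l {..<n}" using inv by (simp add: invariant_def)
    have "\<not> heavy (adj E) T \<phi> n (piece s q)" for q
    proof
      assume h: "heavy (adj E) T \<phi> n (piece s q)"
      have "card (T \<inter> piece s q) \<le> 1"
        using inj by (intro card_le_Suc0_iff_eq[THEN iffD2, simplified One_nat_def[symmetric]] |
          auto simp: piece_def inj_on_def)+
      then have "card T < 2" using h by (simp add: heavy_def)
      then show False using pos[OF \<phi>1] by (simp add: lambda2_induced_small)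
    qed
    then have "\<phi> * real_of_int (s ''Bm'' 0) \<le> real_of_int (s ''Be'' 0)"
      using inv \<phi>1 by (auto simp: invariant_def)
    then have "(\<phi> * real_of_int (s ''Bm'' 0))\<^sup>2 \<le> (real_of_int (s ''Be'' 0))\<^sup>2"
      using \<phi>0 S(3) by (intro power_mono) auto
    also note ratio
    finally show ?thesis using S(3) by (simp add: power_mult_distrib)
  qed
  then show ?thesis using S by blast
qed

end

section \<open>Input encoding and assembly of the bounds\<close>

lemma length_concat_rows: "length (concat (map (\<lambda>u. map (f u) [0..<n]) [0..<k])) = k * n"
  by (induction k) auto

lemma nth_concat_rows:
  "u < k \<Longrightarrow> v < n \<Longrightarrow> concat (map (\<lambda>u. map (f u) [0..<n]) [0..<k]) ! (u * n + v) = f u v"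
proof (induction k)
  case (Suc k)
  show ?case
  proof (cases "u = k")
    case True
    then show ?thesis using Suc.prems by (simp add: nth_append length_concat_rows)
  next
    case False
    then have u: "u < k" using Suc.prems by simp
    have "u * n + v < (u + 1) * n" using Suc.prems by simp
    also have "\<dots> \<le> k * n" using u by (intro mult_right_mono) auto
    finally show ?thesis using Suc u by (simp add: nth_append length_concat_rows)
  qed
qed simp

lemma length_le_input_size: "length xs \<le> input_size xs"
  by (induction xs) (auto simp: input_size_def bit_size_def)

lemma bit_size_le_input_size: "x \<in> set xs \<Longrightarrow> bit_size x \<le> input_size xs"
  unfolding input_size_def by (rule member_le_sum_list) auto

lemma encode_facts:
  fixes n :: nat and E :: "nat set set"
  assumes "quotient_of \<delta> = (a, b)"
  defines "s \<equiv> input_state (encode (n, E, \<delta>))"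
  shows "s ''in'' 0 = int n" "s ''in'' 1 = a" "s ''in'' 2 = b"
    and "\<And>u v. u < n \<Longrightarrow> v < n \<Longrightarrow> s ''in'' (3 + (int u * int n + int v)) = adj_int E u v"
    and "length (encode (n, E, \<delta>)) = 3 + n * n"
    and "\<And>x. x \<noteq> ''in'' \<Longrightarrow> s x = (\<lambda>_. 0)"
proof -
  define rows where "rows = concat (map (\<lambda>u. map (\<lambda>v. if {u, v} \<in> E then 1 else 0) [0..<n]) [0..<n] :: int list list)"
  have enc: "encode (n, E, \<delta>) = [int n, a, b] @ rows" using assms by (simp add: encode_def rows_def)
  have len: "length rows = n * n" unfolding rows_def by (rule length_concat_rows)
  show "length (encode (n, E, \<delta>)) = 3 + n * n" by (simp add: enc len)
  show "s ''in'' 0 = int n" "s ''in'' 1 = a" "s ''in'' 2 = b"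
    by (simp_all add: s_def input_state_def enc)
  show "s x = (\<lambda>_. 0)" if "x \<noteq> ''in''" for x using that by (simp add: s_def input_state_def fun_eq_iff)
  fix u v assume uv: "u < n" "v < n"
  have "u * n + v < (u + 1) * n" using uv by simp
  also have "\<dots> \<le> n * n" using uv by (intro mult_right_mono) auto
  finally have lt: "u * n + v < n * n" .
  have i: "3 + (int u * int n + int v) = int (3 + (u * n + v))" by simp
  have "s ''in'' (3 + (int u * int n + int v)) = ([int n, a, b] @ rows) ! (3 + (u * n + v))"
    unfolding i s_def input_state_def enc using lt len by (simp del: of_nat_add of_nat_mult)
  also have "\<dots> = rows ! (u * n + v)" by (simp add: nth_append)
  also have "\<dots> = adj_int E u v"
    unfolding rows_def by (subst nth_concat_rows[OF uv]) (simp add: adj_int_def)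
  finally show "s ''in'' (3 + (int u * int n + int v)) = adj_int E u v" .
qed

theorem theorem1p3:
  shows "\<exists>(c :: real) (alg :: com). c > 0 \<and>
    poly_time_solves alg encode instances
      (\<lambda>(n, E, \<delta>) s. \<forall>\<Delta>. regular_graph {..<n} E \<Delta> \<longrightarrow>
         (let S = output_set n s; lam = lambda_max {..<n} E (of_rat \<delta>) in
           S \<subseteq> {..<n} \<and>
           real (card S) \<ge> 3 * of_rat \<delta> * real n / 8 \<and>
           lambda2_induced E S \<ge>
             c * ((of_rat \<delta>)\<^sup>2 * lam\<^sup>2 / (real \<Delta> * log_sq (of_rat \<delta>)))))"
proof -
  obtain p :: "nat poly" where p: "\<And>M. cost M main_com = poly p M" using cost_poly by blast
  \<comment> \<open>\<open>Mp\<close> covers the power iteration with its 8 n^5 steps and the loops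
    over vertices. In \<open>Bp\<close> the term of degree 6 is the bit length of the iterates, from
    (2 n)^(8 n^5) \<le> 2^(2 n * 8 n^5); the others leave room for counters, edge counts and input
    numbers.\<close>
  define Mp :: "nat poly" where "Mp = monom 8 5 + monom 1 1"
  define Bp :: "nat poly" where "Bp = monom 16 6 + monom 8 5 + monom 1 2 + monom 1 1 + [:2:]"
  have "poly_time_solves main_com encode instances
      (\<lambda>(n, E, \<delta>) s. \<forall>\<Delta>. regular_graph {..<n} E \<Delta> \<longrightarrow>
         (let S = output_set n s; lam = lambda_max {..<n} E (of_rat \<delta>) in
           S \<subseteq> {..<n} \<and>
           real (card S) \<ge> 3 * of_rat \<delta> * real n / 8 \<and>
           lambda2_induced E S \<ge>
             1 / 512 * ((of_rat \<delta>)\<^sup>2 * lam\<^sup>2 / (real \<Delta> * log_sq (of_rat \<delta>)))))"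
    unfolding poly_time_solves_def
  proof (rule exI[of _ "pcompose p Mp * Bp"], rule ballI)
    fix x :: "nat \<times> nat set set \<times> rat"
    assume "x \<in> instances"
    moreover obtain n E \<delta> where x: "x = (n, E, \<delta>)" by (cases x) auto
    ultimately have \<delta>: "0 < \<delta>" "\<delta> < 1" and "\<exists>\<Delta>. regular_graph {..<n} E \<Delta>" by (auto simp: instances_def)
    then have simple: "\<And>e. e \<in> E \<Longrightarrow> \<exists>u v. u \<noteq> v \<and> e = {u, v}"
      using simple_graph_edge unfolding regular_graph_def by blast
    obtain a b where ab: "quotient_of \<delta> = (a, b)" by fastforce
    have b: "b > 0" using quotient_of_denom_pos[OF ab] .
    have \<delta>ab: "of_rat \<delta> = real_of_int a / real_of_int b"
      using quotient_of_div[OF ab] by (simp add: of_rat_divide)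
    have a: "a > 0"
    proof -
      have "0 < real_of_int a / real_of_int b" using \<delta>(1) \<delta>ab by (metis zero_less_of_rat_iff)
      then show ?thesis using b by (simp add: zero_less_divide_iff)
    qed
    have r\<delta>: "0 < real_of_rat \<delta>" "real_of_rat \<delta> < 1" using \<delta> by auto
    have "real_of_int a < real_of_int b" using r\<delta> \<delta>ab b by (simp add: field_simps)
    then have ab1: "a < b" by simp
    define xs where "xs = encode (n, E, \<delta>)"
    define N where "N = input_size xs"
    define M where "M = poly Mp N"
    define B where "B = poly Bp N"
    note enc = encode_facts[where n = n and E = E, OF ab, folded xs_def]
    \<comment> \<open>Each of the n^2 matrix entries contributes at least one bit to the input size
      \<open>N\<close>.\<close>
    have "n \<le> n * n" by (cases n) auto
    moreover have "3 + n * n \<le> N" using length_le_input_size[of xs] enc(5) by (simp add: N_def)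
    ultimately have nN: "n \<le> N" "n * n \<le> N" by linarith+
    have M: "M = 8 * N ^ 5 + N" by (simp add: M_def Mp_def poly_monom)
    have B: "B = 16 * N ^ 6 + 8 * N ^ 5 + N\<^sup>2 + N + 2" by (simp add: B_def Bp_def poly_monom)
    have pow_le: "int x \<le> 2 ^ B" if "x \<le> B" for x
    proof -
      have "x \<le> 2 ^ x" by (simp add: less_imp_le)
      also have "\<dots> \<le> 2 ^ B" using that by (intro power_increasing) auto
      finally show ?thesis by (metis of_nat_le_iff of_nat_numeral of_nat_power)
    qed
    have n5: "8 * n ^ 5 \<le> 8 * N ^ 5" using nN by (simp add: power_mono)
    interpret ram_run n E a b M B
    proof
      show "1 \<le> B" by (simp add: B)
      show "n \<le> M" using nN by (simp add: M)
      show "8 * n ^ 5 \<le> M" using n5 unfolding M by linarith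
      have "8 * n ^ 5 \<le> B" using n5 unfolding B by linarith
      then show "8 * int n ^ 5 \<le> 2 ^ B" using pow_le[of "8 * n ^ 5"] by simp
      have "n * n + 2 \<le> B" using nN unfolding B by linarith
      then show "int n * int n + 2 \<le> 2 ^ B" using pow_le[of "n * n + 2"] by simp
      have "(2 * n) ^ (8 * n ^ 5) \<le> (2 ^ (2 * n)) ^ (8 * n ^ 5)"
        by (intro power_mono) (auto intro: less_imp_le)
      also have "\<dots> = 2 ^ (2 * n * (8 * n ^ 5))" by (simp only: power_mult)
      also have "2 * n * (8 * n ^ 5) = 16 * n ^ 6" by (simp flip: power_Suc)
      also have "(2::nat) ^ (16 * n ^ 6) \<le> 2 ^ B"
      proof (rule power_increasing)
        have "16 * n ^ 6 \<le> 16 * N ^ 6" using nN by (simp add: power_mono)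
        then show "16 * n ^ 6 \<le> B" unfolding B by linarith
      qed simp
      finally have "int ((2 * n) ^ (8 * n ^ 5)) \<le> int (2 ^ B)" by (simp only: of_nat_le_iff)
      then show "(2 * int n) ^ (8 * n ^ 5) \<le> 2 ^ B" by simp
    qed
    let ?s = "input_state xs"
    have inp: "is_input (?s ''in'')" using enc by (simp add: is_input_def)
    have bd: "bounded B ?s"
      unfolding bounded_def
    proof (intro allI)
      fix x i
      show "\<bar>?s x i\<bar> \<le> 2 ^ B"
      proof (cases "x = ''in'' \<and> 0 \<le> i \<and> i < int (length xs)")
        case True
        then have "xs ! nat i \<in> set xs" by (intro nth_mem) auto
        then have "bit_size (xs ! nat i) \<le> N" unfolding N_def by (rule bit_size_le_input_size)
        then have "(2::int) ^ bit_size (xs ! nat i) \<le> 2 ^ B" by (intro power_increasing) (auto simp: B)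
        then have "\<bar>xs ! nat i\<bar> \<le> 2 ^ B" by (rule order_trans[OF abs_le_bit_size])
        then show ?thesis using True by (simp add: input_state_def)
      qed (auto simp: input_state_def)
    qed
    define lam where "lam = lambda_max {..<n} E (of_rat \<delta>)"
    \<comment> \<open>Since \<delta> < 1, the whole vertex set is a candidate, so the maximum over
      finitely many candidates is attained.\<close>
    obtain T where T: "T \<subseteq> {..<n}" "of_rat \<delta> * real n \<le> real (card T)" "lam = lambda2_induced E T"
    proof -
      let ?X = "{lambda2_induced E S | S. S \<subseteq> {..<n} \<and> real (card S) \<ge> of_rat \<delta> * real (card {..<n})}"
      have "?X \<subseteq> lambda2_induced E ` Pow {..<n}" by auto
      then have fin: "finite ?X" by (rule finite_subset) simp
      have "of_rat \<delta> * real n \<le> real n" using r\<delta> by (intro mult_left_le_one_le) auto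
      then have "lambda2_induced E {..<n} \<in> ?X" by (intro CollectI exI[of _ "{..<n}"]) auto
      then have "lam \<in> ?X" unfolding lam_def lambda_max_def using fin by (intro Max_in) auto
      then show ?thesis using that by auto
    qed
    have lam0: "lam \<ge> 0"
      unfolding T(3) using T(1) finite_subset by (intro lambda2_induced_nonneg) (auto simp: simple)
    \<comment> \<open>The divisor 8 and \<delta> n \<le> |T| give the edge budget \<phi> n \<le>
      \<lambda> |T| / 8 of the charging argument.\<close>
    define \<phi> where "\<phi> = of_rat \<delta> * lam / 8"
    have \<phi>0: "\<phi> \<ge> 0" using lam0 r\<delta> by (simp add: \<phi>_def)
    have pos: "\<phi> > 0 \<Longrightarrow> lambda2_induced E T > 0"
      using T(3) r\<delta> by (simp add: \<phi>_def zero_less_mult_iff)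
    have \<phi>T: "8 * \<phi> * n \<le> lambda2_induced E T * card T"
      using mult_left_mono[OF T(2) lam0] T(3) by (simp add: \<phi>_def mult_ac)
    have size: "a * int n \<le> int (card T) * b"
    proof -
      have "real_of_int a * real n \<le> real (card T) * real_of_int b"
        using T(2) b by (simp add: \<delta>ab field_simps)
      then have "real_of_int (a * int n) \<le> real_of_int (int (card T) * b)" by simp
      then show ?thesis by (simp only: of_int_le_iff)
    qed
    \<comment> \<open>The run must be found before \<Delta> is given, and the empty graph is regular
      of every degree; so the invariant is claimed for all admissible \<Delta> at once.\<close>
    let ?I = "\<lambda>j s. \<forall>\<Delta>. regular_graph {..<n} E \<Delta> \<longrightarrow> invariant \<Delta> T \<phi> j s"
    have "wp M B main_com (?I n) ?s"
    proof (rule wp_main[where s = ?s and I = ?I, OF inp])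
      fix s' assume s': "ind n s' ''out'' {..<n}" "s' ''Be'' = ?s ''Be''" "s' ''Bm'' 0 = 1" "s' ''lab'' = ?s ''lab''"
      have z: "s' ''Be'' = (\<lambda>_. 0)" "s' ''lab'' = (\<lambda>_. 0)" using s' enc(6) by auto
      have "piece s' 0 = {..<n}" by (auto simp: piece_def z)
      \<comment> \<open>Nothing of \<open>T\<close> is separated and no vertex is discarded, so both
        sides of the charging inequality are 0.\<close>
      moreover have "heavy (adj E) T \<phi> n {..<n}"
        using T(1) by (simp add: heavy_def Int_absorb2 cut_weight_def Diff_eq_empty_iff[THEN iffD2])
      ultimately have h: "\<exists>q. heavy (adj E) T \<phi> n (piece s' q)" by metis
      have "3 * (a * int n) \<le> 8 * (int n * b)"
      proof -
        have "a * int n \<le> b * int n" "0 \<le> b * int n" using ab1 b by (auto intro: mult_right_mono)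
        then show ?thesis unfolding mult.commute[of "int n" b] by linarith
      qed
      moreover have "inj_on (\<lambda>v. s' ''lab'' (int v)) {..<n} \<or> (\<lambda>v. s' ''lab'' (int v)) ` {..<n} = {0..int 0}"
        by (cases "n = 0") (auto simp: z)
      moreover have "lambda2_induced E {..<n} \<ge> 0" by (intro lambda2_induced_nonneg) (auto simp: simple)
      ultimately show "?I 0 s'"
        using h s'(1,3) unfolding invariant_def z by (auto intro!: exI[of _ "{..<n}"])
    next
      show "?I j (s'(''r'' := f)) = ?I j s'" for j f s' by (simp add: invariant_def piece_def)
    next
      show "?I (Suc j) s''" if "j < n" "?I j s'" "round_rel j s' s''" for j s' s''
        using invariant_round[OF _ T(1) a b size \<phi>T pos that(1) _ that(3)] that(2) by blast
    qed
    then obtain t s where run: "exec main_com ?s t s" "t \<le> cost M main_com * B" "?I n s"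
      using bd unfolding wp_def by blast
    have time: "t \<le> poly (pcompose p Mp * Bp) N"
      using run(2) by (simp add: p M_def B_def poly_pcompose)
    have ok: "output_set n s \<subseteq> {..<n} \<and> real (card (output_set n s)) \<ge> 3 * of_rat \<delta> * real n / 8 \<and>
        lambda2_induced E (output_set n s) \<ge> 1 / 512 * ((of_rat \<delta>)\<^sup>2 * lam\<^sup>2 / (real \<Delta> * log_sq (of_rat \<delta>)))"
      if reg: "regular_graph {..<n} E \<Delta>" for \<Delta>
    proof -
      have "invariant \<Delta> T \<phi> n s" using run(3) reg by blast
      from invariant_final[OF reg \<phi>0 pos this] obtain S where S: "ind n s ''out'' S"
        "3 * (a * int n) \<le> 8 * (int (card S) * b)" "\<phi>\<^sup>2 \<le> 8 * real \<Delta> * lambda2_induced E S" by blast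
      have out: "output_set n s = S" using S(1) by (auto simp: output_set_def ind_def split: if_splits)
      have Sn: "S \<subseteq> {..<n}" using S(1) by (simp add: ind_def)
      have "real_of_int (3 * (a * int n)) \<le> real_of_int (8 * (int (card S) * b))"
        using S(2) by (simp only: of_int_le_iff)
      then have sizeS: "3 * real_of_rat \<delta> * real n / 8 \<le> real (card S)"
        using b by (simp add: \<delta>ab field_simps)
      have l0: "lambda2_induced E S \<ge> 0"
        using Sn finite_subset by (intro lambda2_induced_nonneg) (auto simp: simple)
      have "1 / 512 * ((of_rat \<delta>)\<^sup>2 * lam\<^sup>2 / (real \<Delta> * log_sq (of_rat \<delta>))) \<le> lambda2_induced E S"
      \<comment> \<open>For \<Delta> = 0 division by zero makes the claimed bound 0. Otherwise the
        logarithmic factor is bounded below by 1, and \<phi>^2 / (8 \<Delta>) is \<delta>^2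
        \<lambda>^2 / (512 \<Delta>).\<close>
      proof (cases "\<Delta> = 0")
        case True
        then show ?thesis using l0 by simp
      next
        case False
        have lg: "log_sq (of_rat \<delta>) \<ge> 1" by (simp add: log_sq_def)
        have "1 / 512 * ((of_rat \<delta>)\<^sup>2 * lam\<^sup>2 / (real \<Delta> * log_sq (of_rat \<delta>))) \<le>
            1 / 512 * ((of_rat \<delta>)\<^sup>2 * lam\<^sup>2 / (real \<Delta> * 1))"
          using False lg by (intro mult_left_mono divide_left_mono mult_pos_pos) auto
        also have "\<dots> = \<phi>\<^sup>2 / (8 * real \<Delta>)" by (simp add: \<phi>_def power_divide power_mult_distrib)
        also have "\<dots> \<le> lambda2_induced E S" using S(3) False by (simp add: field_simps)
        finally show ?thesis .
      qed
      then show ?thesis unfolding out using Sn sizeS by blast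
    qed
    show "\<exists>t s. exec main_com (input_state (encode x)) t s \<and>
        t \<le> poly (pcompose p Mp * Bp) (input_size (encode x)) \<and>
        (\<lambda>(n, E, \<delta>) s. \<forall>\<Delta>. regular_graph {..<n} E \<Delta> \<longrightarrow>
         (let S = output_set n s; lam = lambda_max {..<n} E (of_rat \<delta>) in
           S \<subseteq> {..<n} \<and>
           real (card S) \<ge> 3 * of_rat \<delta> * real n / 8 \<and>
           lambda2_induced E S \<ge>
             1 / 512 * ((of_rat \<delta>)\<^sup>2 * lam\<^sup>2 / (real \<Delta> * log_sq (of_rat \<delta>))))) x s"
      unfolding x prod.case Let_def lam_def[symmetric] xs_def[symmetric] N_def[symmetric]
      using run(1) time ok by blast
  qed
  then show ?thesis by (intro exI[of _ "1 / 512"] exI[of _ main_com]) simp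
qed

end
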